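(* Let $R$ be a commutative ring, $A$ a commutative $R$-algebra, $M,N$ left $A$-modules, $K/\mathbb{Q}$ an algebraic field extension, and $\lambda:A\to\mathcal{O}_K\otimes_{\mathbb{Z}}R$ an $R$-algebra morphism. Then there exists a unique $A$-bimodule map $$\chi:\operatorname{Hom}_R(M,N)\otimes_AM^\lambda\to N^\lambda$$ such that the composite of $\chi$ with the natural quotient map $\operatorname{Hom}_R(M,N)\otimes_RM^\lambda\to\operatorname{Hom}_R(M,N)\otimes_AM^\lambda$ is the evaluation map sending $f\otimes(c\otimes m)$ to $c\otimes f(m)$. Consequently the composite of the cup product $$HH^*(A;\operatorname{Hom}_R(M,N))\otimes_RHH^*(A;M^\lambda)\xrightarrow{\ \cup\ }HH^*(A;\operatorname{Hom}_R(M,N)\otimes_AM^\lambda)$$ with the map $HH^*(A;\chi):HH^*(A;\operatorname{Hom}_R(M,N)\otimes_AM^\lambda)\to HH^*(A;N^\lambda)$ is an $R$-linear map $$HH^*(A;\operatorname{Hom}_R(M,N))\otimes_RHH^*(A;M^\lambda)\to HH^*(A;N^\lambda),$$ i.e. it defines an $R$-bilinear product (the "dot-cup product").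
   Context: $\mathcal{O}_K$ is the ring of integers of $K$. $M^\lambda$ denotes $\mathcal{O}_K\otimes_{\mathbb{Z}}M$ regarded as an $A$-bimodule with left action the $\mathcal{O}_K$-linear extension of the given action of $A$ on $M$ and right action $m\cdot a=\lambda(a)m$; similarly $N^\lambda$. $\operatorname{Hom}_R(M,N)$ is an $A$-bimodule via $(a\cdot f)(m)=af(m)$ and $(f\cdot a)(m)=f(am)$. $HH^*(A;-)$ is Hochschild cohomology of the $R$-algebra $A$. The cup product of a Hochschild $i$-cochain $f:A^{\otimes_Ri}\to B$ and a $j$-cochain $g:A^{\otimes_Rj}\to C$ ($B,C$ $A$-bimodules) is the $(i+j)$-cochain $A^{\otimes_R(i+j)}\to B\otimes_AC$ given by $a_1\otimes\dots\otimes a_{i+j}\mapsto f(a_1\otimes\dots\otimes a_i)\otimes g(a_{i+1}\otimes\dots\otimes a_{i+j})$; it induces the cup product on Hochschild cohomology. *)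

theory Defs
  imports
    "HOL-Computational_Algebra.Polynomial"
    "HOL-Algebra.Module"
    "HOL-Algebra.IntRing"
    "HOL-Algebra.Free_Abelian_Groups"
begin

section \<open>Modules and bimodules over a commutative algebra\<close>

text \<open>A module is a ring record of which only the additive part and the
  scalar multiplication matter; the fields \<open>mult\<close> and \<open>one\<close> are \<open>undefined\<close> below unless
  the object is a ring.\<close>

record ('a, 'b) bimodule = "('a, 'b) module" +
  rsmult :: "['b, 'a] \<Rightarrow> 'b"

text \<open>A right module over a commutative ring is a left module.\<close>

definition right_module :: "('a, 'b, 'e) bimodule_scheme \<Rightarrow> ('a, 'b) module" where
  "right_module B = \<lparr>carrier = carrier B, mult = undefined, one = undefined,
     ring.zero = ring.zero B, add = add B, smult = (\<lambda>a x. rsmult B x a)\<rparr>"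

text \<open>Bimodules over an \<open>R\<close>-algebra \<open>A\<close>: \<open>R\<close> acts in the same way from both sides.\<close>

definition is_bimodule ::
  "('r, 'p) ring_scheme \<Rightarrow> ('r, 'a, 'q) module_scheme \<Rightarrow> ('a, 'b, 'e) bimodule_scheme \<Rightarrow> bool"
where
  "is_bimodule R A B \<longleftrightarrow> algebra R A \<and> module A B \<and> module A (right_module B)
     \<and> (\<forall>a\<in>carrier A. \<forall>b\<in>carrier A. \<forall>x\<in>carrier B.
           rsmult B (a \<odot>\<^bsub>B\<^esub> x) b = a \<odot>\<^bsub>B\<^esub> rsmult B x b)
     \<and> (\<forall>r\<in>carrier R. \<forall>x\<in>carrier B.
           (r \<odot>\<^bsub>A\<^esub> \<one>\<^bsub>A\<^esub>) \<odot>\<^bsub>B\<^esub> x = rsmult B x (r \<odot>\<^bsub>A\<^esub> \<one>\<^bsub>A\<^esub>))"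

text \<open>Maps are taken extensional (\<open>undefined\<close> outside the carrier), so that equality of maps
  is equality of functions.\<close>

definition bimodule_hom ::
  "('r, 'p) ring_scheme \<Rightarrow> ('r, 'a, 'q) module_scheme \<Rightarrow> ('a, 'b, 'e) bimodule_scheme
    \<Rightarrow> ('a, 'c, 'f) bimodule_scheme \<Rightarrow> ('b \<Rightarrow> 'c) \<Rightarrow> bool"
where
  "bimodule_hom R A B C h \<longleftrightarrow> is_bimodule R A B \<and> is_bimodule R A C
     \<and> h \<in> carrier B \<rightarrow>\<^sub>E carrier C
     \<and> (\<forall>x\<in>carrier B. \<forall>y\<in>carrier B. h (x \<oplus>\<^bsub>B\<^esub> y) = h x \<oplus>\<^bsub>C\<^esub> h y)
     \<and> (\<forall>a\<in>carrier A. \<forall>x\<in>carrier B. h (a \<odot>\<^bsub>B\<^esub> x) = a \<odot>\<^bsub>C\<^esub> h x)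
     \<and> (\<forall>a\<in>carrier A. \<forall>x\<in>carrier B. h (rsmult B x a) = rsmult C (h x) a)"

definition linear_map ::
  "('r, 'p) ring_scheme \<Rightarrow> ('r, 'b, 'e) module_scheme \<Rightarrow> ('r, 'c, 'f) module_scheme
    \<Rightarrow> ('b \<Rightarrow> 'c) \<Rightarrow> bool"
where
  "linear_map R X Y h \<longleftrightarrow> module R X \<and> module R Y
     \<and> h \<in> carrier X \<rightarrow>\<^sub>E carrier Y
     \<and> (\<forall>x\<in>carrier X. \<forall>y\<in>carrier X. h (x \<oplus>\<^bsub>X\<^esub> y) = h x \<oplus>\<^bsub>Y\<^esub> h y)
     \<and> (\<forall>r\<in>carrier R. \<forall>x\<in>carrier X. h (r \<odot>\<^bsub>X\<^esub> x) = r \<odot>\<^bsub>Y\<^esub> h x)"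

definition bilinear_map ::
  "('r, 'p) ring_scheme \<Rightarrow> ('r, 'b, 'e) module_scheme \<Rightarrow> ('r, 'c, 'f) module_scheme
    \<Rightarrow> ('r, 'd, 'g) module_scheme \<Rightarrow> ('b \<Rightarrow> 'c \<Rightarrow> 'd) \<Rightarrow> bool"
where
  "bilinear_map R X Y Z b \<longleftrightarrow>
     (\<forall>x\<in>carrier X. linear_map R Y Z (\<lambda>y\<in>carrier Y. b x y))
     \<and> (\<forall>y\<in>carrier Y. linear_map R X Z (\<lambda>x\<in>carrier X. b x y))"

definition alg_hom ::
  "('r, 'p) ring_scheme \<Rightarrow> ('r, 'b, 'e) module_scheme \<Rightarrow> ('r, 'c, 'f) module_scheme
    \<Rightarrow> ('b \<Rightarrow> 'c) set"
where
  "alg_hom R A B = {h \<in> ring_hom A B.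
     \<forall>r\<in>carrier R. \<forall>a\<in>carrier A. h (r \<odot>\<^bsub>A\<^esub> a) = r \<odot>\<^bsub>B\<^esub> h a}"

text \<open>A module over a commutative ring as a bimodule; in particular every abelian group
  as a bimodule over the integers.\<close>

definition symm_bimodule :: "('a, 'b, 'e) module_scheme \<Rightarrow> ('a, 'b) bimodule" where
  "symm_bimodule X = \<lparr>carrier = carrier X, mult = undefined, one = undefined,
     ring.zero = ring.zero X, add = add X, smult = smult X, rsmult = (\<lambda>x a. a \<odot>\<^bsub>X\<^esub> x)\<rparr>"

definition int_bimodule :: "('b, 'e) ring_scheme \<Rightarrow> (int, 'b) bimodule" where
  "int_bimodule X = \<lparr>carrier = carrier X, mult = undefined, one = undefined,
     ring.zero = ring.zero X, add = add X, smult = (\<lambda>k x. [k] \<cdot>\<^bsub>X\<^esub> x), rsmult = (\<lambda>x k. [k] \<cdot>\<^bsub>X\<^esub> x)\<rparr>"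

text \<open>Restriction of scalars along \<open>R \<rightarrow> A\<close>, \<open>r \<mapsto> r \<odot> 1\<close>.\<close>

definition restrict_scalars ::
  "('r, 'a, 'q) module_scheme \<Rightarrow> ('a, 'b, 'e) bimodule_scheme \<Rightarrow> ('r, 'b) bimodule"
where
  "restrict_scalars A B = \<lparr>carrier = carrier B, mult = undefined, one = undefined,
     ring.zero = ring.zero B, add = add B,
     smult = (\<lambda>r x. (r \<odot>\<^bsub>A\<^esub> \<one>\<^bsub>A\<^esub>) \<odot>\<^bsub>B\<^esub> x),
     rsmult = (\<lambda>x r. rsmult B x (r \<odot>\<^bsub>A\<^esub> \<one>\<^bsub>A\<^esub>))\<rparr>"

text \<open>\<open>Hom\<^sub>R(M, N)\<close> for \<open>A\<close>-modules \<open>M\<close> and \<open>N\<close>.\<close>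

definition Hom_bimodule ::
  "('r, 'p) ring_scheme \<Rightarrow> ('r, 'a, 'q) module_scheme \<Rightarrow> ('a, 'm, 'e) module_scheme
    \<Rightarrow> ('a, 'n, 'f) module_scheme \<Rightarrow> ('a, 'm \<Rightarrow> 'n) bimodule"
where
  "Hom_bimodule R A M N = \<lparr>
     carrier = {f \<in> carrier M \<rightarrow>\<^sub>E carrier N.
       (\<forall>x\<in>carrier M. \<forall>y\<in>carrier M. f (x \<oplus>\<^bsub>M\<^esub> y) = f x \<oplus>\<^bsub>N\<^esub> f y)
       \<and> (\<forall>r\<in>carrier R. \<forall>x\<in>carrier M.
            f ((r \<odot>\<^bsub>A\<^esub> \<one>\<^bsub>A\<^esub>) \<odot>\<^bsub>M\<^esub> x) = (r \<odot>\<^bsub>A\<^esub> \<one>\<^bsub>A\<^esub>) \<odot>\<^bsub>N\<^esub> f x)},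
     mult = undefined, one = undefined,
     ring.zero = (\<lambda>x\<in>carrier M. \<zero>\<^bsub>N\<^esub>),
     add = (\<lambda>f g. \<lambda>x\<in>carrier M. f x \<oplus>\<^bsub>N\<^esub> g x),
     smult = (\<lambda>a f. \<lambda>x\<in>carrier M. a \<odot>\<^bsub>N\<^esub> f x),
     rsmult = (\<lambda>f a. \<lambda>x\<in>carrier M. f (a \<odot>\<^bsub>M\<^esub> x))\<rparr>"


section \<open>Tensor products\<close>

text \<open>\<open>X \<otimes>\<^sub>S Y\<close> is the free abelian group on \<open>X \<times> Y\<close> modulo biadditivity and
  \<open>x s \<otimes> y = x \<otimes> s y\<close>, using the right action on \<open>X\<close> and the left action on \<open>Y\<close>.\<close>

definition tensor_relations ::
  "('s, 'u) ring_scheme \<Rightarrow> ('s, 'x, 'e) bimodule_scheme \<Rightarrow> ('s, 'y, 'f) bimodule_scheme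
    \<Rightarrow> (('x \<times> 'y) \<Rightarrow>\<^sub>0 int) set"
where
  "tensor_relations S X Y =
     {frag_of (x \<oplus>\<^bsub>X\<^esub> x', y) - frag_of (x, y) - frag_of (x', y) | x x' y.
        x \<in> carrier X \<and> x' \<in> carrier X \<and> y \<in> carrier Y}
   \<union> {frag_of (x, y \<oplus>\<^bsub>Y\<^esub> y') - frag_of (x, y) - frag_of (x, y') | x y y'.
        x \<in> carrier X \<and> y \<in> carrier Y \<and> y' \<in> carrier Y}
   \<union> {frag_of (rsmult X x s, y) - frag_of (x, s \<odot>\<^bsub>Y\<^esub> y) | x s y.
        x \<in> carrier X \<and> s \<in> carrier S \<and> y \<in> carrier Y}"

definition tensor_null ::
  "('s, 'u) ring_scheme \<Rightarrow> ('s, 'x, 'e) bimodule_scheme \<Rightarrow> ('s, 'y, 'f) bimodule_scheme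
    \<Rightarrow> (('x \<times> 'y) \<Rightarrow>\<^sub>0 int) set"
where
  "tensor_null S X Y =
     generate (free_Abelian_group (carrier X \<times> carrier Y)) (tensor_relations S X Y)"

definition tensor_group ::
  "('s, 'u) ring_scheme \<Rightarrow> ('s, 'x, 'e) bimodule_scheme \<Rightarrow> ('s, 'y, 'f) bimodule_scheme
    \<Rightarrow> (('x \<times> 'y) \<Rightarrow>\<^sub>0 int) set monoid"
where
  "tensor_group S X Y = free_Abelian_group (carrier X \<times> carrier Y) Mod tensor_null S X Y"

definition pure_tensor ::
  "('s, 'u) ring_scheme \<Rightarrow> ('s, 'x, 'e) bimodule_scheme \<Rightarrow> ('s, 'y, 'f) bimodule_scheme
    \<Rightarrow> 'x \<Rightarrow> 'y \<Rightarrow> (('x \<times> 'y) \<Rightarrow>\<^sub>0 int) set"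
where
  "pure_tensor S X Y x y =
     tensor_null S X Y #>\<^bsub>free_Abelian_group (carrier X \<times> carrier Y)\<^esub> frag_of (x, y)"

definition tensor_ring ::
  "('s, 'u) ring_scheme \<Rightarrow> ('s, 'x, 'e) bimodule_scheme \<Rightarrow> ('s, 'y, 'f) bimodule_scheme
    \<Rightarrow> (('x \<times> 'y) \<Rightarrow>\<^sub>0 int) set ring"
where
  "tensor_ring S X Y = \<lparr>carrier = carrier (tensor_group S X Y),
     mult = undefined, one = undefined,
     ring.zero = one (tensor_group S X Y), add = mult (tensor_group S X Y)\<rparr>"

text \<open>The additive map into \<open>Z\<close> induced by a balanced biadditive map \<open>b\<close>: a coset is sent to the
  common value of \<open>\<Sum> k\<^sub>i b(x\<^sub>i, y\<^sub>i)\<close> on its members \<open>\<Sum> k\<^sub>i (x\<^sub>i, y\<^sub>i)\<close>.\<close>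

definition tensor_lift ::
  "('z, 'e) ring_scheme \<Rightarrow> ('x \<Rightarrow> 'y \<Rightarrow> 'z) \<Rightarrow> (('x \<times> 'y) \<Rightarrow>\<^sub>0 int) set \<Rightarrow> 'z"
where
  "tensor_lift Z b t = the_elem
     ((\<lambda>c. \<Oplus>\<^bsub>Z\<^esub>p\<in>Poly_Mapping.keys c. [Poly_Mapping.lookup c p] \<cdot>\<^bsub>Z\<^esub> b (fst p) (snd p)) ` t)"

text \<open>The left action on \<open>X \<otimes>\<^sub>S Y\<close> is that on \<open>X\<close>, the right action is that on \<open>Y\<close>.\<close>

definition tensor ::
  "('s, 'u) ring_scheme \<Rightarrow> ('s, 'x, 'e) bimodule_scheme \<Rightarrow> ('s, 'y, 'f) bimodule_scheme
    \<Rightarrow> ('s, (('x \<times> 'y) \<Rightarrow>\<^sub>0 int) set) bimodule"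
where
  "tensor S X Y = \<lparr>carrier = carrier (tensor_ring S X Y),
     mult = undefined, one = undefined,
     ring.zero = ring.zero (tensor_ring S X Y), add = add (tensor_ring S X Y),
     smult = (\<lambda>s. tensor_lift (tensor_ring S X Y) (\<lambda>x y. pure_tensor S X Y (s \<odot>\<^bsub>X\<^esub> x) y)),
     rsmult = (\<lambda>t s. tensor_lift (tensor_ring S X Y) (\<lambda>x y. pure_tensor S X Y x (rsmult Y y s)) t)\<rparr>"

text \<open>\<open>x \<otimes> y \<mapsto> x \<otimes> y\<close> as a map \<open>X \<otimes>\<^sub>R Y \<rightarrow> X \<otimes>\<^sub>A Y\<close>.\<close>

definition tensor_quotient ::
  "('r, 'p) ring_scheme \<Rightarrow> ('r, 'a, 'q) module_scheme \<Rightarrow> ('a, 'x, 'e) bimodule_scheme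
    \<Rightarrow> ('a, 'y, 'f) bimodule_scheme
    \<Rightarrow> (('x \<times> 'y) \<Rightarrow>\<^sub>0 int) set \<Rightarrow> (('x \<times> 'y) \<Rightarrow>\<^sub>0 int) set"
where
  "tensor_quotient R A X Y =
     (\<lambda>t\<in>carrier (tensor R (restrict_scalars A X) (restrict_scalars A Y)).
        tensor_lift (tensor A X Y) (pure_tensor A X Y) t)"


section \<open>Extension of scalars to the ring of integers of an algebraic extension of \<open>\<rat>\<close>\<close>

definition ring_of_integers :: "'k::field_char_0 ring" where
  "ring_of_integers =
     \<lparr>carrier = {x. algebraic_int x}, mult = (*), one = 1, ring.zero = 0, add = (+)\<rparr>"

text \<open>The abelian group \<open>\<O>\<^sub>K \<otimes>\<^sub>\<int> X\<close> and its elements \<open>c \<otimes> x\<close>.\<close>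

abbreviation integers_tensor ::
  "('x, 'e) ring_scheme \<Rightarrow> (int, (('k::field_char_0 \<times> 'x) \<Rightarrow>\<^sub>0 int) set) bimodule"
where
  "integers_tensor X \<equiv> tensor \<Z> (int_bimodule ring_of_integers) (int_bimodule X)"

abbreviation integers_pure ::
  "('x, 'e) ring_scheme \<Rightarrow> 'k::field_char_0 \<Rightarrow> 'x \<Rightarrow> (('k \<times> 'x) \<Rightarrow>\<^sub>0 int) set"
where
  "integers_pure X \<equiv> pure_tensor \<Z> (int_bimodule ring_of_integers) (int_bimodule X)"

text \<open>The ring structure of \<open>\<O>\<^sub>K \<otimes>\<^sub>\<int> R\<close> is \<open>(c \<otimes> r) (d \<otimes> s) = c d \<otimes> r s\<close>, and \<open>s (c \<otimes> r) = c \<otimes> s r\<close>.\<close>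

definition integers_algebra ::
  "('r, 'p) ring_scheme \<Rightarrow> ('r, (('k::field_char_0 \<times> 'r) \<Rightarrow>\<^sub>0 int) set) module"
where
  "integers_algebra R = \<lparr>carrier = carrier (integers_tensor R),
     mult = (\<lambda>t u. tensor_lift (integers_tensor R) (\<lambda>c r.
               tensor_lift (integers_tensor R) (\<lambda>d s. integers_pure R (c * d) (r \<otimes>\<^bsub>R\<^esub> s)) u) t),
     one = integers_pure R 1 \<one>\<^bsub>R\<^esub>,
     ring.zero = ring.zero (integers_tensor R), add = add (integers_tensor R),
     smult = (\<lambda>s. tensor_lift (integers_tensor R) (\<lambda>c r. integers_pure R c (s \<otimes>\<^bsub>R\<^esub> r)))\<rparr>"

text \<open>The action of \<open>\<O>\<^sub>K \<otimes>\<^sub>\<int> R\<close> on \<open>\<O>\<^sub>K \<otimes>\<^sub>\<int> M\<close>: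
  \<open>(c \<otimes> r) (d \<otimes> m) = c d \<otimes> r m\<close>.\<close>

definition integers_action ::
  "('r, 'a, 'q) module_scheme \<Rightarrow> ('a, 'm, 'e) module_scheme
    \<Rightarrow> (('k::field_char_0 \<times> 'r) \<Rightarrow>\<^sub>0 int) set
    \<Rightarrow> (('k \<times> 'm) \<Rightarrow>\<^sub>0 int) set \<Rightarrow> (('k \<times> 'm) \<Rightarrow>\<^sub>0 int) set"
where
  "integers_action A M t u = tensor_lift (integers_tensor M) (\<lambda>c r.
     tensor_lift (integers_tensor M)
       (\<lambda>d m. integers_pure M (c * d) ((r \<odot>\<^bsub>A\<^esub> \<one>\<^bsub>A\<^esub>) \<odot>\<^bsub>M\<^esub> m)) u) t"

text \<open>\<open>M\<^sup>\<lambda>\<close> has left action \<open>a (c \<otimes> m) = c \<otimes> a m\<close> and right action \<open>t a = \<lambda>(a) t\<close>.\<close>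

definition twist ::
  "('r, 'a, 'q) module_scheme \<Rightarrow> ('a, 'm, 'e) module_scheme
    \<Rightarrow> ('a \<Rightarrow> (('k::field_char_0 \<times> 'r) \<Rightarrow>\<^sub>0 int) set)
    \<Rightarrow> ('a, (('k \<times> 'm) \<Rightarrow>\<^sub>0 int) set) bimodule"
where
  "twist A M lam = \<lparr>carrier = carrier (integers_tensor M), mult = undefined, one = undefined,
     ring.zero = ring.zero (integers_tensor M), add = add (integers_tensor M),
     smult = (\<lambda>a. tensor_lift (integers_tensor M) (\<lambda>c m. integers_pure M c (a \<odot>\<^bsub>M\<^esub> m))),
     rsmult = (\<lambda>t a. integers_action A M (lam a) t)\<rparr>"

text \<open>\<open>f \<otimes> (c \<otimes> m) \<mapsto> c \<otimes> f(m)\<close> on \<open>Hom\<^sub>R(M, N) \<otimes>\<^sub>R M\<^sup>\<lambda>\<close>.\<close>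

definition evaluation_map ::
  "('r, 'p) ring_scheme \<Rightarrow> ('r, 'a, 'q) module_scheme \<Rightarrow> ('a, 'm, 'e) module_scheme
    \<Rightarrow> ('a, 'n, 'f) module_scheme \<Rightarrow> ('a \<Rightarrow> (('k::field_char_0 \<times> 'r) \<Rightarrow>\<^sub>0 int) set)
    \<Rightarrow> ((('m \<Rightarrow> 'n) \<times> (('k \<times> 'm) \<Rightarrow>\<^sub>0 int) set) \<Rightarrow>\<^sub>0 int) set
    \<Rightarrow> (('k \<times> 'n) \<Rightarrow>\<^sub>0 int) set"
where
  "evaluation_map R A M N lam =
     (\<lambda>t\<in>carrier (tensor R (restrict_scalars A (Hom_bimodule R A M N))
                           (restrict_scalars A (twist A M lam))).
        tensor_lift (twist A N lam) (\<lambda>f u.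
          tensor_lift (twist A N lam) (\<lambda>c m. integers_pure N c (f m)) u) t)"


section \<open>Hochschild cohomology\<close>

definition tuples :: "('a, 'e) ring_scheme \<Rightarrow> nat \<Rightarrow> 'a list set" where
  "tuples A i = {xs. set xs \<subseteq> carrier A \<and> length xs = i}"

text \<open>An \<open>i\<close>-cochain, i.e. an \<open>R\<close>-linear map from the \<open>i\<close>-th tensor power of \<open>A\<close> over \<open>R\<close> to \<open>B\<close>,
  is given as an \<open>R\<close>-multilinear function of \<open>i\<close>-tuples.\<close>

definition cochains ::
  "('r, 'p) ring_scheme \<Rightarrow> ('r, 'a, 'q) module_scheme \<Rightarrow> ('a, 'b, 'e) bimodule_scheme
    \<Rightarrow> nat \<Rightarrow> ('a list \<Rightarrow> 'b) set"
where
  "cochains R A B i = {f \<in> tuples A i \<rightarrow>\<^sub>E carrier B. \<forall>xs\<in>tuples A i. \<forall>p<i.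
     (\<forall>x\<in>carrier A. \<forall>y\<in>carrier A.
        f (xs[p := x \<oplus>\<^bsub>A\<^esub> y]) = f (xs[p := x]) \<oplus>\<^bsub>B\<^esub> f (xs[p := y]))
     \<and> (\<forall>r\<in>carrier R. \<forall>x\<in>carrier A.
        f (xs[p := r \<odot>\<^bsub>A\<^esub> x]) = (r \<odot>\<^bsub>A\<^esub> \<one>\<^bsub>A\<^esub>) \<odot>\<^bsub>B\<^esub> f (xs[p := x]))}"

definition cochain_module ::
  "('r, 'p) ring_scheme \<Rightarrow> ('r, 'a, 'q) module_scheme \<Rightarrow> ('a, 'b, 'e) bimodule_scheme
    \<Rightarrow> nat \<Rightarrow> ('r, 'a list \<Rightarrow> 'b) module"
where
  "cochain_module R A B i = \<lparr>carrier = cochains R A B i, mult = undefined, one = undefined,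
     ring.zero = (\<lambda>xs\<in>tuples A i. \<zero>\<^bsub>B\<^esub>),
     add = (\<lambda>f g. \<lambda>xs\<in>tuples A i. f xs \<oplus>\<^bsub>B\<^esub> g xs),
     smult = (\<lambda>r f. \<lambda>xs\<in>tuples A i. (r \<odot>\<^bsub>A\<^esub> \<one>\<^bsub>A\<^esub>) \<odot>\<^bsub>B\<^esub> f xs)\<rparr>"

text \<open>\<open>(\<delta>f)(a\<^sub>1, \<dots>, a\<^sub>i\<^sub>+\<^sub>1) = a\<^sub>1 f(a\<^sub>2, \<dots>) + \<Sum>\<^sub>k (-1)\<^sup>k f(\<dots>, a\<^sub>k a\<^sub>k\<^sub>+\<^sub>1, \<dots>)
  + (-1)\<^sup>i\<^sup>+\<^sup>1 f(a\<^sub>1, \<dots>, a\<^sub>i) a\<^sub>i\<^sub>+\<^sub>1\<close>; note that list indices start at 0.\<close>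

definition hochschild_d ::
  "('r, 'a, 'q) module_scheme \<Rightarrow> ('a, 'b, 'e) bimodule_scheme
    \<Rightarrow> nat \<Rightarrow> ('a list \<Rightarrow> 'b) \<Rightarrow> 'a list \<Rightarrow> 'b"
where
  "hochschild_d A B i f = (\<lambda>xs\<in>tuples A (Suc i).
     hd xs \<odot>\<^bsub>B\<^esub> f (tl xs)
     \<oplus>\<^bsub>B\<^esub> (\<Oplus>\<^bsub>B\<^esub>k\<in>{1..i}. [((- 1 :: int) ^ k)] \<cdot>\<^bsub>B\<^esub>
            f (take (k - 1) xs @ [xs ! (k - 1) \<otimes>\<^bsub>A\<^esub> xs ! k] @ drop (k + 1) xs))
     \<oplus>\<^bsub>B\<^esub> [((- 1 :: int) ^ (i + 1))] \<cdot>\<^bsub>B\<^esub> rsmult B (f (butlast xs)) (last xs))"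

definition cocycles ::
  "('r, 'p) ring_scheme \<Rightarrow> ('r, 'a, 'q) module_scheme \<Rightarrow> ('a, 'b, 'e) bimodule_scheme
    \<Rightarrow> nat \<Rightarrow> ('a list \<Rightarrow> 'b) set"
where
  "cocycles R A B i =
     {f \<in> cochains R A B i. hochschild_d A B i f = \<zero>\<^bsub>cochain_module R A B (Suc i)\<^esub>}"

definition coboundaries ::
  "('r, 'p) ring_scheme \<Rightarrow> ('r, 'a, 'q) module_scheme \<Rightarrow> ('a, 'b, 'e) bimodule_scheme
    \<Rightarrow> nat \<Rightarrow> ('a list \<Rightarrow> 'b) set"
where
  "coboundaries R A B i = (case i of
     0 \<Rightarrow> {\<zero>\<^bsub>cochain_module R A B 0\<^esub>}
   | Suc j \<Rightarrow> hochschild_d A B j ` cochains R A B j)"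

definition hochschild_class ::
  "('r, 'p) ring_scheme \<Rightarrow> ('r, 'a, 'q) module_scheme \<Rightarrow> ('a, 'b, 'e) bimodule_scheme
    \<Rightarrow> nat \<Rightarrow> ('a list \<Rightarrow> 'b) \<Rightarrow> ('a list \<Rightarrow> 'b) set"
where
  "hochschild_class R A B i f = coboundaries R A B i +>\<^bsub>cochain_module R A B i\<^esub> f"

text \<open>Operations on classes are those induced by operations on representatives: \<open>the_elem\<close> picks
  the common value of the latter.\<close>

definition HHn ::
  "('r, 'p) ring_scheme \<Rightarrow> ('r, 'a, 'q) module_scheme \<Rightarrow> ('a, 'b, 'e) bimodule_scheme
    \<Rightarrow> nat \<Rightarrow> ('r, ('a list \<Rightarrow> 'b) set) module"
where
  "HHn R A B i = \<lparr>carrier = hochschild_class R A B i ` cocycles R A B i,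
     mult = undefined, one = undefined,
     ring.zero = coboundaries R A B i,
     add = (\<lambda>U V. U <+>\<^bsub>cochain_module R A B i\<^esub> V),
     smult = (\<lambda>r U. the_elem
       ((\<lambda>f. hochschild_class R A B i (r \<odot>\<^bsub>cochain_module R A B i\<^esub> f)) ` U))\<rparr>"

text \<open>\<open>HH\<^sup>*(A; B)\<close> is the direct sum of all \<open>HH\<^sup>i(A; B)\<close>.\<close>

definition HH ::
  "('r, 'p) ring_scheme \<Rightarrow> ('r, 'a, 'q) module_scheme \<Rightarrow> ('a, 'b, 'e) bimodule_scheme
    \<Rightarrow> ('r, nat \<Rightarrow> ('a list \<Rightarrow> 'b) set) module"
where
  "HH R A B = \<lparr>
     carrier = {u. (\<forall>i. u i \<in> carrier (HHn R A B i)) \<and> finite {i. u i \<noteq> \<zero>\<^bsub>HHn R A B i\<^esub>}},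
     mult = undefined, one = undefined,
     ring.zero = (\<lambda>i. \<zero>\<^bsub>HHn R A B i\<^esub>),
     add = (\<lambda>u v i. u i \<oplus>\<^bsub>HHn R A B i\<^esub> v i),
     smult = (\<lambda>r u i. r \<odot>\<^bsub>HHn R A B i\<^esub> u i)\<rparr>"

definition HH_map ::
  "('r, 'p) ring_scheme \<Rightarrow> ('r, 'a, 'q) module_scheme \<Rightarrow> ('a, 'b, 'e) bimodule_scheme
    \<Rightarrow> ('a, 'c, 'f) bimodule_scheme \<Rightarrow> ('b \<Rightarrow> 'c)
    \<Rightarrow> (nat \<Rightarrow> ('a list \<Rightarrow> 'b) set) \<Rightarrow> nat \<Rightarrow> ('a list \<Rightarrow> 'c) set"
where
  "HH_map R A B C h = (\<lambda>u\<in>carrier (HH R A B). \<lambda>i. the_elem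
     ((\<lambda>f. hochschild_class R A C i (compose (tuples A i) h f)) ` u i))"


section \<open>The cup product\<close>

definition cochain_cup ::
  "('r, 'a, 'q) module_scheme \<Rightarrow> ('a, 'b, 'e) bimodule_scheme \<Rightarrow> ('a, 'c, 'f) bimodule_scheme
    \<Rightarrow> nat \<Rightarrow> nat \<Rightarrow> ('a list \<Rightarrow> 'b) \<Rightarrow> ('a list \<Rightarrow> 'c)
    \<Rightarrow> 'a list \<Rightarrow> (('b \<times> 'c) \<Rightarrow>\<^sub>0 int) set"
where
  "cochain_cup A B C i j f g =
     (\<lambda>xs\<in>tuples A (i + j). pure_tensor A B C (f (take i xs)) (g (drop i xs)))"

definition class_cup ::
  "('r, 'p) ring_scheme \<Rightarrow> ('r, 'a, 'q) module_scheme \<Rightarrow> ('a, 'b, 'e) bimodule_scheme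
    \<Rightarrow> ('a, 'c, 'f) bimodule_scheme \<Rightarrow> nat \<Rightarrow> nat
    \<Rightarrow> ('a list \<Rightarrow> 'b) set \<Rightarrow> ('a list \<Rightarrow> 'c) set \<Rightarrow> ('a list \<Rightarrow> (('b \<times> 'c) \<Rightarrow>\<^sub>0 int) set) set"
where
  "class_cup R A B C i j U V = the_elem
     ((\<lambda>(f, g). hochschild_class R A (tensor A B C) (i + j) (cochain_cup A B C i j f g)) ` (U \<times> V))"

definition cup_product ::
  "('r, 'p) ring_scheme \<Rightarrow> ('r, 'a, 'q) module_scheme \<Rightarrow> ('a, 'b, 'e) bimodule_scheme
    \<Rightarrow> ('a, 'c, 'f) bimodule_scheme
    \<Rightarrow> (((nat \<Rightarrow> ('a list \<Rightarrow> 'b) set) \<times> (nat \<Rightarrow> ('a list \<Rightarrow> 'c) set)) \<Rightarrow>\<^sub>0 int) set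
    \<Rightarrow> nat \<Rightarrow> ('a list \<Rightarrow> (('b \<times> 'c) \<Rightarrow>\<^sub>0 int) set) set"
where
  "cup_product R A B C =
     (\<lambda>t\<in>carrier (tensor R (symm_bimodule (HH R A B)) (symm_bimodule (HH R A C))).
        tensor_lift (HH R A (tensor A B C))
          (\<lambda>u v n. \<Oplus>\<^bsub>HHn R A (tensor A B C) n\<^esub>i\<in>{..n}. class_cup R A B C i (n - i) (u i) (v (n - i)))
          t)"

end

theory Submission
  imports Defs "Jordan_Normal_Form.Char_Poly"
begin

text \<open>The map \<open>\<chi>\<close> comes from one pairing. For an \<open>R\<close>-linear \<open>f: M \<rightarrow> N\<close> there is an additive map \<open>1 \<otimes> f\<close> sending
  \<open>c \<otimes> m\<close> to \<open>c \<otimes> f(m)\<close>, and \<open>(f, t) \<mapsto> (1 \<otimes> f)(t)\<close> is additive in both arguments. It is balanced over \<open>A\<close>, because \<open>(f a, c \<otimes> m)\<close>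
  and \<open>(f, a (c \<otimes> m))\<close> both go to \<open>c \<otimes> f(a m)\<close>. So it factors through the tensor product over \<open>A\<close>, and the
  factorization is unique because pure tensors generate. It respects the left actions by the definition
  of \<open>a f\<close>. The right actions are multiplication by \<open>\<lambda>(a)\<close>, an element of \<open>\<O>\<^sub>K \<otimes> R\<close>, and \<open>1 \<otimes> f\<close> commutes with such
  multiplications because \<open>f\<close> is \<open>R\<close>-linear (lemma \<open>base_change_act\<close>).

  The dot-cup product is then linear as the composite of two linear maps, once the cup product is known to be well
  defined on classes. That rests on the Leibniz rule (\<open>bar_d_cup\<close>) and on \<open>\<delta>\<delta> = 0\<close> (\<open>bar_d_bar_d\<close>): the latter is what makes a
  cocycle out of a representative that was changed by a coboundary. Both are proved by induction after the alternating
  sum in \<open>\<delta>\<close> has been replaced by a recursion on the list of arguments (\<open>merge\<close>, \<open>face_sum_eq_merge\<close>).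

  The bimodule laws for \<open>M\<^sup>\<lambda>\<close> and for tensor products are checked on pure tensors. For \<open>M\<^sup>\<lambda>\<close> this presupposes that the
  algebraic integers in \<open>K\<close> are closed under sums and products.\<close>

section \<open>Algebraic integers form a ring\<close>

text \<open>The characteristic polynomial of an integer matrix is monic with integer coefficients.\<close>

lemma algebraic_int_eigenvalue:
  fixes A :: "int mat" and z :: "'k::field_char_0"
  assumes A: "A \<in> carrier_mat n n" and ev: "eigenvector (map_mat of_int A) v z"
  shows "algebraic_int z"
proof -
  let ?A = "map_mat of_int A :: 'k mat"
  have A': "?A \<in> carrier_mat n n" using A by simp
  have "eigenvalue ?A z" using ev by (auto simp: eigenvalue_def)
  then have root: "poly (char_poly ?A) z = 0" using eigenvalue_root_char_poly[OF A'] by simp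
  have "char_poly ?A = map_poly of_int (char_poly A)"
    using of_int_hom.char_poly_hom[OF A] by simp
  then have "\<And>i. coeff (char_poly ?A) i \<in> \<int>" by simp
  moreover have "lead_coeff (char_poly ?A) = 1" using degree_monic_char_poly[OF A'] by simp
  ultimately show ?thesis using root by (intro algebraic_int.intros) auto
qed

definition int_span :: "nat \<Rightarrow> (nat \<Rightarrow> 'k::field_char_0) \<Rightarrow> 'k set" where
  "int_span n w = {\<Sum>j<n. of_int (c j) * w j | c. True}"

lemma int_spanI: "y = (\<Sum>j<n. of_int (c j) * w j) \<Longrightarrow> y \<in> int_span n w"
  by (auto simp: int_span_def)

lemma int_span_add: "x \<in> int_span n w \<Longrightarrow> y \<in> int_span n w \<Longrightarrow> x + y \<in> int_span n w"
  unfolding int_span_def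
proof clarify
  fix c d
  show "\<exists>e. (\<Sum>j<n. of_int (c j) * w j) + (\<Sum>j<n. of_int (d j) * w j) = (\<Sum>j<n. of_int (e j) * w j) \<and> True"
    by (rule exI[of _ "\<lambda>j. c j + d j"]) (simp add: sum.distrib ring_distribs)
qed

lemma int_span_scale: "x \<in> int_span n w \<Longrightarrow> of_int k * x \<in> int_span n w"
  unfolding int_span_def
proof clarify
  fix c
  show "\<exists>e. of_int k * (\<Sum>j<n. of_int (c j) * w j) = (\<Sum>j<n. of_int (e j) * w j) \<and> True"
    by (rule exI[of _ "\<lambda>j. k * c j"]) (simp add: sum_distrib_left mult.assoc)
qed

lemma int_span_zero: "0 \<in> int_span n w"
  by (rule int_spanI[where c = "\<lambda>_. 0"]) simp

lemma int_span_sum: "(\<And>i. i \<in> I \<Longrightarrow> f i \<in> int_span n w) \<Longrightarrow> sum f I \<in> int_span n w"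
  by (induction I rule: infinite_finite_induct) (auto intro: int_span_zero int_span_add)

lemma int_span_base: "i < n \<Longrightarrow> w i \<in> int_span n w"
  by (rule int_spanI[where c = "\<lambda>j. if j = i then 1 else 0"])
    (simp add: if_distrib[of of_int] if_distrib[of "\<lambda>x. x * _"] sum.delta cong: if_cong)

lemma int_span_stable:
  assumes "\<And>i. i < n \<Longrightarrow> z * w i \<in> int_span n w" "x \<in> int_span n w"
  shows "z * x \<in> int_span n w"
proof -
  obtain c where x: "x = (\<Sum>j<n. of_int (c j) * w j)" using assms(2) by (auto simp: int_span_def)
  have "z * x = (\<Sum>j<n. of_int (c j) * (z * w j))"
    unfolding x sum_distrib_left by (intro sum.cong) (auto simp: algebra_simps)
  then show ?thesis using assms(1) by (auto intro: int_span_sum int_span_scale)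
qed

text \<open>If multiplication by \<open>z\<close> preserves the lattice spanned by the \<open>w i\<close>, then the vector \<open>w\<close> is an eigenvector
  of an integer matrix for the eigenvalue \<open>z\<close>.\<close>

lemma algebraic_int_of_stable:
  assumes st: "\<And>i. i < n \<Longrightarrow> z * w i \<in> int_span n w" and i0: "i0 < n" "w i0 \<noteq> 0"
  shows "algebraic_int z"
proof -
  have "\<forall>i. \<exists>c. i < n \<longrightarrow> z * w i = (\<Sum>j<n. of_int (c j) * w j)"
    using st by (fastforce simp: int_span_def)
  then obtain c where c: "\<And>i. i < n \<Longrightarrow> z * w i = (\<Sum>j<n. of_int (c i j) * w j)" by metis
  define A where "A = mat n n (\<lambda>(i,j). c i j)"
  have A: "A \<in> carrier_mat n n" by (simp add: A_def)
  have "eigenvector (map_mat of_int A) (vec n w) z"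
    unfolding eigenvector_def
  proof (intro conjI)
    show "vec n w \<in> carrier_vec (dim_row (map_mat of_int A))" by (simp add: A_def)
    show "vec n w \<noteq> 0\<^sub>v (dim_row (map_mat of_int A))"
    proof
      assume "vec n w = 0\<^sub>v (dim_row (map_mat of_int A))"
      then have "vec n w $ i0 = 0\<^sub>v n $ i0" by (simp add: A_def)
      with i0 show False by simp
    qed
    show "map_mat of_int A *\<^sub>v vec n w = z \<cdot>\<^sub>v vec n w"
      by (rule eq_vecI) (auto simp: A_def scalar_prod_def c atLeast0LessThan)
  qed
  then show ?thesis by (rule algebraic_int_eigenvalue[OF A])
qed

lemma algebraic_int_power_reduce:
  assumes "algebraic_int (x::'k::field_char_0)"
  obtains m c where "0 < m" "x ^ m = (\<Sum>k<m. of_int (c k) * x ^ k)"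
proof -
  from assms obtain p where p: "lead_coeff p = 1" "\<And>i. coeff p i \<in> \<int>" "poly p x = 0"
    by (auto elim: algebraic_int.cases)
  have "\<forall>i. \<exists>c. coeff p i = of_int c" using p(2) by (meson Ints_cases)
  then obtain c where c: "\<And>i. coeff p i = of_int (c i)" by metis
  have "degree p \<noteq> 0"
  proof
    assume "degree p = 0"
    then obtain a where "p = [:a:]" by (metis degree_eq_zeroE)
    with p show False by auto
  qed
  moreover have "x ^ degree p = (\<Sum>k<degree p. of_int (- c k) * x ^ k)"
  proof -
    have "0 = (\<Sum>k\<le>degree p. coeff p k * x ^ k)" using p(3) by (simp add: poly_altdef)
    also have "\<dots> = (\<Sum>k<degree p. of_int (c k) * x ^ k) + x ^ degree p"
      using p(1) by (simp add: lessThan_Suc_atMost[symmetric] c)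
    finally show ?thesis by (simp add: sum_negf eq_neg_iff_add_eq_0 add.commute)
  qed
  ultimately show ?thesis using that[of "degree p" "\<lambda>k. - c k"] by simp
qed

text \<open>The monomials \<open>x\<^sup>a y\<^sup>b\<close> with exponents below the degrees of integral equations of \<open>x\<close> and \<open>y\<close> span a
  lattice that is preserved by \<open>x\<close> and by \<open>y\<close>, hence also by their sum and product.\<close>

lemma
  fixes x y :: "'k::field_char_0"
  assumes x: "algebraic_int x" and y: "algebraic_int y"
  shows algebraic_int_add: "algebraic_int (x + y)"
    and algebraic_int_mult: "algebraic_int (x * y)"
proof -
  obtain m c where m: "0 < m" and c: "x ^ m = (\<Sum>k<m. of_int (c k) * x ^ k)"
    using x by (rule algebraic_int_power_reduce)
  obtain n d where n: "0 < n" and d: "y ^ n = (\<Sum>k<n. of_int (d k) * y ^ k)"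
    using y by (rule algebraic_int_power_reduce)
  \<comment> \<open>position \<open>a * n + b\<close> holds the monomial \<open>x\<^sup>a y\<^sup>b\<close>\<close>
  define w where "w = (\<lambda>i. x ^ (i div n) * y ^ (i mod n))"
  have mon: "x ^ a * y ^ b \<in> int_span (m * n) w" if "a < m" "b < n" for a b
  proof -
    have "a * n + b < Suc a * n" using that by simp
    also have "\<dots> \<le> m * n" using that by (intro mult_le_mono1) simp
    finally have "a * n + b < m * n" .
    moreover have "w (a * n + b) = x ^ a * y ^ b" using that n by (simp add: w_def)
    ultimately show ?thesis using int_span_base by metis
  qed
  have red: "x ^ a * y ^ b \<in> int_span (m * n) w" if "a \<le> m" "b \<le> n" "a < m \<or> b < n" for a b
  proof -
    have "x ^ a * y ^ b = (\<Sum>k<m. of_int (c k) * (x ^ k * y ^ b))" if "a = m"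
      using that c by (simp add: sum_distrib_right mult.assoc)
    moreover have "x ^ a * y ^ b = (\<Sum>k<n. of_int (d k) * (x ^ a * y ^ k))" if "b = n"
      using that d by (simp add: sum_distrib_left algebra_simps)
    ultimately show ?thesis using that
      by (cases "a = m"; cases "b = n") (auto intro!: int_span_sum int_span_scale mon)
  qed
  have idx: "i div n < m" "i mod n < n" if "i < m * n" for i
    using that n by (auto simp: less_mult_imp_div_less)
  have sx: "x * w i \<in> int_span (m * n) w" if "i < m * n" for i
    using red[of "Suc (i div n)" "i mod n"] idx[OF that] by (auto simp: w_def mult.assoc)
  have sy: "y * w i \<in> int_span (m * n) w" if "i < m * n" for i
    using red[of "i div n" "Suc (i mod n)"] idx[OF that] by (auto simp: w_def algebra_simps)
  have w0: "0 < m * n" "w 0 \<noteq> 0" using m n by (auto simp: w_def)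
  show "algebraic_int (x + y)"
    by (rule algebraic_int_of_stable[where w = w and ?i0.0 = 0, OF _ w0]) (auto simp: distrib_right intro: int_span_add sx sy)
  show "algebraic_int (x * y)"
    by (rule algebraic_int_of_stable[where w = w and ?i0.0 = 0, OF _ w0])
      (auto simp: mult.assoc intro: int_span_stable sx sy)
qed

section \<open>The universal property of tensor products\<close>

text \<open>Values outside the carrier are left open, so that compositions and pointwise sums of additive maps are
  additive maps again.\<close>

definition add_map :: "('x, 'e) ring_scheme \<Rightarrow> ('z, 'f) ring_scheme \<Rightarrow> ('x \<Rightarrow> 'z) \<Rightarrow> bool" where
  "add_map X Z h \<longleftrightarrow> h \<in> carrier X \<rightarrow> carrier Z
     \<and> (\<forall>x\<in>carrier X. \<forall>y\<in>carrier X. h (x \<oplus>\<^bsub>X\<^esub> y) = h x \<oplus>\<^bsub>Z\<^esub> h y)"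

lemma add_mapI:
  assumes "\<And>x. x \<in> carrier X \<Longrightarrow> h x \<in> carrier Z"
    and "\<And>x y. x \<in> carrier X \<Longrightarrow> y \<in> carrier X \<Longrightarrow> h (x \<oplus>\<^bsub>X\<^esub> y) = h x \<oplus>\<^bsub>Z\<^esub> h y"
  shows "add_map X Z h"
  using assms by (auto simp: add_map_def)

lemma add_map_closed: "add_map X Z h \<Longrightarrow> x \<in> carrier X \<Longrightarrow> h x \<in> carrier Z"
  and add_map_add: "add_map X Z h \<Longrightarrow> x \<in> carrier X \<Longrightarrow> y \<in> carrier X \<Longrightarrow> h (x \<oplus>\<^bsub>X\<^esub> y) = h x \<oplus>\<^bsub>Z\<^esub> h y"
  by (auto simp: add_map_def)

lemma add_map_cong:
  assumes "\<And>x. x \<in> carrier X \<Longrightarrow> h x = k x" "add_map X Z h" "abelian_group X"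
  shows "add_map X Z k"
proof -
  interpret X: abelian_group X by fact
  show ?thesis using assms(1,2) by (auto simp: add_map_def Pi_iff)
qed

lemma add_map_hom: "add_map X Z h \<Longrightarrow> abelian_group X \<Longrightarrow> abelian_group Z \<Longrightarrow> abelian_group_hom X Z h"
  by (auto simp: add_map_def abelian_group_hom_def abelian_group_hom_axioms_def group_hom_def
      group_hom_axioms_def hom_def abelian_group.a_group)

lemma add_map_zero: "add_map X Z h \<Longrightarrow> abelian_group X \<Longrightarrow> abelian_group Z \<Longrightarrow> h \<zero>\<^bsub>X\<^esub> = \<zero>\<^bsub>Z\<^esub>"
  by (rule abelian_group_hom.hom_zero[OF add_map_hom])

lemma add_map_minus: "add_map X Z h \<Longrightarrow> abelian_group X \<Longrightarrow> abelian_group Z \<Longrightarrow> x \<in> carrier X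
   \<Longrightarrow> h (\<ominus>\<^bsub>X\<^esub> x) = \<ominus>\<^bsub>Z\<^esub> h x"
  by (rule abelian_group_hom.hom_a_inv[OF add_map_hom])

lemma add_map_diff: "add_map X Z h \<Longrightarrow> abelian_group X \<Longrightarrow> abelian_group Z \<Longrightarrow> x \<in> carrier X
   \<Longrightarrow> y \<in> carrier X \<Longrightarrow> h (x \<ominus>\<^bsub>X\<^esub> y) = h x \<ominus>\<^bsub>Z\<^esub> h y"
  by (simp add: a_minus_def add_map_add add_map_minus abelian_group.a_inv_closed)

lemma add_map_int:
  assumes "add_map X Z h" "abelian_group X" "abelian_group Z" "x \<in> carrier X"
  shows "h ([(k::int)] \<cdot>\<^bsub>X\<^esub> x) = [k] \<cdot>\<^bsub>Z\<^esub> h x"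
proof -
  interpret h: group_hom "add_monoid X" "add_monoid Z" h
    using abelian_group_hom.a_group_hom[OF add_map_hom[OF assms(1-3)]] .
  show ?thesis using h.hom_int_pow[of x k] assms(4) by (simp add: add_pow_def)
qed

lemma add_map_comp: "add_map X Y h \<Longrightarrow> add_map Y Z k \<Longrightarrow> add_map X Z (\<lambda>x. k (h x))"
  by (auto simp: add_map_def Pi_iff)

lemma add_map_sum:
  assumes "add_map X Z h" "add_map X Z k" "abelian_group Z"
  shows "add_map X Z (\<lambda>x. h x \<oplus>\<^bsub>Z\<^esub> k x)"
proof -
  interpret Z: abelian_group Z by fact
  show ?thesis using assms(1,2) by (auto simp: add_map_def Pi_iff Z.a_ac)
qed

definition frag_sum :: "('z, 'e) ring_scheme \<Rightarrow> ('p \<Rightarrow> 'z) \<Rightarrow> ('p \<Rightarrow>\<^sub>0 int) \<Rightarrow> 'z" where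
  "frag_sum Z b c = (\<Oplus>\<^bsub>Z\<^esub>p\<in>Poly_Mapping.keys c. [Poly_Mapping.lookup c p] \<cdot>\<^bsub>Z\<^esub> b p)"

lemma (in abelian_group) int_pow_closed:
  "x \<in> carrier G \<Longrightarrow> [(k::int)] \<cdot> x \<in> carrier G"
  by (rule add.int_pow_closed)

lemma (in abelian_group) add_diff_diff:
  assumes "x \<in> carrier G" "y \<in> carrier G" shows "x \<oplus> y \<ominus> x \<ominus> y = \<zero>"
proof -
  have "x \<oplus> y \<ominus> x = y" using assms by (simp add: minus_eq a_comm[of x y] a_assoc r_neg)
  then show ?thesis using assms by (simp add: minus_eq r_neg)
qed

text \<open>Summing over a common superset of the supports makes additivity in the formal sum visible.\<close>

lemma (in abelian_group) frag_sum_superset: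
  assumes "finite K" "Poly_Mapping.keys c \<subseteq> K" "b \<in> K \<rightarrow> carrier G"
  shows "frag_sum G b c = (\<Oplus>p\<in>K. [Poly_Mapping.lookup c p] \<cdot> b p)"
  unfolding frag_sum_def using assms
  by (intro add.finprod_mono_neutral_cong_left)
    (auto simp: in_keys_iff add_pow_def intro!: int_pow_closed[unfolded add_pow_def])

lemma (in abelian_group) frag_sum_hom:
  assumes b: "b \<in> S \<rightarrow> carrier G"
  shows "frag_sum G b \<in> hom (free_Abelian_group S) (add_monoid G)"
proof (rule homI)
  fix c assume "c \<in> carrier (free_Abelian_group S)"
  then show "frag_sum G b c \<in> carrier (add_monoid G)"
    using b by (auto simp: frag_sum_def intro!: finsum_closed int_pow_closed)
next
  fix c d assume cd: "c \<in> carrier (free_Abelian_group S)" "d \<in> carrier (free_Abelian_group S)"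
  let ?K = "Poly_Mapping.keys c \<union> Poly_Mapping.keys d"
  have K: "finite ?K" "b \<in> ?K \<rightarrow> carrier G" using b cd by auto
  have "frag_sum G b (c + d) = (\<Oplus>p\<in>?K. [Poly_Mapping.lookup (c + d) p] \<cdot> b p)"
    by (rule frag_sum_superset[OF K(1) keys_add K(2)])
  also have "\<dots> = (\<Oplus>p\<in>?K. [Poly_Mapping.lookup c p] \<cdot> b p \<oplus> [Poly_Mapping.lookup d p] \<cdot> b p)"
    using K by (intro finsum_cong') (auto simp: lookup_add add.int_pow_mult Pi_iff intro!: int_pow_closed)
  also have "\<dots> = (\<Oplus>p\<in>?K. [Poly_Mapping.lookup c p] \<cdot> b p) \<oplus> (\<Oplus>p\<in>?K. [Poly_Mapping.lookup d p] \<cdot> b p)"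
    using K by (intro finsum_addf) (auto intro!: int_pow_closed)
  also have "\<dots> = frag_sum G b c \<oplus> frag_sum G b d"
    using K by (simp add: frag_sum_superset[of ?K])
  finally show "frag_sum G b (c \<otimes>\<^bsub>free_Abelian_group S\<^esub> d) = frag_sum G b c \<otimes>\<^bsub>add_monoid G\<^esub> frag_sum G b d"
    by simp
qed

lemma (in abelian_group) frag_sum_of:
  assumes "b p \<in> carrier G" shows "frag_sum G b (frag_of p) = b p"
  using assms by (simp add: frag_sum_def finsum_insert int_pow_closed)

definition balanced ::
  "('s, 'u) ring_scheme \<Rightarrow> ('s, 'x, 'e) bimodule_scheme \<Rightarrow> ('s, 'y, 'f) bimodule_scheme
    \<Rightarrow> ('z, 'g) ring_scheme \<Rightarrow> ('x \<Rightarrow> 'y \<Rightarrow> 'z) \<Rightarrow> bool"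
where
  "balanced S X Y Z b \<longleftrightarrow>
     (\<forall>x\<in>carrier X. add_map Y Z (b x)) \<and> (\<forall>y\<in>carrier Y. add_map X Z (\<lambda>x. b x y))
     \<and> (\<forall>x\<in>carrier X. \<forall>s\<in>carrier S. \<forall>y\<in>carrier Y. b (rsmult X x s) y = b x (s \<odot>\<^bsub>Y\<^esub> y))"

lemma balancedD:
  assumes "balanced S X Y Z b"
  shows "x \<in> carrier X \<Longrightarrow> add_map Y Z (b x)"
    and "y \<in> carrier Y \<Longrightarrow> add_map X Z (\<lambda>x. b x y)"
    and "x \<in> carrier X \<Longrightarrow> s \<in> carrier S \<Longrightarrow> y \<in> carrier Y \<Longrightarrow> b (rsmult X x s) y = b x (s \<odot>\<^bsub>Y\<^esub> y)"
  using assms by (simp_all add: balanced_def)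

lemma balanced_closed: "balanced S X Y Z b \<Longrightarrow> x \<in> carrier X \<Longrightarrow> y \<in> carrier Y \<Longrightarrow> b x y \<in> carrier Z"
  by (rule add_map_closed[OF balancedD(1)])

lemma balancedI:
  assumes "\<And>x y. x \<in> carrier X \<Longrightarrow> y \<in> carrier Y \<Longrightarrow> b x y \<in> carrier Z"
    and "\<And>x x' y. x \<in> carrier X \<Longrightarrow> x' \<in> carrier X \<Longrightarrow> y \<in> carrier Y \<Longrightarrow>
      b (x \<oplus>\<^bsub>X\<^esub> x') y = b x y \<oplus>\<^bsub>Z\<^esub> b x' y"
    and "\<And>x y y'. x \<in> carrier X \<Longrightarrow> y \<in> carrier Y \<Longrightarrow> y' \<in> carrier Y \<Longrightarrow>
      b x (y \<oplus>\<^bsub>Y\<^esub> y') = b x y \<oplus>\<^bsub>Z\<^esub> b x y'"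
    and "\<And>x s y. x \<in> carrier X \<Longrightarrow> s \<in> carrier S \<Longrightarrow> y \<in> carrier Y \<Longrightarrow>
      b (rsmult X x s) y = b x (s \<odot>\<^bsub>Y\<^esub> y)"
  shows "balanced S X Y Z b"
  unfolding balanced_def using assms by (intro conjI ballI add_mapI)

text \<open>Closure under the two actions is all that enters here, so the locale applies to tensor products over the integers, over
  \<open>R\<close> and over \<open>A\<close> alike.\<close>

locale tensor_pair =
  fixes S :: "('s, 'u) ring_scheme" and X :: "('s, 'x, 'e) bimodule_scheme"
    and Y :: "('s, 'y, 'f) bimodule_scheme"
  assumes X_group: "abelian_group X" and Y_group: "abelian_group Y"
    and rsmult_closed: "x \<in> carrier X \<Longrightarrow> s \<in> carrier S \<Longrightarrow> rsmult X x s \<in> carrier X"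
    and smult_closed: "y \<in> carrier Y \<Longrightarrow> s \<in> carrier S \<Longrightarrow> s \<odot>\<^bsub>Y\<^esub> y \<in> carrier Y"
begin

sublocale X: abelian_group X by (rule X_group)
sublocale Y: abelian_group Y by (rule Y_group)

abbreviation F where "F \<equiv> free_Abelian_group (carrier X \<times> carrier Y)"
abbreviation T where "T \<equiv> tensor_ring S X Y"
abbreviation pure where "pure \<equiv> pure_tensor S X Y"

sublocale F: comm_group F by (rule abelian_free_Abelian_group)

lemma relations_in_F: "tensor_relations S X Y \<subseteq> carrier F"
  unfolding tensor_relations_def
  by (auto dest!: subsetD[OF keys_diff] simp: rsmult_closed smult_closed)

lemma null_subgroup: "subgroup (tensor_null S X Y) F"
  unfolding tensor_null_def by (rule F.generate_is_subgroup[OF relations_in_F])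

sublocale null: normal "tensor_null S X Y" F
  by (rule F.subgroup_imp_normal[OF null_subgroup])

lemma add_monoid_T: "add_monoid T = tensor_group S X Y"
  by (simp add: tensor_ring_def)

lemma T_group: "abelian_group T"
proof (rule comm_group_abelian_groupI)
  show "comm_group (add_monoid T)"
    unfolding add_monoid_T tensor_group_def by (rule F.abelian_FactGroup[OF null_subgroup])
qed

sublocale T: abelian_group T by (rule T_group)

lemma carrier_T: "carrier T = (\<lambda>c. tensor_null S X Y #>\<^bsub>F\<^esub> c) ` carrier F"
  by (simp add: tensor_ring_def tensor_group_def carrier_FactGroup)

lemma pure_closed [simp]: "x \<in> carrier X \<Longrightarrow> y \<in> carrier Y \<Longrightarrow> pure x y \<in> carrier T"
  unfolding carrier_T pure_tensor_def by (rule imageI) simp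

lemma coset_add:
  assumes "c \<in> carrier F" "d \<in> carrier F"
  shows "(tensor_null S X Y #>\<^bsub>F\<^esub> c) \<oplus>\<^bsub>T\<^esub> (tensor_null S X Y #>\<^bsub>F\<^esub> d) = tensor_null S X Y #>\<^bsub>F\<^esub> (c + d)"
  using null.rcos_sum[OF assms] by (simp add: tensor_ring_def tensor_group_def)

lemma coset_eqI:
  assumes "c \<in> carrier F" "d \<in> carrier F" "c - d \<in> tensor_null S X Y"
  shows "tensor_null S X Y #>\<^bsub>F\<^esub> c = tensor_null S X Y #>\<^bsub>F\<^esub> d"
proof -
  have "(c - d) + d \<in> tensor_null S X Y #>\<^bsub>F\<^esub> d"
    using F.rcosI[OF assms(3) null.subset assms(2)] by simp
  then show ?thesis using F.repr_independence[OF _ assms(2) null_subgroup, of c] by simp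
qed

lemma pure_relation:
  "c - d \<in> tensor_relations S X Y \<Longrightarrow> c \<in> carrier F \<Longrightarrow> d \<in> carrier F \<Longrightarrow>
     tensor_null S X Y #>\<^bsub>F\<^esub> c = tensor_null S X Y #>\<^bsub>F\<^esub> d"
  by (rule coset_eqI) (auto simp: tensor_null_def generate.incl)

lemma pure_add_left:
  assumes "x \<in> carrier X" "x' \<in> carrier X" "y \<in> carrier Y"
  shows "pure (x \<oplus>\<^bsub>X\<^esub> x') y = pure x y \<oplus>\<^bsub>T\<^esub> pure x' y"
proof -
  have "frag_of (x \<oplus>\<^bsub>X\<^esub> x', y) - (frag_of (x, y) + frag_of (x', y)) \<in> tensor_relations S X Y"
    unfolding tensor_relations_def diff_diff_eq[symmetric] using assms by blast
  moreover have *: "frag_of (x, y) \<in> carrier F" "frag_of (x', y) \<in> carrier F" using assms by simp_all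
  moreover have "frag_of (x \<oplus>\<^bsub>X\<^esub> x', y) \<in> carrier F" using assms by simp
  ultimately have "tensor_null S X Y #>\<^bsub>F\<^esub> frag_of (x \<oplus>\<^bsub>X\<^esub> x', y)
      = tensor_null S X Y #>\<^bsub>F\<^esub> (frag_of (x, y) + frag_of (x', y))"
    using F.m_closed[OF *] by (intro pure_relation) (simp_all only: mult_free_Abelian_group)
  then show ?thesis unfolding pure_tensor_def coset_add[OF *] .
qed

lemma pure_add_right:
  assumes "x \<in> carrier X" "y \<in> carrier Y" "y' \<in> carrier Y"
  shows "pure x (y \<oplus>\<^bsub>Y\<^esub> y') = pure x y \<oplus>\<^bsub>T\<^esub> pure x y'"
proof -
  have "frag_of (x, y \<oplus>\<^bsub>Y\<^esub> y') - (frag_of (x, y) + frag_of (x, y')) \<in> tensor_relations S X Y"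
    unfolding tensor_relations_def diff_diff_eq[symmetric] using assms by blast
  moreover have *: "frag_of (x, y) \<in> carrier F" "frag_of (x, y') \<in> carrier F" using assms by simp_all
  moreover have "frag_of (x, y \<oplus>\<^bsub>Y\<^esub> y') \<in> carrier F" using assms by simp
  ultimately have "tensor_null S X Y #>\<^bsub>F\<^esub> frag_of (x, y \<oplus>\<^bsub>Y\<^esub> y')
      = tensor_null S X Y #>\<^bsub>F\<^esub> (frag_of (x, y) + frag_of (x, y'))"
    using F.m_closed[OF *] by (intro pure_relation) (simp_all only: mult_free_Abelian_group)
  then show ?thesis unfolding pure_tensor_def coset_add[OF *] .
qed

lemma pure_balanced:
  assumes "x \<in> carrier X" "s \<in> carrier S" "y \<in> carrier Y"
  shows "pure (rsmult X x s) y = pure x (s \<odot>\<^bsub>Y\<^esub> y)"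
proof -
  have "frag_of (rsmult X x s, y) - frag_of (x, s \<odot>\<^bsub>Y\<^esub> y) \<in> tensor_relations S X Y"
    unfolding tensor_relations_def using assms by blast
  then show ?thesis
    unfolding pure_tensor_def using assms by (intro pure_relation) (simp_all add: rsmult_closed smult_closed)
qed

lemma balanced_pure: "balanced S X Y T pure"
  by (intro balancedI pure_closed pure_add_left pure_add_right pure_balanced)

lemma pure_zero: "pure \<zero>\<^bsub>X\<^esub> \<zero>\<^bsub>Y\<^esub> = \<zero>\<^bsub>T\<^esub>"
  by (rule add_map_zero[OF balancedD(1)[OF balanced_pure] Y_group T_group]) simp

lemma pure_minus: "x \<in> carrier X \<Longrightarrow> y \<in> carrier Y \<Longrightarrow> pure (\<ominus>\<^bsub>X\<^esub> x) y = \<ominus>\<^bsub>T\<^esub> pure x y"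
  by (rule add_map_minus[OF balancedD(2)[OF balanced_pure] X_group T_group])

text \<open>Pure tensors generate under addition alone, because \<open>0 = 0 \<otimes> 0\<close> and \<open>- (x \<otimes> y) = (- x) \<otimes> y\<close>.\<close>

lemma tensor_induct [consumes 1, case_names pure add]:
  assumes t: "t \<in> carrier T"
    and pure: "\<And>x y. x \<in> carrier X \<Longrightarrow> y \<in> carrier Y \<Longrightarrow> P (pure x y)"
    and add: "\<And>t u. t \<in> carrier T \<Longrightarrow> u \<in> carrier T \<Longrightarrow> P t \<Longrightarrow> P u \<Longrightarrow> P (t \<oplus>\<^bsub>T\<^esub> u)"
  shows "P t"
proof -
  let ?q = "\<lambda>c. tensor_null S X Y #>\<^bsub>F\<^esub> c"
  have q_closed: "?q c \<in> carrier T" if "c \<in> carrier F" for c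
    using that unfolding carrier_T by (rule imageI)
  have q_hom: "?q (c + d) = ?q c \<oplus>\<^bsub>T\<^esub> ?q d" if "c \<in> carrier F" "d \<in> carrier F" for c d
    using coset_add[OF that] by simp
  have q_zero: "?q 0 = \<zero>\<^bsub>T\<^esub>"
    using F.coset_mult_one[OF null.subset] by (simp add: tensor_ring_def tensor_group_def)
  \<comment> \<open>the free group is generated under differences, so \<open>c\<close> and \<open>- c\<close> are treated together\<close>
  have "P (?q c) \<and> P (?q (- c))" if "c \<in> carrier F" for c
  proof -
    have "Poly_Mapping.keys c \<subseteq> carrier X \<times> carrier Y" using that by simp
    then show ?thesis
    proof (induction c rule: free_Abelian_group_induct[consumes 1, case_names zero diff single])
      case zero
      have "P \<zero>\<^bsub>T\<^esub>" using pure[of "\<zero>\<^bsub>X\<^esub>" "\<zero>\<^bsub>Y\<^esub>"] by (simp add: pure_zero)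
      then show ?case by (simp add: q_zero)
    next
      case (diff c d)
      then have "P (?q c \<oplus>\<^bsub>T\<^esub> ?q (- d))" "P (?q (- c) \<oplus>\<^bsub>T\<^esub> ?q d)"
        by (auto intro!: add q_closed)
      moreover have "?q (c - d) = ?q c \<oplus>\<^bsub>T\<^esub> ?q (- d)" "?q (- (c - d)) = ?q (- c) \<oplus>\<^bsub>T\<^esub> ?q d"
        using diff q_hom[of c "- d"] q_hom[of "- c" d] by auto
      ultimately show ?case by simp
    next
      case (single p)
      obtain x y where p: "p = (x, y)" "x \<in> carrier X" "y \<in> carrier Y" using single by auto
      have "?q (frag_of p) \<oplus>\<^bsub>T\<^esub> ?q (- frag_of p) = \<zero>\<^bsub>T\<^esub>"
        using q_hom[of "frag_of p" "- frag_of p"] single by (simp add: q_zero)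
      then have "?q (- frag_of p) = \<ominus>\<^bsub>T\<^esub> ?q (frag_of p)"
        using T.minus_equality[of "?q (- frag_of p)" "?q (frag_of p)"] single q_closed
        by (simp add: T.a_comm)
      also have "\<dots> = pure (\<ominus>\<^bsub>X\<^esub> x) y" using p by (simp add: pure_minus) (simp add: pure_tensor_def)
      finally have "?q (- frag_of p) = pure (\<ominus>\<^bsub>X\<^esub> x) y" .
      moreover have "?q (frag_of p) = pure x y" by (simp add: p pure_tensor_def)
      ultimately show ?case using p by (auto intro!: pure)
    qed
  qed
  moreover obtain c where "c \<in> carrier F" "t = ?q c"
    using t unfolding carrier_T by (rule imageE)
  ultimately show ?thesis by blast
qed

text \<open>The extension of \<open>b\<close> to formal sums kills the defining relations, hence is constant on cosets, and \<open>tensor_lift\<close> takes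
  its value at an arbitrary representative.\<close>

lemma lift_coset:
  assumes Z: "abelian_group Z" and b: "balanced S X Y Z b" and c: "c \<in> carrier F"
  shows "tensor_lift Z b (tensor_null S X Y #>\<^bsub>F\<^esub> c) = frag_sum Z (\<lambda>p. b (fst p) (snd p)) c"
proof -
  interpret Z: abelian_group Z by fact
  let ?b = "\<lambda>p. b (fst p) (snd p)"
  have clo: "b x y \<in> carrier Z" if "x \<in> carrier X" "y \<in> carrier Y" for x y
    using balanced_closed[OF b] that by blast
  have "?b \<in> carrier X \<times> carrier Y \<rightarrow> carrier Z" using clo by auto
  from Z.frag_sum_hom[OF this]
  interpret h: group_hom F "add_monoid Z" "frag_sum Z ?b"
    by unfold_locales
  have ofb: "frag_sum Z ?b (frag_of (x, y)) = b x y" if "x \<in> carrier X" "y \<in> carrier Y" for x y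
    using Z.frag_sum_of[of ?b "(x, y)"] clo that by simp
  have diff: "frag_sum Z ?b (c - d) = frag_sum Z ?b c \<ominus>\<^bsub>Z\<^esub> frag_sum Z ?b d"
    if "c \<in> carrier F" "d \<in> carrier F" for c d
  proof -
    have "frag_sum Z ?b (c + - d) = frag_sum Z ?b c \<oplus>\<^bsub>Z\<^esub> frag_sum Z ?b (- d)"
      using h.hom_mult[of c "- d"] that by simp
    moreover have "frag_sum Z ?b (- d) = \<ominus>\<^bsub>Z\<^esub> frag_sum Z ?b d"
      using h.hom_inv[of d] that by (simp add: a_inv_def)
    ultimately show ?thesis by (simp add: a_minus_def)
  qed
  have "tensor_relations S X Y \<subseteq> kernel F (add_monoid Z) (frag_sum Z ?b)"
  proof
    fix r assume r: "r \<in> tensor_relations S X Y"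
    then have rF: "r \<in> carrier F" using relations_in_F by blast
    have "frag_sum Z ?b r = \<zero>\<^bsub>Z\<^esub>"
      using r unfolding tensor_relations_def
    proof (elim UnE CollectE exE conjE)
      fix x x' y assume *: "x \<in> carrier X" "x' \<in> carrier X" "y \<in> carrier Y"
        "r = frag_of (x \<oplus>\<^bsub>X\<^esub> x', y) - frag_of (x, y) - frag_of (x', y)"
      have "b (x \<oplus>\<^bsub>X\<^esub> x') y = b x y \<oplus>\<^bsub>Z\<^esub> b x' y" by (rule add_map_add[OF balancedD(2)[OF b *(3)] *(1,2)])
      moreover have "Poly_Mapping.keys (frag_of (x \<oplus>\<^bsub>X\<^esub> x', y) - frag_of (x, y)) \<subseteq> carrier X \<times> carrier Y"
        using * by (intro order_trans[OF keys_diff]) auto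
      ultimately show ?thesis using *(1-3) unfolding *(4)
        by (simp add: diff ofb clo Z.add_diff_diff)
    next
      fix x y y' assume *: "x \<in> carrier X" "y \<in> carrier Y" "y' \<in> carrier Y"
        "r = frag_of (x, y \<oplus>\<^bsub>Y\<^esub> y') - frag_of (x, y) - frag_of (x, y')"
      have "b x (y \<oplus>\<^bsub>Y\<^esub> y') = b x y \<oplus>\<^bsub>Z\<^esub> b x y'" by (rule add_map_add[OF balancedD(1)[OF b *(1)] *(2,3)])
      moreover have "Poly_Mapping.keys (frag_of (x, y \<oplus>\<^bsub>Y\<^esub> y') - frag_of (x, y)) \<subseteq> carrier X \<times> carrier Y"
        using * by (intro order_trans[OF keys_diff]) auto
      ultimately show ?thesis using *(1-3) unfolding *(4)
        by (simp add: diff ofb clo Z.add_diff_diff)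
    next
      fix x s y assume *: "x \<in> carrier X" "s \<in> carrier S" "y \<in> carrier Y"
        "r = frag_of (rsmult X x s, y) - frag_of (x, s \<odot>\<^bsub>Y\<^esub> y)"
      have "b (rsmult X x s) y = b x (s \<odot>\<^bsub>Y\<^esub> y)" by (rule balancedD(3)[OF b *(1,2,3)])
      then have "b (rsmult X x s) y \<ominus>\<^bsub>Z\<^esub> b x (s \<odot>\<^bsub>Y\<^esub> y) = \<zero>\<^bsub>Z\<^esub>"
        using clo[of x "s \<odot>\<^bsub>Y\<^esub> y"] * by (simp add: smult_closed Z.minus_eq Z.r_neg)
      then show ?thesis using *(1-3) unfolding *(4)
        by (simp add: diff ofb rsmult_closed smult_closed)
    qed
    then show "r \<in> kernel F (add_monoid Z) (frag_sum Z ?b)" using rF by (simp add: kernel_def)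
  qed
  then have ker: "tensor_null S X Y \<subseteq> kernel F (add_monoid Z) (frag_sum Z ?b)"
    unfolding tensor_null_def
    by (rule F.generate_subgroup_incl) (rule h.subgroup_kernel)
  have const: "frag_sum Z ?b d = frag_sum Z ?b c" if d: "d \<in> tensor_null S X Y #>\<^bsub>F\<^esub> c" for d
  proof -
    obtain n where n: "n \<in> tensor_null S X Y" "d = n + c"
      using d unfolding r_coset_def by auto
    then have "n \<in> carrier F" "frag_sum Z ?b n = \<zero>\<^bsub>Z\<^esub>"
      using subsetD[OF ker n(1)] by (auto simp: kernel_def)
    then show ?thesis using h.hom_mult[of n c] h.hom_closed[of c] c n(2) by simp
  qed
  have "tensor_null S X Y #>\<^bsub>F\<^esub> c \<noteq> {}" using F.rcos_self[OF c null_subgroup] by blast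
  then have "the_elem (frag_sum Z ?b ` (tensor_null S X Y #>\<^bsub>F\<^esub> c)) = frag_sum Z ?b c"
    using const by (rule the_elem_image_unique)
  moreover have "tensor_lift Z b t = the_elem (frag_sum Z ?b ` t)" for t
    by (simp add: tensor_lift_def frag_sum_def[abs_def])
  ultimately show ?thesis by simp
qed


lemma lift_pure:
  assumes Z: "abelian_group Z" and b: "balanced S X Y Z b" and xy: "x \<in> carrier X" "y \<in> carrier Y"
  shows "tensor_lift Z b (pure x y) = b x y"
proof -
  have "b x y \<in> carrier Z" using balanced_closed[OF b] xy by blast
  then show ?thesis
    unfolding pure_tensor_def using xy abelian_group.frag_sum_of[OF Z, of "\<lambda>p. b (fst p) (snd p)" "(x,y)"]
    by (simp add: lift_coset[OF Z b])
qed

lemma lift_add_map: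
  assumes Z: "abelian_group Z" and b: "balanced S X Y Z b"
  shows "add_map T Z (tensor_lift Z b)"
proof -
  interpret Z: abelian_group Z by fact
  let ?b = "\<lambda>p. b (fst p) (snd p)"
  have "?b \<in> carrier X \<times> carrier Y \<rightarrow> carrier Z"
    using balanced_closed[OF b] by auto
  from Z.frag_sum_hom[OF this]
  interpret h: group_hom F "add_monoid Z" "frag_sum Z ?b"
    by unfold_locales
  have rep: "\<exists>c\<in>carrier F. t = tensor_null S X Y #>\<^bsub>F\<^esub> c" if "t \<in> carrier T" for t
    using that unfolding carrier_T image_iff .
  show ?thesis
  proof (rule add_mapI)
    fix t assume "t \<in> carrier T"
    from rep[OF this] obtain c where c: "c \<in> carrier F" "t = tensor_null S X Y #>\<^bsub>F\<^esub> c" ..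
    show "tensor_lift Z b t \<in> carrier Z"
      using h.hom_closed[OF c(1)] lift_coset[OF Z b c(1)] c(2) by simp
  next
    fix t u assume t: "t \<in> carrier T" and u: "u \<in> carrier T"
    from rep[OF t] obtain c where c: "c \<in> carrier F" "t = tensor_null S X Y #>\<^bsub>F\<^esub> c" ..
    from rep[OF u] obtain d where d: "d \<in> carrier F" "u = tensor_null S X Y #>\<^bsub>F\<^esub> d" ..
    have "c + d \<in> carrier F" using F.m_closed[OF c(1) d(1)] by simp
    from lift_coset[OF Z b this]
    show "tensor_lift Z b (t \<oplus>\<^bsub>T\<^esub> u) = tensor_lift Z b t \<oplus>\<^bsub>Z\<^esub> tensor_lift Z b u"
      using h.hom_mult[OF c(1) d(1)] lift_coset[OF Z b c(1)] lift_coset[OF Z b d(1)]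
      by (simp add: c(2) d(2) coset_add[OF c(1) d(1)])
  qed
qed

lemma add_map_eqI:
  assumes "add_map T Z h" "add_map T Z k" "t \<in> carrier T"
    and "\<And>x y. x \<in> carrier X \<Longrightarrow> y \<in> carrier Y \<Longrightarrow> h (pure x y) = k (pure x y)"
  shows "h t = k t"
  using assms(3)
  by (induction t rule: tensor_induct) (simp_all add: assms(4) add_map_add[OF assms(1)] add_map_add[OF assms(2)])

end

section \<open>Bimodules\<close>

lemma abelian_group_transfer:
  assumes "abelian_group G" "carrier H = carrier G" "add H = add G" "ring.zero H = ring.zero G"
  shows "abelian_group H"
proof -
  interpret G: abelian_group G by fact
  show ?thesis
  proof (rule abelian_groupI)
    fix x assume "x \<in> carrier H"
    then show "\<exists>y\<in>carrier H. y \<oplus>\<^bsub>H\<^esub> x = \<zero>\<^bsub>H\<^esub>"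
      using G.l_neg[of x] G.a_inv_closed[of x] assms by (intro bexI[of _ "\<ominus>\<^bsub>G\<^esub> x"]) simp_all
  qed (simp_all add: assms G.a_assoc, simp_all add: G.a_comm)
qed

text \<open>Two commuting actions of one commutative ring; \<open>central_bimod\<close> below adds that the scalars from \<open>R\<close> act equally from both
  sides.\<close>

locale bimod = module S B for S and B :: "('s, 'b, 'e) bimodule_scheme" (structure) +
  assumes rsmult_closed: "x \<in> carrier B \<Longrightarrow> a \<in> carrier S \<Longrightarrow> rsmult B x a \<in> carrier B"
    and rsmult_add_left: "x \<in> carrier B \<Longrightarrow> y \<in> carrier B \<Longrightarrow> a \<in> carrier S \<Longrightarrow>
      rsmult B (x \<oplus>\<^bsub>B\<^esub> y) a = rsmult B x a \<oplus>\<^bsub>B\<^esub> rsmult B y a"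
    and rsmult_add_right: "x \<in> carrier B \<Longrightarrow> a \<in> carrier S \<Longrightarrow> b \<in> carrier S \<Longrightarrow>
      rsmult B x (a \<oplus>\<^bsub>S\<^esub> b) = rsmult B x a \<oplus>\<^bsub>B\<^esub> rsmult B x b"
    and rsmult_assoc: "x \<in> carrier B \<Longrightarrow> a \<in> carrier S \<Longrightarrow> b \<in> carrier S \<Longrightarrow>
      rsmult B x (a \<otimes>\<^bsub>S\<^esub> b) = rsmult B (rsmult B x a) b"
    and rsmult_one: "x \<in> carrier B \<Longrightarrow> rsmult B x \<one>\<^bsub>S\<^esub> = x"
    and rsmult_smult: "x \<in> carrier B \<Longrightarrow> a \<in> carrier S \<Longrightarrow> b \<in> carrier S \<Longrightarrow>
      rsmult B (a \<odot>\<^bsub>B\<^esub> x) b = a \<odot>\<^bsub>B\<^esub> rsmult B x b"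
begin

lemma add_map_smult: "a \<in> carrier S \<Longrightarrow> add_map B B (\<lambda>x. a \<odot>\<^bsub>B\<^esub> x)"
  by (rule add_mapI) (simp_all add: smult_r_distr)

lemma add_map_rsmult: "a \<in> carrier S \<Longrightarrow> add_map B B (\<lambda>x. rsmult B x a)"
  by (rule add_mapI) (simp_all add: rsmult_closed rsmult_add_left)

end

lemma right_module_simps [simp]:
  "carrier (right_module B) = carrier B" "add (right_module B) = add B"
  "ring.zero (right_module B) = ring.zero B" "smult (right_module B) = (\<lambda>a x. rsmult B x a)"
  by (simp_all add: right_module_def)

lemma bimod_iff:
  "bimod S B \<longleftrightarrow> module S B \<and> module S (right_module B) \<and>
     (\<forall>a\<in>carrier S. \<forall>b\<in>carrier S. \<forall>x\<in>carrier B. rsmult B (a \<odot>\<^bsub>B\<^esub> x) b = a \<odot>\<^bsub>B\<^esub> rsmult B x b)"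
  (is "_ \<longleftrightarrow> ?r")
proof
  assume "bimod S B"
  then interpret bimod S B .
  have "abelian_group (right_module B)"
    by (rule abelian_group_transfer[OF M.abelian_group_axioms]) simp_all
  then have "module S (right_module B)"
    by (intro moduleI R.is_cring)
      (simp_all add: rsmult_closed rsmult_add_left rsmult_add_right rsmult_one rsmult_assoc[symmetric] R.m_comm)
  then show ?r using module_axioms rsmult_smult by simp
next
  assume r: ?r
  then interpret L: module S B by simp
  interpret Q: module S "right_module B" using r by simp
  show "bimod S B"
  proof
    fix x a b assume "x \<in> carrier B" "a \<in> carrier S" "b \<in> carrier S"
    then show "rsmult B x (a \<otimes>\<^bsub>S\<^esub> b) = rsmult B (rsmult B x a) b"
      using Q.smult_assoc1[of b a x] by (simp add: L.m_comm)
  qed (use Q.smult_closed Q.smult_l_distr Q.smult_r_distr Q.smult_one r in simp_all)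
qed

locale central_bimod = A: algebra R A + B: bimod A B for R A and B :: "('s, 'b, 'e) bimodule_scheme" +
  assumes central: "r \<in> carrier R \<Longrightarrow> x \<in> carrier B \<Longrightarrow>
    rsmult B x (r \<odot>\<^bsub>A\<^esub> \<one>\<^bsub>A\<^esub>) = (r \<odot>\<^bsub>A\<^esub> \<one>\<^bsub>A\<^esub>) \<odot>\<^bsub>B\<^esub> x"

lemma is_bimodule_iff: "is_bimodule R A B \<longleftrightarrow> central_bimod R A B"
  unfolding is_bimodule_def central_bimod_def central_bimod_axioms_def bimod_iff
  by (rule iffI; elim conjE; intro conjI; simp)

lemma tensor_simps:
  "carrier (tensor S X Y) = carrier (tensor_ring S X Y)" "add (tensor S X Y) = add (tensor_ring S X Y)"
  "ring.zero (tensor S X Y) = ring.zero (tensor_ring S X Y)"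
  "smult (tensor S X Y) s = tensor_lift (tensor_ring S X Y) (\<lambda>x y. pure_tensor S X Y (s \<odot>\<^bsub>X\<^esub> x) y)"
  "rsmult (tensor S X Y) t s = tensor_lift (tensor_ring S X Y) (\<lambda>x y. pure_tensor S X Y x (rsmult Y y s)) t"
  by (simp_all add: tensor_def)

locale tensor_bimod = X: bimod S X + Y: bimod S Y
  for S :: "('s, 'u) ring_scheme" and X :: "('s, 'x, 'e) bimodule_scheme"
    and Y :: "('s, 'y, 'f) bimodule_scheme"

sublocale tensor_bimod \<subseteq> tensor_pair S X Y
  by unfold_locales (simp_all add: X.rsmult_closed)

context tensor_bimod begin

abbreviation XY where "XY \<equiv> tensor S X Y"

lemma XY_group: "abelian_group XY"
  by (rule abelian_group_transfer[OF T_group]) (simp_all add: tensor_simps)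

lemma balanced_smult:
  assumes "s \<in> carrier S" shows "balanced S X Y T (\<lambda>x y. pure (s \<odot>\<^bsub>X\<^esub> x) y)"
  by (rule balancedI)
    (use assms in \<open>simp_all add: X.smult_r_distr pure_add_left pure_add_right pure_balanced X.rsmult_smult[symmetric]\<close>)

lemma balanced_rsmult:
  assumes "s \<in> carrier S" shows "balanced S X Y T (\<lambda>x y. pure x (rsmult Y y s))"
  by (rule balancedI)
    (use assms in \<open>simp_all add: Y.rsmult_closed Y.rsmult_add_left pure_add_left pure_add_right pure_balanced
      Y.rsmult_smult\<close>)

lemma smult_pure [simp]:
  "s \<in> carrier S \<Longrightarrow> x \<in> carrier X \<Longrightarrow> y \<in> carrier Y \<Longrightarrow> s \<odot>\<^bsub>XY\<^esub> pure x y = pure (s \<odot>\<^bsub>X\<^esub> x) y"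
  by (simp add: tensor_simps lift_pure[OF T_group balanced_smult])

lemma rsmult_pure [simp]:
  "s \<in> carrier S \<Longrightarrow> x \<in> carrier X \<Longrightarrow> y \<in> carrier Y \<Longrightarrow> rsmult XY (pure x y) s = pure x (rsmult Y y s)"
  by (simp add: tensor_simps lift_pure[OF T_group balanced_rsmult])

lemma smult_add_map: "s \<in> carrier S \<Longrightarrow> add_map T T (\<lambda>t. s \<odot>\<^bsub>XY\<^esub> t)"
  using lift_add_map[OF T_group balanced_smult] by (simp add: tensor_simps)

lemma rsmult_add_map: "s \<in> carrier S \<Longrightarrow> add_map T T (\<lambda>t. rsmult XY t s)"
  using lift_add_map[OF T_group balanced_rsmult] by (simp add: tensor_simps)

lemma id_add_map: "add_map T T (\<lambda>t. t)" by (rule add_mapI) simp_all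

text \<open>Both sides of each law are additive, and on pure tensors the law is one of \<open>X\<close> or of \<open>Y\<close>.\<close>

lemma bimod_XY: "bimod S XY"
proof -
  note intros = add_map_comp smult_add_map rsmult_add_map add_map_sum id_add_map T_group
  have "module S XY"
  proof (rule moduleI[OF X.R.is_cring XY_group], goal_cases)
    case (1 a x) then show ?case using add_map_closed[OF smult_add_map] by (simp add: tensor_simps(1))
  next
    case (2 a b x)
    then have x: "x \<in> carrier T" by (simp add: tensor_simps)
    have "(a \<oplus>\<^bsub>S\<^esub> b) \<odot>\<^bsub>XY\<^esub> x = a \<odot>\<^bsub>XY\<^esub> x \<oplus>\<^bsub>T\<^esub> b \<odot>\<^bsub>XY\<^esub> x"
      by (rule add_map_eqI[where Z = T, OF _ _ x])
        (use 2(1,2) in \<open>simp_all add: X.smult_l_distr pure_add_left intros\<close>)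
    then show ?case by (simp add: tensor_simps(2))
  next
    case (3 a x y) then show ?case using add_map_add[OF smult_add_map] by (simp add: tensor_simps(1,2))
  next
    case (4 a b x)
    then have x: "x \<in> carrier T" by (simp add: tensor_simps)
    show ?case
      by (rule add_map_eqI[where Z = T, OF _ _ x])
        (use 4(1,2) in \<open>simp_all add: X.smult_assoc1 intros add_map_comp[OF smult_add_map smult_add_map]\<close>)
  next
    case (5 x)
    then have x: "x \<in> carrier T" by (simp add: tensor_simps)
    show ?case by (rule add_map_eqI[where Z = T, OF _ _ x]) (simp_all add: intros)
  qed
  then interpret XY: module S XY .
  show ?thesis
  proof (unfold_locales, goal_cases)
    case (1 x a) then show ?case using add_map_closed[OF rsmult_add_map] by (simp add: tensor_simps(1))
  next
    case (2 x y a) then show ?case using add_map_add[OF rsmult_add_map] by (simp add: tensor_simps(1,2))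
  next
    case (3 x a b)
    then have x: "x \<in> carrier T" by (simp add: tensor_simps)
    have "rsmult XY x (a \<oplus>\<^bsub>S\<^esub> b) = rsmult XY x a \<oplus>\<^bsub>T\<^esub> rsmult XY x b"
      by (rule add_map_eqI[where Z = T, OF _ _ x])
        (use 3(2,3) in \<open>simp_all add: Y.rsmult_add_right Y.rsmult_closed pure_add_right intros\<close>)
    then show ?case by (simp add: tensor_simps(2))
  next
    case (4 x a b)
    then have x: "x \<in> carrier T" by (simp add: tensor_simps)
    show ?case
      by (rule add_map_eqI[where Z = T, OF _ _ x])
        (use 4(2,3) in \<open>simp_all add: Y.rsmult_assoc Y.rsmult_closed rsmult_add_map add_map_comp[OF rsmult_add_map rsmult_add_map]\<close>)
  next
    case (5 x)
    then have x: "x \<in> carrier T" by (simp add: tensor_simps)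
    show ?case by (rule add_map_eqI[where Z = T, OF _ _ x]) (simp_all add: intros Y.rsmult_one)
  next
    case (6 x a b)
    then have x: "x \<in> carrier T" by (simp add: tensor_simps)
    show ?case
      by (rule add_map_eqI[where Z = T, OF _ _ x])
        (use 6(2,3) in \<open>simp_all add: Y.rsmult_closed add_map_comp[OF smult_add_map rsmult_add_map] add_map_comp[OF rsmult_add_map smult_add_map]\<close>)
  qed
qed

end

text \<open>For a scalar \<open>r\<close> from \<open>R\<close> one has \<open>r x \<otimes> y = x r \<otimes> y = x \<otimes> r y = x \<otimes> y r\<close>.\<close>

lemma central_tensor:
  assumes X: "central_bimod R A X" and Y: "central_bimod R A Y"
  shows "central_bimod R A (tensor A X Y)"
proof -
  interpret X: central_bimod R A X by fact
  interpret Y: central_bimod R A Y by fact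
  interpret tensor_bimod A X Y ..
  interpret XY: bimod A XY by (rule bimod_XY)
  show ?thesis
  proof (unfold_locales, goal_cases)
    case (1 r x)
    then have x: "x \<in> carrier T" and r: "r \<odot>\<^bsub>A\<^esub> \<one>\<^bsub>A\<^esub> \<in> carrier A" by (simp_all add: tensor_simps)
    show ?case
    proof (rule add_map_eqI[OF rsmult_add_map[OF r] smult_add_map[OF r] x])
      fix x y assume xy: "x \<in> carrier X" "y \<in> carrier Y"
      then show "rsmult XY (pure x y) (r \<odot>\<^bsub>A\<^esub> \<one>\<^bsub>A\<^esub>) = (r \<odot>\<^bsub>A\<^esub> \<one>\<^bsub>A\<^esub>) \<odot>\<^bsub>XY\<^esub> pure x y"
        using 1(1) r pure_balanced[OF xy(1) r xy(2)] by (simp add: X.central Y.central)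
    qed
  qed
qed

lemma symm_bimodule_simps:
  "carrier (symm_bimodule X) = carrier X" "add (symm_bimodule X) = add X"
  "ring.zero (symm_bimodule X) = ring.zero X" "smult (symm_bimodule X) = smult X"
  "rsmult (symm_bimodule X) x a = a \<odot>\<^bsub>X\<^esub> x"
  by (simp_all add: symm_bimodule_def)

lemma bimod_symm:
  assumes "module S X" shows "bimod S (symm_bimodule X)"
proof -
  interpret X: module S X by fact
  note s = symm_bimodule_simps[where X = X]
  have "abelian_group (symm_bimodule X)"
    by (rule abelian_group_transfer[OF X.M.abelian_group_axioms]) (simp_all add: s)
  then interpret Y: module S "symm_bimodule X"
    by (intro moduleI X.R.is_cring) (simp_all add: s X.smult_l_distr X.smult_r_distr X.smult_assoc1)
  show ?thesis
    by unfold_locales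
      (simp_all add: s X.smult_l_distr X.smult_r_distr X.smult_assoc1[symmetric] X.m_comm)
qed

lemma Hom_simps:
  "add (Hom_bimodule R A M N) f g = (\<lambda>x\<in>carrier M. f x \<oplus>\<^bsub>N\<^esub> g x)"
  "ring.zero (Hom_bimodule R A M N) = (\<lambda>x\<in>carrier M. \<zero>\<^bsub>N\<^esub>)"
  "smult (Hom_bimodule R A M N) a f = (\<lambda>x\<in>carrier M. a \<odot>\<^bsub>N\<^esub> f x)"
  "rsmult (Hom_bimodule R A M N) f a = (\<lambda>x\<in>carrier M. f (a \<odot>\<^bsub>M\<^esub> x))"
  by (simp_all add: Hom_bimodule_def)

lemma Hom_carrier:
  "f \<in> carrier (Hom_bimodule R A M N) \<longleftrightarrow> f \<in> extensional (carrier M) \<and> add_map M N f \<and>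
     (\<forall>r\<in>carrier R. \<forall>x\<in>carrier M. f ((r \<odot>\<^bsub>A\<^esub> \<one>\<^bsub>A\<^esub>) \<odot>\<^bsub>M\<^esub> x) = (r \<odot>\<^bsub>A\<^esub> \<one>\<^bsub>A\<^esub>) \<odot>\<^bsub>N\<^esub> f x)"
  by (auto simp: Hom_bimodule_def add_map_def PiE_def)

lemma (in module) smult_comm:
  assumes "a \<in> carrier R" "b \<in> carrier R" "x \<in> carrier M"
  shows "a \<odot>\<^bsub>M\<^esub> (b \<odot>\<^bsub>M\<^esub> x) = b \<odot>\<^bsub>M\<^esub> (a \<odot>\<^bsub>M\<^esub> x)"
  using assms smult_assoc1[of a b x] smult_assoc1[of b a x] by (simp add: R.m_comm)

text \<open>Covers \<open>Hom\<^sub>R(M, N)\<close> and the cochain modules. Negatives come from the scalar \<open>- 1\<close>.\<close>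

lemma module_of_functions:
  fixes F :: "('s, 'i \<Rightarrow> 'n, 'e) module_scheme" and N :: "('s, 'n, 'f) module_scheme"
  assumes N: "module S N" and F: "carrier F \<subseteq> I \<rightarrow>\<^sub>E carrier N"
    and ops: "\<And>f g. f \<oplus>\<^bsub>F\<^esub> g = (\<lambda>x\<in>I. f x \<oplus>\<^bsub>N\<^esub> g x)" "\<zero>\<^bsub>F\<^esub> = (\<lambda>x\<in>I. \<zero>\<^bsub>N\<^esub>)"
      "\<And>a f. a \<odot>\<^bsub>F\<^esub> f = (\<lambda>x\<in>I. a \<odot>\<^bsub>N\<^esub> f x)"
    and add: "\<And>f g. f \<in> carrier F \<Longrightarrow> g \<in> carrier F \<Longrightarrow> f \<oplus>\<^bsub>F\<^esub> g \<in> carrier F"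
    and zero: "\<zero>\<^bsub>F\<^esub> \<in> carrier F"
    and smult: "\<And>a f. a \<in> carrier S \<Longrightarrow> f \<in> carrier F \<Longrightarrow> a \<odot>\<^bsub>F\<^esub> f \<in> carrier F"
  shows "module S F"
proof -
  interpret N: module S N by fact
  have cl: "f x \<in> carrier N" if "f \<in> carrier F" "x \<in> I" for f x
    using PiE_mem[OF subsetD[OF F that(1)] that(2)] .
  have ext: "f = g" if "f \<in> carrier F" "g \<in> carrier F" "\<And>x. x \<in> I \<Longrightarrow> f x = g x" for f g
    by (rule PiE_ext[OF subsetD[OF F that(1)] subsetD[OF F that(2)] that(3)])
  have "abelian_group F"
  proof (rule abelian_groupI)
    fix f assume f: "f \<in> carrier F"
    have "\<ominus>\<^bsub>S\<^esub> \<one>\<^bsub>S\<^esub> \<in> carrier S" by simp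
    from smult[OF this f] show "\<exists>g\<in>carrier F. g \<oplus>\<^bsub>F\<^esub> f = \<zero>\<^bsub>F\<^esub>"
    proof (rule bexI[rotated])
      show "(\<ominus>\<^bsub>S\<^esub> \<one>\<^bsub>S\<^esub>) \<odot>\<^bsub>F\<^esub> f \<oplus>\<^bsub>F\<^esub> f = \<zero>\<^bsub>F\<^esub>"
        unfolding ops by (rule restrict_ext) (simp add: cl[OF f] N.smult_l_minus N.l_neg)
    qed
  qed ((rule add zero; assumption)+, (intro ext add zero; simp add: ops cl N.a_ac)+)
  with N.R.is_cring show ?thesis
  proof (rule moduleI)
  qed ((rule smult; assumption) | (intro ext smult add N.R.a_closed N.R.m_closed N.R.one_closed; simp add: ops cl
    N.smult_l_distr N.smult_r_distr N.smult_assoc1))+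
qed

lemma central_Hom:
  assumes "algebra R A" "module A M" "module A N"
  shows "central_bimod R A (Hom_bimodule R A M N)" (is "central_bimod R A ?H")
proof -
  interpret A: algebra R A by fact
  interpret M: module A M by fact
  interpret N: module A N by fact
  note clo = add_map_closed[of M N]
  have ext: "f = g" if "f \<in> carrier ?H" "g \<in> carrier ?H" "\<And>x. x \<in> carrier M \<Longrightarrow> f x = g x" for f g
    using that extensionalityI[of f "carrier M" g] by (simp add: Hom_carrier)
  have cl: "f x \<in> carrier N" if "f \<in> carrier ?H" "x \<in> carrier M" for f x
    using that by (simp add: Hom_carrier clo)
  have ad: "f (x \<oplus>\<^bsub>M\<^esub> y) = f x \<oplus>\<^bsub>N\<^esub> f y" if "f \<in> carrier ?H" "x \<in> carrier M" "y \<in> carrier M" for f x y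
    using that by (simp add: Hom_carrier add_map_add[of M N])
  have lin: "f ((r \<odot>\<^bsub>A\<^esub> \<one>\<^bsub>A\<^esub>) \<odot>\<^bsub>M\<^esub> x) = (r \<odot>\<^bsub>A\<^esub> \<one>\<^bsub>A\<^esub>) \<odot>\<^bsub>N\<^esub> f x"
    if "f \<in> carrier ?H" "x \<in> carrier M" "r \<in> carrier R" for f x r
    using that by (simp add: Hom_carrier)
  have r1: "r \<odot>\<^bsub>A\<^esub> \<one>\<^bsub>A\<^esub> \<in> carrier A" if "r \<in> carrier R" for r using that by simp
  have add: "f \<oplus>\<^bsub>?H\<^esub> g \<in> carrier ?H" if f: "f \<in> carrier ?H" and g: "g \<in> carrier ?H" for f g
    unfolding Hom_carrier Hom_simps
    by (intro conjI ballI add_mapI)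
      (simp_all add: cl[OF f] cl[OF g] ad[OF f] ad[OF g] lin[OF f] lin[OF g] N.a_ac N.smult_r_distr r1)
  have zero: "\<zero>\<^bsub>?H\<^esub> \<in> carrier ?H"
    unfolding Hom_carrier Hom_simps by (intro conjI ballI add_mapI) (simp_all add: r1)
  have smult: "a \<odot>\<^bsub>?H\<^esub> f \<in> carrier ?H" if f: "f \<in> carrier ?H" and a: "a \<in> carrier A" for f a
    unfolding Hom_carrier Hom_simps
    by (intro conjI ballI add_mapI)
      (simp_all add: cl[OF f] ad[OF f] lin[OF f] N.smult_r_distr r1 a N.smult_comm[of a])
  have rsmult: "rsmult ?H f a \<in> carrier ?H" if f: "f \<in> carrier ?H" and a: "a \<in> carrier A" for f a
    unfolding Hom_carrier Hom_simps
    by (intro conjI ballI add_mapI)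
      (simp_all add: cl[OF f] ad[OF f] lin[OF f] M.smult_r_distr r1 a M.smult_comm[of a])
  interpret H: module A ?H
    by (rule module_of_functions[OF N.module_axioms, of _ "carrier M"])
      (simp_all add: add zero smult, simp_all add: Hom_simps, simp add: Hom_bimodule_def)
  show ?thesis
  proof (unfold_locales, goal_cases)
    case (1 x a) then show ?case by (intro rsmult)
  next
    case (2 x y a)
    then show ?case by (intro ext rsmult add) (simp_all add: Hom_simps cl)
  next
    case (3 x a b)
    then show ?case by (intro ext rsmult add A.a_closed) (simp_all add: Hom_simps cl M.smult_l_distr ad)
  next
    case (4 x a b)
    then show ?case by (intro ext rsmult A.m_closed) (simp_all add: Hom_simps M.smult_assoc1)
  next
    case (5 x)
    then show ?case by (intro ext rsmult A.one_closed) (simp_all add: Hom_simps)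
  next
    case (6 x a b)
    then show ?case by (intro ext rsmult smult) (simp_all add: Hom_simps)
  next
    case (7 r x)
    then show ?case by (intro ext rsmult smult r1) (simp_all add: Hom_simps lin)
  qed
qed

section \<open>Extension of scalars to the ring of integers\<close>

lemma ring_of_integers_simps [simp]:
  "c \<in> carrier ring_of_integers \<longleftrightarrow> algebraic_int c" "add ring_of_integers c d = c + d"
  "ring.zero ring_of_integers = 0"
  by (simp_all add: ring_of_integers_def)

lemma ring_of_integers_group: "abelian_group (ring_of_integers :: 'k::field_char_0 ring)"
proof (rule abelian_groupI)
  fix x :: 'k assume "x \<in> carrier ring_of_integers"
  then show "\<exists>y\<in>carrier ring_of_integers. y \<oplus>\<^bsub>ring_of_integers\<^esub> x = \<zero>\<^bsub>ring_of_integers\<^esub>"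
    by (intro bexI[of _ "- x"]) simp_all
qed (simp_all add: algebraic_int_add ac_simps)

lemma int_bimodule_simps [simp]:
  "carrier (int_bimodule X) = carrier X" "add (int_bimodule X) = add X"
  "ring.zero (int_bimodule X) = ring.zero X" "smult (int_bimodule X) n x = [n] \<cdot>\<^bsub>X\<^esub> x"
  "rsmult (int_bimodule X) x n = [n] \<cdot>\<^bsub>X\<^esub> x"
  by (simp_all add: int_bimodule_def)

lemma int_bimodule_group: "abelian_group X \<Longrightarrow> abelian_group (int_bimodule X)"
  by (rule abelian_group_transfer) simp_all

lemma integers_tensor_pair:
  assumes "abelian_group M"
  shows "tensor_pair \<Z> (int_bimodule (ring_of_integers :: 'k::field_char_0 ring)) (int_bimodule M)"
  by (intro tensor_pair.intro int_bimodule_group ring_of_integers_group assms)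
    (use abelian_group.int_pow_closed[OF assms] abelian_group.int_pow_closed[OF ring_of_integers_group] in simp_all)

definition biadd :: "('m, 'e) ring_scheme \<Rightarrow> ('z, 'f) ring_scheme \<Rightarrow> ('k::field_char_0 \<Rightarrow> 'm \<Rightarrow> 'z) \<Rightarrow> bool" where
  "biadd M Z b \<longleftrightarrow> (\<forall>c. algebraic_int c \<longrightarrow> add_map M Z (b c)) \<and>
     (\<forall>m\<in>carrier M. add_map ring_of_integers Z (\<lambda>c. b c m))"

lemma biaddI:
  assumes "\<And>c m. algebraic_int c \<Longrightarrow> m \<in> carrier M \<Longrightarrow> b c m \<in> carrier Z"
    and "\<And>c c' m. algebraic_int c \<Longrightarrow> algebraic_int c' \<Longrightarrow> m \<in> carrier M \<Longrightarrow>
      b (c + c') m = b c m \<oplus>\<^bsub>Z\<^esub> b c' m"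
    and "\<And>c m m'. algebraic_int c \<Longrightarrow> m \<in> carrier M \<Longrightarrow> m' \<in> carrier M \<Longrightarrow>
      b c (m \<oplus>\<^bsub>M\<^esub> m') = b c m \<oplus>\<^bsub>Z\<^esub> b c m'"
  shows "biadd M Z b"
  unfolding biadd_def by (intro conjI allI impI ballI add_mapI) (simp_all add: assms)

lemma biaddD:
  assumes "biadd M Z b"
  shows "algebraic_int c \<Longrightarrow> m \<in> carrier M \<Longrightarrow> b c m \<in> carrier Z"
    and "algebraic_int c \<Longrightarrow> algebraic_int c' \<Longrightarrow> m \<in> carrier M \<Longrightarrow>
      b (c + c') m = b c m \<oplus>\<^bsub>Z\<^esub> b c' m"
    and "algebraic_int c \<Longrightarrow> m \<in> carrier M \<Longrightarrow> m' \<in> carrier M \<Longrightarrow>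
      b c (m \<oplus>\<^bsub>M\<^esub> m') = b c m \<oplus>\<^bsub>Z\<^esub> b c m'"
  using assms unfolding biadd_def add_map_def by (simp_all add: Pi_iff)

text \<open>An additive map commutes with integer multiples, so over the integers balancedness follows from additivity in
  each argument.\<close>

lemma biadd_balanced:
  fixes M :: "('m, 'e) ring_scheme" and b :: "'k::field_char_0 \<Rightarrow> 'm \<Rightarrow> 'z"
  assumes b: "biadd M Z b" and M: "abelian_group M" and Z: "abelian_group Z"
  shows "balanced \<Z> (int_bimodule ring_of_integers) (int_bimodule M) Z b"
proof (rule balancedI)
  fix c :: 'k and n :: int and m
  assume c: "c \<in> carrier (int_bimodule ring_of_integers)" and m: "m \<in> carrier (int_bimodule M)"
  have "b ([n] \<cdot>\<^bsub>ring_of_integers\<^esub> c) m = [n] \<cdot>\<^bsub>Z\<^esub> b c m"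
    using b c m by (intro add_map_int[OF _ ring_of_integers_group Z, where h = "\<lambda>c. b c m"]) (simp_all add: biadd_def)
  also have "\<dots> = b c ([n] \<cdot>\<^bsub>M\<^esub> m)"
    using b c m by (intro add_map_int[OF _ M Z, symmetric]) (simp_all add: biadd_def)
  finally show "b (rsmult (int_bimodule ring_of_integers) c n) m = b c (n \<odot>\<^bsub>int_bimodule M\<^esub> m)" by simp
qed (simp_all add: biaddD[OF b])

lemma add_map_integers_tensor: "add_map (integers_tensor M) Z h \<longleftrightarrow>
    add_map (tensor_ring \<Z> (int_bimodule ring_of_integers) (int_bimodule M)) Z h"
  by (simp_all add: add_map_def tensor_simps)

context
  fixes M :: "('m, 'e) ring_scheme"
  assumes M: "abelian_group M"
begin

lemma integers_tensor_group: "abelian_group (integers_tensor M :: (int, (('k::field_char_0 \<times> 'm) \<Rightarrow>\<^sub>0 int) set) bimodule)"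
  by (rule abelian_group_transfer[OF tensor_pair.T_group[OF integers_tensor_pair[OF M]]]) (simp_all add: tensor_simps)

lemma biadd_integers_pure:
  "biadd M (integers_tensor M) (integers_pure M :: 'k::field_char_0 \<Rightarrow> 'm \<Rightarrow> (('k \<times> 'm) \<Rightarrow>\<^sub>0 int) set)"
proof -
  interpret P: tensor_pair \<Z> "int_bimodule (ring_of_integers :: 'k ring)" "int_bimodule M" by (rule integers_tensor_pair[OF M])
  show ?thesis
    using P.pure_add_left P.pure_add_right by (intro biaddI) (simp_all add: tensor_simps)
qed

lemmas integers_pure_closed = biaddD(1)[OF biadd_integers_pure]

context
  fixes Z :: "('z, 'f) ring_scheme"
  assumes Z: "abelian_group Z"
begin

lemma integers_lift_pure:
  fixes b :: "'k::field_char_0 \<Rightarrow> 'm \<Rightarrow> 'z"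
  assumes b: "biadd M Z b" and "algebraic_int c" "m \<in> carrier M"
  shows "tensor_lift Z b (integers_pure M c m) = b c m"
  using assms(2,3) by (intro tensor_pair.lift_pure[OF integers_tensor_pair[OF M] Z biadd_balanced[OF b M Z]]) simp_all

lemma integers_lift_add_map:
  fixes b :: "'k::field_char_0 \<Rightarrow> 'm \<Rightarrow> 'z"
  assumes b: "biadd M Z b"
  shows "add_map (integers_tensor M) Z (tensor_lift Z b)"
  unfolding add_map_integers_tensor by (rule tensor_pair.lift_add_map[OF integers_tensor_pair[OF M] Z biadd_balanced[OF b M Z]])

lemma integers_tensor_eqI:
  fixes t :: "(('k::field_char_0 \<times> 'm) \<Rightarrow>\<^sub>0 int) set"
  assumes "add_map (integers_tensor M) Z h" "add_map (integers_tensor M) Z k" "t \<in> carrier (integers_tensor M)"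
    and eq: "\<And>c m. algebraic_int c \<Longrightarrow> m \<in> carrier M \<Longrightarrow> h (integers_pure M c m) = k (integers_pure M c m)"
  shows "h t = k t"
proof (rule tensor_pair.add_map_eqI[OF integers_tensor_pair[OF M]])
  show "add_map (tensor_ring \<Z> (int_bimodule ring_of_integers) (int_bimodule M)) Z h"
    "add_map (tensor_ring \<Z> (int_bimodule ring_of_integers) (int_bimodule M)) Z k"
    using assms(1,2) by (simp_all add: add_map_integers_tensor)
  show "t \<in> carrier (tensor_ring \<Z> (int_bimodule ring_of_integers) (int_bimodule M))"
    using assms(3) by (simp add: tensor_simps)
qed (simp add: eq)

end

end

text \<open>The products on \<open>\<O>\<^sub>K \<otimes> R\<close> and on \<open>\<O>\<^sub>K \<otimes> M\<close> both have this form, with \<open>B c r d m\<close> the product of \<open>c \<otimes> r\<close> and \<open>d \<otimes> m\<close>.\<close>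

definition bilift where
  "bilift Z B t u = tensor_lift Z (\<lambda>c r. tensor_lift Z (B c r) u) t"

context
  fixes L :: "('l, 'd) ring_scheme" and M :: "('m, 'e) ring_scheme" and Z :: "('z, 'f) ring_scheme"
    and B :: "'k::field_char_0 \<Rightarrow> 'l \<Rightarrow> 'k \<Rightarrow> 'm \<Rightarrow> 'z"
  assumes L: "abelian_group L" and M: "abelian_group M" and Z: "abelian_group Z"
    and B1: "\<And>c r. algebraic_int c \<Longrightarrow> r \<in> carrier L \<Longrightarrow> biadd M Z (B c r)"
    and B2: "\<And>d m. algebraic_int d \<Longrightarrow> m \<in> carrier M \<Longrightarrow> biadd L Z (\<lambda>c r. B c r d m)"
begin

lemma bilift_inner:
  assumes u: "u \<in> carrier (integers_tensor M)"
  shows "biadd L Z (\<lambda>c r. tensor_lift Z (B c r) u)"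
proof (rule biaddI)
  note am = integers_lift_add_map[OF M Z B1] and pu = integers_lift_pure[OF M Z B1]
  show "tensor_lift Z (B c r) u \<in> carrier Z" if "algebraic_int c" "r \<in> carrier L" for c r
    by (rule add_map_closed[OF am[OF that] u])
  show "tensor_lift Z (B (c + c') r) u = tensor_lift Z (B c r) u \<oplus>\<^bsub>Z\<^esub> tensor_lift Z (B c' r) u"
    if c: "algebraic_int c" "algebraic_int c'" and r: "r \<in> carrier L" for c c' r
    by (rule integers_tensor_eqI[OF M Z am[OF algebraic_int_add[OF c] r] add_map_sum[OF am[OF c(1) r] am[OF c(2) r] Z] u])
      (simp add: pu c r algebraic_int_add biaddD(2)[OF B2])
  show "tensor_lift Z (B c (r \<oplus>\<^bsub>L\<^esub> r')) u = tensor_lift Z (B c r) u \<oplus>\<^bsub>Z\<^esub> tensor_lift Z (B c r') u"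
    if c: "algebraic_int c" and r: "r \<in> carrier L" "r' \<in> carrier L" for c r r'
  proof -
    have rr: "r \<oplus>\<^bsub>L\<^esub> r' \<in> carrier L" using L r by (simp add: abelian_monoid.a_closed abelian_group.axioms(1))
    show ?thesis
      by (rule integers_tensor_eqI[OF M Z am[OF c rr] add_map_sum[OF am[OF c r(1)] am[OF c r(2)] Z] u])
        (simp add: pu c r rr biaddD(3)[OF B2])
  qed
qed

lemma bilift_left: "u \<in> carrier (integers_tensor M) \<Longrightarrow> add_map (integers_tensor L) Z (\<lambda>t. bilift Z B t u)"
  unfolding bilift_def by (rule integers_lift_add_map[OF L Z bilift_inner])

lemma bilift_pure_left:
  "algebraic_int c \<Longrightarrow> r \<in> carrier L \<Longrightarrow> u \<in> carrier (integers_tensor M) \<Longrightarrow>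
    bilift Z B (integers_pure L c r) u = tensor_lift Z (B c r) u"
  unfolding bilift_def by (rule integers_lift_pure[OF L Z bilift_inner])

lemma bilift_pure:
  "algebraic_int c \<Longrightarrow> r \<in> carrier L \<Longrightarrow> algebraic_int d \<Longrightarrow> m \<in> carrier M \<Longrightarrow>
    bilift Z B (integers_pure L c r) (integers_pure M d m) = B c r d m"
  by (simp add: bilift_pure_left integers_pure_closed[OF M] integers_lift_pure[OF M Z B1])

lemma bilift_right:
  assumes t: "t \<in> carrier (integers_tensor L)"
  shows "add_map (integers_tensor M) Z (\<lambda>u. bilift Z B t u)"
proof (rule add_mapI)
  interpret IM: abelian_group "integers_tensor M :: (int, (('k \<times> 'm) \<Rightarrow>\<^sub>0 int) set) bimodule" by (rule integers_tensor_group[OF M])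
  fix u :: "(('k \<times> 'm) \<Rightarrow>\<^sub>0 int) set" assume u: "u \<in> carrier (integers_tensor M)"
  show "bilift Z B t u \<in> carrier Z" by (rule add_map_closed[OF bilift_left[OF u] t])
  fix u' :: "(('k \<times> 'm) \<Rightarrow>\<^sub>0 int) set" assume u': "u' \<in> carrier (integers_tensor M)"
  note uu = IM.a_closed[OF u u']
  show "bilift Z B t (u \<oplus>\<^bsub>integers_tensor M\<^esub> u') = bilift Z B t u \<oplus>\<^bsub>Z\<^esub> bilift Z B t u'"
    by (rule integers_tensor_eqI[OF L Z bilift_left[OF uu] add_map_sum[OF bilift_left[OF u] bilift_left[OF u'] Z] t])
      (simp add: bilift_pure_left u u' uu add_map_add[OF integers_lift_add_map[OF M Z B1]])
qed

end

text \<open>\<open>IM\<close> and \<open>IR\<close> are \<open>\<O>\<^sub>K \<otimes> M\<close> and \<open>\<O>\<^sub>K \<otimes> R\<close>, and \<open>TM\<close> is \<open>M\<^sup>\<lambda>\<close>.\<close>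

locale twist_data = algebra R A + M: module A M
  for R :: "('r, 'p) ring_scheme" and A :: "('r, 'a, 'q) module_scheme"
    and M :: "('a, 'm, 'e) module_scheme"
    and lam :: "'a \<Rightarrow> (('k::field_char_0 \<times> 'r) \<Rightarrow>\<^sub>0 int) set" +
  assumes lam: "lam \<in> alg_hom R A (integers_algebra R)"
begin

abbreviation IM :: "(int, (('k \<times> 'm) \<Rightarrow>\<^sub>0 int) set) bimodule" where "IM \<equiv> integers_tensor M"
abbreviation IR :: "(int, (('k \<times> 'r) \<Rightarrow>\<^sub>0 int) set) bimodule" where "IR \<equiv> integers_tensor R"
abbreviation TM where "TM \<equiv> twist A M lam"
abbreviation pM :: "'k \<Rightarrow> 'm \<Rightarrow> (('k \<times> 'm) \<Rightarrow>\<^sub>0 int) set" where "pM \<equiv> integers_pure M"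
abbreviation pR :: "'k \<Rightarrow> 'r \<Rightarrow> (('k \<times> 'r) \<Rightarrow>\<^sub>0 int) set" where "pR \<equiv> integers_pure R"
abbreviation act where "act \<equiv> integers_action A M"
abbreviation mulR :: "(('k \<times> 'r) \<Rightarrow>\<^sub>0 int) set \<Rightarrow> _" where "mulR \<equiv> mult (integers_algebra R)"

lemma M_grp: "abelian_group M" and R_grp: "abelian_group R"
  by (rule M.M.abelian_group_axioms R.abelian_group_axioms)+

lemmas IM_grp = integers_tensor_group[OF M_grp, where 'k = 'k]
lemmas IR_grp = integers_tensor_group[OF R_grp, where 'k = 'k]

lemma one_smult_closed: "r \<in> carrier R \<Longrightarrow> r \<odot>\<^bsub>A\<^esub> \<one>\<^bsub>A\<^esub> \<in> carrier A"
  by simp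

lemma one_smult_mult:
  "r \<in> carrier R \<Longrightarrow> s \<in> carrier R \<Longrightarrow> (r \<otimes>\<^bsub>R\<^esub> s) \<odot>\<^bsub>A\<^esub> \<one>\<^bsub>A\<^esub> = (r \<odot>\<^bsub>A\<^esub> \<one>\<^bsub>A\<^esub>) \<otimes>\<^bsub>A\<^esub> (s \<odot>\<^bsub>A\<^esub> \<one>\<^bsub>A\<^esub>)"
  by (simp add: smult_assoc1 smult_assoc2)

lemma pM_closed [simp]: "algebraic_int c \<Longrightarrow> m \<in> carrier M \<Longrightarrow> pM c m \<in> carrier IM"
  by (rule integers_pure_closed[OF M_grp])

lemma pR_closed [simp]: "algebraic_int c \<Longrightarrow> m \<in> carrier R \<Longrightarrow> pR c m \<in> carrier IR"
  by (rule integers_pure_closed[OF R_grp])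

definition "act_form = (\<lambda>c r d m. pM (c * d) ((r \<odot>\<^bsub>A\<^esub> \<one>\<^bsub>A\<^esub>) \<odot>\<^bsub>M\<^esub> m))"
definition "mul_form = (\<lambda>c r d s. pR (c * d) (r \<otimes>\<^bsub>R\<^esub> s))"

lemma act_eq: "act = bilift IM act_form"
  by (intro ext) (simp add: integers_action_def bilift_def act_form_def)

lemma mulR_eq: "mulR = bilift IR mul_form"
  by (intro ext) (simp add: integers_algebra_def bilift_def mul_form_def)

lemma act_form_right: "algebraic_int c \<Longrightarrow> r \<in> carrier R \<Longrightarrow> biadd M IM (act_form c r)"
  unfolding act_form_def
  by (rule biaddI) (simp_all add: algebraic_int_mult ring_distribs M.smult_r_distr biaddD[OF biadd_integers_pure[OF M_grp]])

lemma act_form_left: "algebraic_int d \<Longrightarrow> m \<in> carrier M \<Longrightarrow> biadd R IM (\<lambda>c r. act_form c r d m)"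
  unfolding act_form_def
  by (rule biaddI)
    (simp_all add: algebraic_int_mult ring_distribs smult_l_distr M.smult_l_distr biaddD[OF biadd_integers_pure[OF M_grp]])

lemma mul_form_right: "algebraic_int c \<Longrightarrow> r \<in> carrier R \<Longrightarrow> biadd R IR (mul_form c r)"
  unfolding mul_form_def
  by (rule biaddI) (simp_all add: algebraic_int_mult ring_distribs R.r_distr biaddD[OF biadd_integers_pure[OF R_grp]])

lemma mul_form_left: "algebraic_int d \<Longrightarrow> s \<in> carrier R \<Longrightarrow> biadd R IR (\<lambda>c r. mul_form c r d s)"
  unfolding mul_form_def
  by (rule biaddI) (simp_all add: algebraic_int_mult ring_distribs R.l_distr biaddD[OF biadd_integers_pure[OF R_grp]])

lemma act_left: "u \<in> carrier IM \<Longrightarrow> add_map IR IM (\<lambda>t. act t u)"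
  unfolding act_eq by (rule bilift_left[OF R_grp M_grp IM_grp act_form_right act_form_left])

lemma act_right: "t \<in> carrier IR \<Longrightarrow> add_map IM IM (\<lambda>u. act t u)"
  unfolding act_eq by (rule bilift_right[OF R_grp M_grp IM_grp act_form_right act_form_left])

lemma act_pure:
  "algebraic_int c \<Longrightarrow> r \<in> carrier R \<Longrightarrow> algebraic_int d \<Longrightarrow> m \<in> carrier M \<Longrightarrow>
    act (pR c r) (pM d m) = pM (c * d) ((r \<odot>\<^bsub>A\<^esub> \<one>\<^bsub>A\<^esub>) \<odot>\<^bsub>M\<^esub> m)"
  unfolding act_eq by (subst bilift_pure[OF R_grp M_grp IM_grp act_form_right act_form_left]) (simp_all add: act_form_def)

lemma mulR_left: "u \<in> carrier IR \<Longrightarrow> add_map IR IR (\<lambda>t. mulR t u)"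
  unfolding mulR_eq by (rule bilift_left[OF R_grp R_grp IR_grp mul_form_right mul_form_left])

lemma mulR_right: "t \<in> carrier IR \<Longrightarrow> add_map IR IR (\<lambda>u. mulR t u)"
  unfolding mulR_eq by (rule bilift_right[OF R_grp R_grp IR_grp mul_form_right mul_form_left])

lemma mulR_pure:
  "algebraic_int c \<Longrightarrow> r \<in> carrier R \<Longrightarrow> algebraic_int d \<Longrightarrow> s \<in> carrier R \<Longrightarrow>
    mulR (pR c r) (pR d s) = pR (c * d) (r \<otimes>\<^bsub>R\<^esub> s)"
  unfolding mulR_eq by (subst bilift_pure[OF R_grp R_grp IR_grp mul_form_right mul_form_left]) (simp_all add: mul_form_def)

end

section \<open>The twisted bimodules\<close>

lemma twist_simps:
  "carrier (twist A M lam) = carrier (integers_tensor M)" "add (twist A M lam) = add (integers_tensor M)"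
  "ring.zero (twist A M lam) = ring.zero (integers_tensor M)"
  "smult (twist A M lam) a = tensor_lift (integers_tensor M) (\<lambda>c m. integers_pure M c (a \<odot>\<^bsub>M\<^esub> m))"
  "rsmult (twist A M lam) t a = integers_action A M (lam a) t"
  by (simp_all add: twist_def)

lemma integers_algebra_simps:
  "carrier (integers_algebra R) = carrier (integers_tensor R)" "add (integers_algebra R) = add (integers_tensor R)"
  "one (integers_algebra R) = integers_pure R 1 \<one>\<^bsub>R\<^esub>"
  "smult (integers_algebra R) s = tensor_lift (integers_tensor R) (\<lambda>c r. integers_pure R c (s \<otimes>\<^bsub>R\<^esub> r))"
  by (simp_all add: integers_algebra_def)

context twist_data begin

lemma act_closed: "t \<in> carrier IR \<Longrightarrow> u \<in> carrier IM \<Longrightarrow> act t u \<in> carrier IM"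
  by (rule add_map_closed[OF act_left])

lemma mulR_closed: "t \<in> carrier IR \<Longrightarrow> u \<in> carrier IR \<Longrightarrow> mulR t u \<in> carrier IR"
  by (rule add_map_closed[OF mulR_left])

lemma act_mulR_pure:
  assumes "algebraic_int c" "r \<in> carrier R" "algebraic_int d" "s \<in> carrier R"
    and u: "u \<in> carrier IM"
  shows "act (mulR (pR c r) (pR d s)) u = act (pR c r) (act (pR d s) u)"
proof (rule integers_tensor_eqI[OF M_grp IM_grp _ _ u])
  have "mulR (pR c r) (pR d s) \<in> carrier IR" using assms by (simp add: mulR_closed)
  then show "add_map IM IM (act (mulR (pR c r) (pR d s)))" by (rule act_right)
  show "add_map IM IM (\<lambda>u. act (pR c r) (act (pR d s) u))"
    using assms by (intro add_map_comp[OF act_right act_right]) simp_all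
next
  fix e :: 'k and m assume "algebraic_int e" "m \<in> carrier M"
  with assms(1-4) show "act (mulR (pR c r) (pR d s)) (pM e m) = act (pR c r) (act (pR d s) (pM e m))"
    by (simp add: mulR_pure act_pure algebraic_int_mult mult.assoc one_smult_mult M.smult_assoc1)
qed

text \<open>Pure tensors suffice in each of the three arguments, one after the other.\<close>

lemma act_mulR:
  assumes t: "t \<in> carrier IR" and t': "t' \<in> carrier IR" and u: "u \<in> carrier IM"
  shows "act (mulR t t') u = act t (act t' u)"
proof (rule integers_tensor_eqI[OF R_grp IM_grp _ _ t])
  show "add_map IR IM (\<lambda>t. act (mulR t t') u)"
    by (rule add_map_comp[OF mulR_left[OF t'] act_left[OF u]])
  show "add_map IR IM (\<lambda>t. act t (act t' u))" by (rule act_left[OF act_closed[OF t' u]])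
next
  fix c :: 'k and r assume cr: "algebraic_int c" "r \<in> carrier R"
  then have p: "pR c r \<in> carrier IR" by simp
  show "act (mulR (pR c r) t') u = act (pR c r) (act t' u)"
  proof (rule integers_tensor_eqI[OF R_grp IM_grp _ _ t'])
    show "add_map IR IM (\<lambda>t'. act (mulR (pR c r) t') u)"
      by (rule add_map_comp[OF mulR_right[OF p] act_left[OF u]])
    show "add_map IR IM (\<lambda>t'. act (pR c r) (act t' u))"
      by (rule add_map_comp[OF act_left[OF u] act_right[OF p]])
  qed (rule act_mulR_pure[OF cr _ _ u])
qed

lemma act_one: "u \<in> carrier IM \<Longrightarrow> act (pR 1 \<one>\<^bsub>R\<^esub>) u = u"
  by (rule integers_tensor_eqI[OF M_grp IM_grp act_right add_mapI[where h = "\<lambda>u. u"]])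
    (simp_all add: act_pure)

lemma
  assumes a: "a \<in> carrier A"
  shows smult_add_map: "add_map IM IM (\<lambda>u. a \<odot>\<^bsub>TM\<^esub> u)"
    and smult_pure: "algebraic_int c \<Longrightarrow> m \<in> carrier M \<Longrightarrow> a \<odot>\<^bsub>TM\<^esub> pM c m = pM c (a \<odot>\<^bsub>M\<^esub> m)"
proof -
  have b: "biadd M IM (\<lambda>c m. pM c (a \<odot>\<^bsub>M\<^esub> m))"
    by (rule biaddI) (simp_all add: a M.smult_r_distr biaddD[OF biadd_integers_pure[OF M_grp]])
  show "add_map IM IM (\<lambda>u. a \<odot>\<^bsub>TM\<^esub> u)"
    unfolding twist_simps by (rule integers_lift_add_map[OF M_grp IM_grp b])
  show "a \<odot>\<^bsub>TM\<^esub> pM c m = pM c (a \<odot>\<^bsub>M\<^esub> m)" if "algebraic_int c" "m \<in> carrier M"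
    unfolding twist_simps by (rule integers_lift_pure[OF M_grp IM_grp b that])
qed

lemma lam_hom:
  "a \<in> carrier A \<Longrightarrow> lam a \<in> carrier IR"
  "a \<in> carrier A \<Longrightarrow> b \<in> carrier A \<Longrightarrow> lam (a \<oplus>\<^bsub>A\<^esub> b) = lam a \<oplus>\<^bsub>IR\<^esub> lam b"
  "a \<in> carrier A \<Longrightarrow> b \<in> carrier A \<Longrightarrow> lam (a \<otimes>\<^bsub>A\<^esub> b) = mulR (lam a) (lam b)"
  "lam \<one>\<^bsub>A\<^esub> = pR 1 \<one>\<^bsub>R\<^esub>"
  using lam by (simp_all add: alg_hom_def Ring.ring_hom_def integers_algebra_simps(1-3) Pi_iff)

text \<open>By \<open>R\<close>-linearity \<open>\<lambda>\<close> sends \<open>r 1\<close> to \<open>1 \<otimes> r\<close>; this is why the scalars from \<open>R\<close> act equally from both sides of \<open>M\<^sup>\<lambda>\<close>.\<close>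

lemma lam_scalar:
  assumes r: "r \<in> carrier R" shows "lam (r \<odot>\<^bsub>A\<^esub> \<one>\<^bsub>A\<^esub>) = pR 1 r"
proof -
  have b: "biadd R IR (\<lambda>c s. pR c (r \<otimes>\<^bsub>R\<^esub> s))"
    by (rule biaddI) (simp_all add: r R.r_distr biaddD[OF biadd_integers_pure[OF R_grp]])
  have "lam (r \<odot>\<^bsub>A\<^esub> \<one>\<^bsub>A\<^esub>) = r \<odot>\<^bsub>integers_algebra R\<^esub> lam \<one>\<^bsub>A\<^esub>"
    using lam r by (simp add: alg_hom_def)
  also have "\<dots> = pR 1 (r \<otimes>\<^bsub>R\<^esub> \<one>\<^bsub>R\<^esub>)"
    unfolding lam_hom integers_algebra_simps by (rule integers_lift_pure[OF R_grp IR_grp b]) simp_all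
  finally show ?thesis using r by simp
qed

lemma TM_group: "abelian_group TM"
  by (rule abelian_group_transfer[OF IM_grp]) (simp_all add: twist_simps)

text \<open>Associativity of the right action is multiplicativity of \<open>\<lambda>\<close> together with \<open>act_mulR\<close>; commutativity of \<open>A\<close> turns
  the left action of \<open>\<O>\<^sub>K \<otimes> R\<close> into a right action of \<open>A\<close>.\<close>

lemma central_twist: "central_bimod R A TM"
proof -
  have eqI: "h u = k u" if "add_map IM IM h" "add_map IM IM k" "u \<in> carrier IM"
    "\<And>c m. algebraic_int c \<Longrightarrow> m \<in> carrier M \<Longrightarrow> h (pM c m) = k (pM c m)" for h k u
    by (rule integers_tensor_eqI[OF M_grp IM_grp that])
  have idm: "add_map IM IM (\<lambda>u. u)" by (rule add_mapI) simp_all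
  note pMadd = biaddD(3)[OF biadd_integers_pure[OF M_grp]]
  interpret TM: module A TM
  proof (rule moduleI[OF M_cring TM_group], goal_cases)
    case (1 a x)
    then show ?case using add_map_closed[OF smult_add_map] by (simp add: twist_simps(1))
  next
    case (2 a b x)
    then have x: "x \<in> carrier IM" by (simp add: twist_simps)
    have "(a \<oplus>\<^bsub>A\<^esub> b) \<odot>\<^bsub>TM\<^esub> x = a \<odot>\<^bsub>TM\<^esub> x \<oplus>\<^bsub>IM\<^esub> b \<odot>\<^bsub>TM\<^esub> x"
      by (rule eqI[OF smult_add_map add_map_sum[OF smult_add_map smult_add_map IM_grp] x])
        (use 2(1,2) in \<open>simp_all add: smult_pure M.smult_l_distr pMadd\<close>)
    then show ?case by (simp add: twist_simps(2))
  next
    case (3 a x y)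
    then show ?case using add_map_add[OF smult_add_map] by (simp add: twist_simps(1,2))
  next
    case (4 a b x)
    then have x: "x \<in> carrier IM" by (simp add: twist_simps)
    show ?case
      by (rule eqI[OF smult_add_map add_map_comp[OF smult_add_map smult_add_map] x])
        (use 4(1,2) in \<open>simp_all add: smult_pure M.smult_assoc1\<close>)
  next
    case (5 x)
    then have x: "x \<in> carrier IM" by (simp add: twist_simps)
    show ?case by (rule eqI[OF smult_add_map idm x]) (simp_all add: smult_pure)
  qed
  show ?thesis
  proof (unfold_locales, goal_cases)
    case (1 x a)
    then show ?case by (simp add: twist_simps(1,5) act_closed lam_hom)
  next
    case (2 x y a)
    then show ?case using add_map_add[OF act_right] by (simp add: twist_simps(1,2,5) lam_hom(1))
  next
    case (3 x a b)
    then show ?case using add_map_add[OF act_left] by (simp add: twist_simps(1,2,5) lam_hom(1,2))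
  next
    case (4 x a b)
    then have "lam (a \<otimes>\<^bsub>A\<^esub> b) = mulR (lam b) (lam a)" by (simp add: lam_hom(3)[symmetric] comm_monoid.m_comm[OF cring.axioms(2)[OF M_cring]])
    with 4 show ?case by (simp add: twist_simps(1,5) lam_hom(1) act_mulR)
  next
    case (5 x)
    then show ?case by (simp add: twist_simps(1,5) lam_hom(4) act_one)
  next
    case (6 x a b)
    then have x: "x \<in> carrier IM" and a: "a \<in> carrier A" and b: "lam b \<in> carrier IR"
      by (simp_all add: twist_simps(1) lam_hom(1))
    have "act (lam b) (a \<odot>\<^bsub>TM\<^esub> x) = a \<odot>\<^bsub>TM\<^esub> act (lam b) x"
    proof (rule integers_tensor_eqI[OF R_grp IM_grp _ _ b])
      have ax: "a \<odot>\<^bsub>TM\<^esub> x \<in> carrier IM" using add_map_closed[OF smult_add_map[OF a] x] .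
      show "add_map IR IM (\<lambda>t. act t (a \<odot>\<^bsub>TM\<^esub> x))" by (rule act_left[OF ax])
      show "add_map IR IM (\<lambda>t. a \<odot>\<^bsub>TM\<^esub> act t x)" by (rule add_map_comp[OF act_left[OF x] smult_add_map[OF a]])
      fix c :: 'k and r assume cr: "algebraic_int c" "r \<in> carrier R"
      then have p: "pR c r \<in> carrier IR" by simp
      show "act (pR c r) (a \<odot>\<^bsub>TM\<^esub> x) = a \<odot>\<^bsub>TM\<^esub> act (pR c r) x"
        by (rule eqI[OF add_map_comp[OF smult_add_map[OF a] act_right[OF p]]
              add_map_comp[OF act_right[OF p] smult_add_map[OF a]] x])
          (simp add: smult_pure a act_pure cr algebraic_int_mult M.smult_comm[of "r \<odot>\<^bsub>A\<^esub> \<one>\<^bsub>A\<^esub>" a])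
    qed
    then show ?case by (simp add: twist_simps(5))
  next
    case (7 r x)
    then have x: "x \<in> carrier IM" and r: "r \<in> carrier R" "r \<odot>\<^bsub>A\<^esub> \<one>\<^bsub>A\<^esub> \<in> carrier A" by (simp_all add: twist_simps(1))
    have "act (lam (r \<odot>\<^bsub>A\<^esub> \<one>\<^bsub>A\<^esub>)) x = (r \<odot>\<^bsub>A\<^esub> \<one>\<^bsub>A\<^esub>) \<odot>\<^bsub>TM\<^esub> x"
      by (rule eqI[OF act_right smult_add_map x]) (simp_all add: lam_scalar r act_pure smult_pure)
    then show ?case by (simp add: twist_simps(5))
  qed
qed

end

section \<open>Evaluation descends to the tensor product over the algebra\<close>

lemma restrict_scalars_simps:
  "carrier (restrict_scalars A B) = carrier B" "add (restrict_scalars A B) = add B"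
  "ring.zero (restrict_scalars A B) = ring.zero B"
  "smult (restrict_scalars A B) r x = (r \<odot>\<^bsub>A\<^esub> \<one>\<^bsub>A\<^esub>) \<odot>\<^bsub>B\<^esub> x"
  "rsmult (restrict_scalars A B) x r = rsmult B x (r \<odot>\<^bsub>A\<^esub> \<one>\<^bsub>A\<^esub>)"
  by (simp_all add: restrict_scalars_def)

locale eval_data = MD: twist_data R A M lam + ND: twist_data R A N lam
  for R :: "('r, 'p) ring_scheme" and A :: "('r, 'a, 'q) module_scheme"
    and M :: "('a, 'm, 'e) module_scheme" and N :: "('a, 'n, 'f) module_scheme"
    and lam :: "'a \<Rightarrow> (('k::field_char_0 \<times> 'r) \<Rightarrow>\<^sub>0 int) set"
begin

abbreviation H where "H \<equiv> Hom_bimodule R A M N"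

lemma central_H: "central_bimod R A H"
  by (rule central_Hom) (unfold_locales)

sublocale H: central_bimod R A H by (rule central_H)
sublocale TM: central_bimod R A MD.TM by (rule MD.central_twist)
sublocale TN: central_bimod R A ND.TM by (rule ND.central_twist)
sublocale HML: tensor_bimod A H MD.TM
  by (rule tensor_bimod.intro[OF H.B.bimod_axioms TM.B.bimod_axioms])

lemma H_add_map: "f \<in> carrier H \<Longrightarrow> add_map M N f"
  by (simp add: Hom_carrier)

lemma H_closed: "f \<in> carrier H \<Longrightarrow> m \<in> carrier M \<Longrightarrow> f m \<in> carrier N"
  by (rule add_map_closed[OF H_add_map])

text \<open>The map \<open>1 \<otimes> f\<close> from \<open>M\<^sup>\<lambda>\<close> to \<open>N\<^sup>\<lambda>\<close>.\<close>

definition base_change :: "('m \<Rightarrow> 'n) \<Rightarrow> (('k \<times> 'm) \<Rightarrow>\<^sub>0 int) set \<Rightarrow> (('k \<times> 'n) \<Rightarrow>\<^sub>0 int) set" where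
  "base_change f = tensor_lift ND.TM (\<lambda>c m. integers_pure N c (f m))"

lemma add_map_to_TN: "add_map Z ND.TM h \<longleftrightarrow> add_map Z ND.IM h"
  by (simp add: add_map_def twist_simps)

lemma biadd_base_change: "f \<in> carrier H \<Longrightarrow> biadd M ND.TM (\<lambda>c m. integers_pure N c (f m))"
  by (rule biaddI)
    (simp_all add: twist_simps H_closed add_map_add[OF H_add_map] biaddD[OF biadd_integers_pure[OF ND.M_grp]])

lemma base_change_pure: "f \<in> carrier H \<Longrightarrow> algebraic_int c \<Longrightarrow> m \<in> carrier M \<Longrightarrow> base_change f (MD.pM c m) = ND.pM c (f m)"
  unfolding base_change_def by (rule integers_lift_pure[OF MD.M_grp ND.TM_group biadd_base_change])

lemma base_change_add_map: "f \<in> carrier H \<Longrightarrow> add_map MD.IM ND.IM (base_change f)"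
  unfolding base_change_def add_map_to_TN[symmetric] by (rule integers_lift_add_map[OF MD.M_grp ND.TM_group biadd_base_change])

lemma integers_eqI:
  assumes "add_map MD.IM ND.IM h" "add_map MD.IM ND.IM k" "u \<in> carrier MD.IM"
    "\<And>c m. algebraic_int c \<Longrightarrow> m \<in> carrier M \<Longrightarrow> h (MD.pM c m) = k (MD.pM c m)"
  shows "h u = k u"
  by (rule integers_tensor_eqI[OF MD.M_grp ND.IM_grp assms])

lemma base_change_add: "f \<in> carrier H \<Longrightarrow> g \<in> carrier H \<Longrightarrow> u \<in> carrier MD.IM \<Longrightarrow>
   base_change (f \<oplus>\<^bsub>H\<^esub> g) u = base_change f u \<oplus>\<^bsub>ND.IM\<^esub> base_change g u"
  by (rule integers_eqI[OF base_change_add_map[OF H.B.a_closed] add_map_sum[OF base_change_add_map base_change_add_map ND.IM_grp]])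
    (simp_all add: base_change_pure, simp add: Hom_simps H_closed biaddD(3)[OF biadd_integers_pure[OF ND.M_grp]])

text \<open>Both sides send \<open>c \<otimes> m\<close> to \<open>c \<otimes> f(a m)\<close>. This makes the pairing balanced over \<open>A\<close>.\<close>

lemma base_change_rsmult: "f \<in> carrier H \<Longrightarrow> a \<in> carrier A \<Longrightarrow> u \<in> carrier MD.IM \<Longrightarrow>
   base_change (rsmult H f a) u = base_change f (a \<odot>\<^bsub>MD.TM\<^esub> u)"
  by (rule integers_eqI[OF base_change_add_map[OF H.B.rsmult_closed] add_map_comp[OF MD.smult_add_map base_change_add_map]])
    (simp_all add: base_change_pure MD.smult_pure H.B.rsmult_closed, simp add: Hom_simps)

lemma base_change_smult: "f \<in> carrier H \<Longrightarrow> a \<in> carrier A \<Longrightarrow> u \<in> carrier MD.IM \<Longrightarrow>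
   base_change (a \<odot>\<^bsub>H\<^esub> f) u = a \<odot>\<^bsub>ND.TM\<^esub> base_change f u"
  by (rule integers_eqI[OF base_change_add_map[OF H.B.smult_closed] add_map_comp[OF base_change_add_map ND.smult_add_map]])
    (simp_all add: base_change_pure ND.smult_pure H_closed, simp add: Hom_simps)

text \<open>For \<open>t = c \<otimes> r\<close> this is \<open>f(r m) = r f(m)\<close>. It gives compatibility of \<open>\<chi>\<close> with the right actions, which are
  multiplications by \<open>\<lambda>(a)\<close>.\<close>

lemma base_change_act:
  assumes f: "f \<in> carrier H" and t: "t \<in> carrier MD.IR" and u: "u \<in> carrier MD.IM"
  shows "base_change f (MD.act t u) = ND.act t (base_change f u)"
proof (rule integers_tensor_eqI[OF MD.R_grp ND.IM_grp _ _ t])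
  show "add_map MD.IR ND.IM (\<lambda>t. base_change f (MD.act t u))"
    by (rule add_map_comp[OF MD.act_left[OF u] base_change_add_map[OF f]])
  show "add_map MD.IR ND.IM (\<lambda>t. ND.act t (base_change f u))"
    by (rule ND.act_left[OF add_map_closed[OF base_change_add_map[OF f] u]])
  fix c :: 'k and r assume cr: "algebraic_int c" "r \<in> carrier R"
  then have p: "MD.pR c r \<in> carrier MD.IR" by simp
  have lin: "f ((r \<odot>\<^bsub>A\<^esub> \<one>\<^bsub>A\<^esub>) \<odot>\<^bsub>M\<^esub> m) = (r \<odot>\<^bsub>A\<^esub> \<one>\<^bsub>A\<^esub>) \<odot>\<^bsub>N\<^esub> f m" if "m \<in> carrier M" for m
    using f that cr by (simp add: Hom_carrier)
  show "base_change f (MD.act (MD.pR c r) u) = ND.act (MD.pR c r) (base_change f u)"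
    by (rule integers_eqI[OF add_map_comp[OF MD.act_right[OF p] base_change_add_map[OF f]]
          add_map_comp[OF base_change_add_map[OF f] ND.act_right[OF p]] u])
      (simp add: MD.act_pure ND.act_pure cr base_change_pure f algebraic_int_mult H_closed lin)
qed

lemma balanced_base_change: "balanced A H MD.TM ND.TM base_change"
  by (rule balancedI)
    (simp_all add: twist_simps(1,2) add_map_closed[OF base_change_add_map] base_change_add add_map_add[OF base_change_add_map] base_change_rsmult)

lemma HR_pair: "tensor_pair R (restrict_scalars A H) (restrict_scalars A MD.TM)"
proof -
  have "abelian_group (restrict_scalars A H)" "abelian_group (restrict_scalars A MD.TM)"
    by (rule abelian_group_transfer[OF H.B.abelian_group_axioms], simp_all add: restrict_scalars_simps)
      (rule abelian_group_transfer[OF MD.TM_group], simp_all add: restrict_scalars_simps)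
  then show ?thesis
    by (rule tensor_pair.intro) (simp_all add: restrict_scalars_simps H.B.rsmult_closed)
qed

sublocale HR: tensor_pair R "restrict_scalars A H" "restrict_scalars A MD.TM" by (rule HR_pair)

lemma balanced_restrict:
  assumes "balanced A H MD.TM Z b"
  shows "balanced R (restrict_scalars A H) (restrict_scalars A MD.TM) Z b"
  by (rule balancedI)
    (simp_all add: restrict_scalars_simps balanced_closed[OF assms] add_map_add[OF balancedD(1)[OF assms]]
      add_map_add[OF balancedD(2)[OF assms]] balancedD(3)[OF assms])

abbreviation TQ where "TQ \<equiv> tensor_quotient R A H MD.TM"
abbreviation EV where "EV \<equiv> evaluation_map R A M N lam"

lemma TQ_pure: "f \<in> carrier H \<Longrightarrow> u \<in> carrier MD.TM \<Longrightarrow> TQ (HR.pure f u) = HML.pure f u"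
  using HR.pure_closed[of f u]
  by (simp add: tensor_quotient_def tensor_simps restrict_scalars_simps)
    (rule HR.lift_pure[OF HML.XY_group balanced_restrict], simp_all add: restrict_scalars_simps,
      use HML.balanced_pure in \<open>simp add: balanced_def add_map_def tensor_simps\<close>)

lemma TQ_add_map: "add_map HR.T HML.T TQ"
proof -
  have "balanced A H MD.TM HML.XY HML.pure"
    using HML.balanced_pure by (simp add: balanced_def add_map_def tensor_simps)
  from HR.lift_add_map[OF HML.XY_group balanced_restrict[OF this]]
  have "add_map HR.T HML.T (tensor_lift HML.XY HML.pure)" by (simp add: add_map_def tensor_simps)
  then show ?thesis
    by (rule add_map_cong[rotated]) (simp_all add: HR.T_group tensor_quotient_def tensor_simps)
qed

lemma EV_pure: "f \<in> carrier H \<Longrightarrow> u \<in> carrier MD.TM \<Longrightarrow> EV (HR.pure f u) = base_change f u"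
  using HR.pure_closed[of f u]
  by (simp add: evaluation_map_def tensor_simps restrict_scalars_simps base_change_def[abs_def, symmetric])
    (rule HR.lift_pure[OF ND.TM_group balanced_restrict[OF balanced_base_change]], simp_all add: restrict_scalars_simps)

lemma EV_add_map: "add_map HR.T ND.TM EV"
  by (rule add_map_cong[OF _ HR.lift_add_map[OF ND.TM_group balanced_restrict[OF balanced_base_change]] HR.T_group])
    (simp add: evaluation_map_def tensor_simps base_change_def[abs_def, symmetric])

definition is_chi where
  "is_chi \<chi> \<longleftrightarrow> bimodule_hom R A HML.XY ND.TM \<chi> \<and> compose (carrier (tensor R (restrict_scalars A H) (restrict_scalars A MD.TM))) \<chi> TQ = EV"

text \<open>The quotient map from the tensor product over \<open>R\<close> hits every pure tensor, so the composite prescribes \<open>\<chi>\<close> on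
  generators.\<close>

lemma chi_pure:
  assumes \<chi>: "is_chi \<chi>" and f: "f \<in> carrier H" and u: "u \<in> carrier MD.TM"
  shows "\<chi> (HML.pure f u) = base_change f u"
proof -
  have "HR.pure f u \<in> carrier (tensor R (restrict_scalars A H) (restrict_scalars A MD.TM))"
    using HR.pure_closed[of f u] f u by (simp add: tensor_simps restrict_scalars_simps)
  from compose_eq[OF this, of \<chi> TQ] have "\<chi> (TQ (HR.pure f u)) = EV (HR.pure f u)"
    using \<chi> by (simp add: is_chi_def)
  then show ?thesis by (simp add: TQ_pure EV_pure f u)
qed

lemma chi_add_map: "is_chi \<chi> \<Longrightarrow> add_map HML.T ND.TM \<chi>"
  by (simp add: is_chi_def bimodule_hom_def add_map_def tensor_simps(1,2) PiE_def)

lemma chi_unique: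
  assumes "is_chi \<chi>" "is_chi \<psi>" shows "\<chi> = \<psi>"
proof (rule extensionalityI)
  show "\<chi> \<in> extensional (carrier HML.T)" "\<psi> \<in> extensional (carrier HML.T)"
    using assms by (simp_all add: is_chi_def bimodule_hom_def tensor_simps(1) PiE_def)
  fix t assume "t \<in> carrier HML.T"
  then show "\<chi> t = \<psi> t"
    by (rule HML.add_map_eqI[OF chi_add_map[OF assms(1)] chi_add_map[OF assms(2)]])
      (simp add: chi_pure assms)
qed

lemma chi_exists: "is_chi (\<lambda>t\<in>carrier HML.T. tensor_lift ND.TM base_change t)" (is "is_chi ?\<chi>")
proof -
  let ?l = "tensor_lift ND.TM base_change"
  have lp: "?l (HML.pure f u) = base_change f u" if "f \<in> carrier H" "u \<in> carrier MD.TM" for f u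
    by (rule HML.lift_pure[OF ND.TM_group balanced_base_change that])
  have la: "add_map HML.T ND.TM ?l" by (rule HML.lift_add_map[OF ND.TM_group balanced_base_change])
  have lc: "?l t \<in> carrier ND.TM" if "t \<in> carrier HML.T" for t by (rule add_map_closed[OF la that])
  have sm: "?l (a \<odot>\<^bsub>HML.XY\<^esub> t) = a \<odot>\<^bsub>ND.TM\<^esub> ?l t" if a: "a \<in> carrier A" and t: "t \<in> carrier HML.T" for a t
    by (rule HML.add_map_eqI[OF add_map_comp[OF HML.smult_add_map[OF a] la] add_map_comp[OF la TN.B.add_map_smult[OF a]] t])
      (simp add: a lp, simp add: base_change_smult a twist_simps(1))
  have rs: "?l (rsmult HML.XY t a) = rsmult ND.TM (?l t) a" if a: "a \<in> carrier A" and t: "t \<in> carrier HML.T" for a t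
    by (rule HML.add_map_eqI[OF add_map_comp[OF HML.rsmult_add_map[OF a] la] add_map_comp[OF la TN.B.add_map_rsmult[OF a]] t])
      (simp add: a lp TM.B.rsmult_closed, simp add: base_change_act twist_simps(1,5) MD.lam_hom(1) a)
  have XY: "central_bimod R A HML.XY" by (rule central_tensor[OF central_H MD.central_twist])
  then interpret XY: central_bimod R A HML.XY .
  have hom: "bimodule_hom R A HML.XY ND.TM ?\<chi>"
    unfolding bimodule_hom_def is_bimodule_iff
    using XY.B.a_closed XY.B.smult_closed XY.B.rsmult_closed
    by (intro conjI XY ND.central_twist ballI)
      (simp_all add: tensor_simps(1,2) lc sm rs add_map_add[OF la])
  moreover have "compose (carrier (tensor R (restrict_scalars A H) (restrict_scalars A MD.TM))) ?\<chi> TQ = EV"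
  proof (rule extensionalityI[where A = "carrier HR.T"])
    show "compose (carrier (tensor R (restrict_scalars A H) (restrict_scalars A MD.TM))) ?\<chi> TQ \<in> extensional (carrier HR.T)"
      by (simp add: compose_def tensor_simps)
    show "EV \<in> extensional (carrier HR.T)"
      by (simp add: evaluation_map_def tensor_simps)
    fix t assume t: "t \<in> carrier HR.T"
    have "?l (TQ t) = EV t"
      by (rule HR.add_map_eqI[OF add_map_comp[OF TQ_add_map la] EV_add_map t])
        (simp add: restrict_scalars_simps TQ_pure EV_pure lp)
    then show "compose (carrier (tensor R (restrict_scalars A H) (restrict_scalars A MD.TM))) ?\<chi> TQ t = EV t"
      using t add_map_closed[OF TQ_add_map t] by (simp add: compose_eq tensor_simps)
  qed
  ultimately show ?thesis by (simp add: is_chi_def)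
qed

end

section \<open>A recursive form of the Hochschild differential\<close>

lemma tuples_0 [simp]: "tuples A 0 = {[]}"
  by (auto simp: tuples_def)

lemma tuples_Cons [simp]: "x # xs \<in> tuples A (Suc n) \<longleftrightarrow> x \<in> carrier A \<and> xs \<in> tuples A n"
  by (simp add: tuples_def)

lemma tuples_SucE:
  assumes "xs \<in> tuples A (Suc n)"
  obtains y ys where "xs = y # ys" "y \<in> carrier A" "ys \<in> tuples A n"
  using assms by (cases xs) (auto simp: tuples_def)

lemma tuples_take: "xs \<in> tuples A (i + j) \<Longrightarrow> take i xs \<in> tuples A i"
  and tuples_drop: "xs \<in> tuples A (i + j) \<Longrightarrow> drop i xs \<in> tuples A j"
  by (auto simp: tuples_def dest: in_set_takeD in_set_dropD)

lemma tuples_merge: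
  assumes "cring A" "xs \<in> tuples A (Suc n)" "k \<in> {1..n}"
  shows "take (k - 1) xs @ [xs ! (k - 1) \<otimes>\<^bsub>A\<^esub> xs ! k] @ drop (k + 1) xs \<in> tuples A n"
proof -
  interpret cring A by fact
  have xs: "set xs \<subseteq> carrier A" "length xs = Suc n" using assms(2) by (simp_all add: tuples_def)
  then have "xs ! (k - 1) \<in> carrier A" "xs ! k \<in> carrier A"
    using assms(3) nth_mem[of "k - 1" xs] nth_mem[of k xs] by auto
  moreover have "set (take (k - 1) xs) \<subseteq> carrier A" "set (drop (k + 1) xs) \<subseteq> carrier A"
    using xs(1) set_take_subset set_drop_subset by fast+
  ultimately show ?thesis using xs(2) assms(3) by (simp add: tuples_def; arith)
qed

text \<open>Multilinearity with the arguments peeled off one at a time, as in an induction on lists. By \<open>mlin_iff\<close> it agrees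
  with the condition on cochains.\<close>

fun mlin ::
  "('r, 'p) ring_scheme \<Rightarrow> ('r, 'a, 'q) module_scheme \<Rightarrow> ('a, 'b, 'e) bimodule_scheme
    \<Rightarrow> nat \<Rightarrow> ('a list \<Rightarrow> 'b) \<Rightarrow> bool"
where
  "mlin R A B 0 f \<longleftrightarrow> f [] \<in> carrier B"
| "mlin R A B (Suc n) f \<longleftrightarrow> (\<forall>a\<in>carrier A. mlin R A B n (\<lambda>ys. f (a # ys)))
     \<and> (\<forall>ys\<in>tuples A n. (\<forall>a\<in>carrier A. \<forall>b\<in>carrier A. f ((a \<oplus>\<^bsub>A\<^esub> b) # ys) = f (a # ys) \<oplus>\<^bsub>B\<^esub> f (b # ys))
        \<and> (\<forall>r\<in>carrier R. \<forall>a\<in>carrier A. f ((r \<odot>\<^bsub>A\<^esub> a) # ys) = (r \<odot>\<^bsub>A\<^esub> \<one>\<^bsub>A\<^esub>) \<odot>\<^bsub>B\<^esub> f (a # ys)))"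

lemma mlin_iff:
  assumes ne: "carrier A \<noteq> {}"
  shows "mlin R A B n f \<longleftrightarrow> (\<forall>xs\<in>tuples A n. f xs \<in> carrier B) \<and> (\<forall>xs\<in>tuples A n. \<forall>p<n.
     (\<forall>x\<in>carrier A. \<forall>y\<in>carrier A.
        f (xs[p := x \<oplus>\<^bsub>A\<^esub> y]) = f (xs[p := x]) \<oplus>\<^bsub>B\<^esub> f (xs[p := y]))
     \<and> (\<forall>r\<in>carrier R. \<forall>x\<in>carrier A.
        f (xs[p := r \<odot>\<^bsub>A\<^esub> x]) = (r \<odot>\<^bsub>A\<^esub> \<one>\<^bsub>A\<^esub>) \<odot>\<^bsub>B\<^esub> f (xs[p := x])))"
proof (induction n arbitrary: f)
  case 0
  show ?case by simp
next
  case (Suc n)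
  obtain a0 where a0: "a0 \<in> carrier A" using ne by blast
  have all_tuples: "(\<forall>xs\<in>tuples A (Suc n). P xs) \<longleftrightarrow> (\<forall>a\<in>carrier A. \<forall>ys\<in>tuples A n. P (a # ys))" for P
    by (auto elim: tuples_SucE)
  have all_p: "(\<forall>p<Suc n. P p) \<longleftrightarrow> P 0 \<and> (\<forall>p<n. P (Suc p))" for P
    using less_Suc_eq_0_disj by auto
  show ?case
    unfolding mlin.simps Suc.IH all_tuples all_p using a0 by auto
qed

lemma mlin_closed: "mlin R A B n f \<Longrightarrow> xs \<in> tuples A n \<Longrightarrow> f xs \<in> carrier B"
  by (induction n arbitrary: f xs) (auto elim!: tuples_SucE)

lemma mlin_cong:
  "(\<And>xs. xs \<in> tuples A n \<Longrightarrow> f xs = g xs) \<Longrightarrow> mlin R A B n f \<Longrightarrow> algebra R A \<Longrightarrow> mlin R A B n g"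
proof (induction n arbitrary: f g)
  case (Suc n)
  interpret A: algebra R A by fact
  have "mlin R A B n (\<lambda>ys. g (a # ys))" if a: "a \<in> carrier A" for a
    by (rule Suc.IH[of "\<lambda>ys. f (a # ys)"]) (use Suc.prems a in simp_all)
  then show ?case using Suc.prems(1,2) by (simp add: Suc.prems(1)[symmetric])
qed simp

text \<open>For \<open>f\<close> of degree \<open>n\<close> this is \<open>\<Sum>\<^sub>k (-1)\<^sup>k\<^sup>+\<^sup>1 f(\<dots>, a\<^sub>k a\<^sub>k\<^sub>+\<^sub>1, \<dots>) + (-1)\<^sup>n f(a\<^sub>1, \<dots>, a\<^sub>n) a\<^sub>n\<^sub>+\<^sub>1\<close>, that is, minus all terms of \<open>\<delta>f\<close>
  but the first. The terms in which the first argument \<open>a\<close> is not multiplied form the same expression for \<open>f(a, \<dots>)\<close>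
  with the opposite sign, and this gives the recursion. The value at the empty list is a default.\<close>

fun merge ::
  "('r, 'a, 'q) module_scheme \<Rightarrow> ('a, 'b, 'e) bimodule_scheme \<Rightarrow> ('a list \<Rightarrow> 'b) \<Rightarrow> 'a list \<Rightarrow> 'b"
where
  "merge A B f [] = \<zero>\<^bsub>B\<^esub>"
| "merge A B f [a] = rsmult B (f []) a"
| "merge A B f (a # b # xs) = f ((a \<otimes>\<^bsub>A\<^esub> b) # xs) \<ominus>\<^bsub>B\<^esub> merge A B (\<lambda>ys. f (a # ys)) (b # xs)"

lemma merge_cong:
  assumes "\<And>xs. xs \<in> tuples A n \<Longrightarrow> f xs = g xs" "xs \<in> tuples A (Suc n)" "cring A"
  shows "merge A B f xs = merge A B g xs"
  using assms(1,2)
proof (induction n arbitrary: f g xs)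
  case 0 then show ?case by (auto elim!: tuples_SucE)
next
  case (Suc n)
  interpret A: cring A by fact
  obtain a b ys where xs: "xs = a # b # ys" and ab: "a \<in> carrier A" "b \<in> carrier A" "ys \<in> tuples A n"
    using Suc.prems(2) by (auto elim!: tuples_SucE)
  have "merge A B (\<lambda>ys. f (a # ys)) (b # ys) = merge A B (\<lambda>ys. g (a # ys)) (b # ys)"
    by (rule Suc.IH) (use Suc.prems(1) ab in simp_all)
  then show ?case using Suc.prems(1) ab by (simp add: xs)
qed

definition bar_d ::
  "('r, 'a, 'q) module_scheme \<Rightarrow> ('a, 'b, 'e) bimodule_scheme \<Rightarrow> ('a list \<Rightarrow> 'b) \<Rightarrow> 'a list \<Rightarrow> 'b" where
  "bar_d A B f xs = hd xs \<odot>\<^bsub>B\<^esub> f (tl xs) \<ominus>\<^bsub>B\<^esub> merge A B f xs"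

lemma (in abelian_group) finsum_minus:
  assumes "finite I" "f \<in> I \<rightarrow> carrier G"
  shows "(\<Oplus>i\<in>I. \<ominus> f i) = \<ominus> (\<Oplus>i\<in>I. f i)"
proof -
  have "(\<Oplus>i\<in>I. \<ominus> f i) \<oplus> (\<Oplus>i\<in>I. f i) = (\<Oplus>i\<in>I. \<ominus> f i \<oplus> f i)"
    using assms by (intro finsum_addf[symmetric]) auto
  also have "\<dots> = (\<Oplus>i\<in>I. \<zero>)"
    using assms by (intro finsum_cong') (auto simp: l_neg Pi_iff)
  finally have "(\<Oplus>i\<in>I. \<ominus> f i) \<oplus> (\<Oplus>i\<in>I. f i) = \<zero>" by (simp add: finsum_zero)
  then show ?thesis
    using assms minus_equality[of "\<Oplus>i\<in>I. \<ominus> f i" "\<Oplus>i\<in>I. f i"] by (simp add: Pi_iff finsum_closed)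
qed

lemma (in abelian_group) neg_pow:
  assumes "x \<in> carrier G"
  shows "[((- 1 :: int) ^ Suc k)] \<cdot> x = \<ominus> ([((- 1 :: int) ^ k)] \<cdot> x)"
  using add.int_pow_neg[of x "(- 1 :: int) ^ k"] assms by simp

lemma (in abelian_group) diff_diff_add:
  assumes "x \<in> carrier G" "y \<in> carrier G"
  shows "\<ominus> (x \<ominus> y) = \<ominus> x \<oplus> y"
  using assms by (simp add: minus_eq minus_add)

context central_bimod begin

lemma merge_closed:
  "(\<And>ys. ys \<in> tuples A n \<Longrightarrow> f ys \<in> carrier B) \<Longrightarrow> xs \<in> tuples A (Suc n) \<Longrightarrow> merge A B f xs \<in> carrier B"
proof (induction n arbitrary: f xs)
  case 0 then show ?case by (auto elim!: tuples_SucE intro: B.rsmult_closed)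
next
  case (Suc n)
  obtain a b ys where xs: "xs = a # b # ys" and ab: "a \<in> carrier A" "b \<in> carrier A" "ys \<in> tuples A n"
    using Suc.prems(2) by (auto elim!: tuples_SucE)
  have "merge A B (\<lambda>ys. f (a # ys)) (b # ys) \<in> carrier B"
    by (rule Suc.IH) (use Suc.prems(1) ab in simp_all)
  then show ?case using Suc.prems(1) ab by (simp add: xs)
qed

text \<open>Apart from \<open>k = 1\<close>, the summands are those for \<open>f(a, \<dots>)\<close> with the index shifted by one, hence with opposite sign.\<close>

lemma face_sum_eq_merge:
  "(\<And>ys. ys \<in> tuples A n \<Longrightarrow> f ys \<in> carrier B) \<Longrightarrow> xs \<in> tuples A (Suc n) \<Longrightarrow>
     (\<Oplus>\<^bsub>B\<^esub>k\<in>{1..n}. [((- 1 :: int) ^ k)] \<cdot>\<^bsub>B\<^esub>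
        f (take (k - 1) xs @ [xs ! (k - 1) \<otimes>\<^bsub>A\<^esub> xs ! k] @ drop (k + 1) xs))
     \<oplus>\<^bsub>B\<^esub> [((- 1 :: int) ^ (n + 1))] \<cdot>\<^bsub>B\<^esub> rsmult B (f (butlast xs)) (last xs) = \<ominus>\<^bsub>B\<^esub> merge A B f xs"
proof (induction n arbitrary: f xs)
  case 0
  then obtain a where a: "xs = [a]" "a \<in> carrier A" by (auto elim!: tuples_SucE)
  then show ?case
    using B.neg_pow[of "rsmult B (f []) a" 0] 0 by (simp add: B.rsmult_closed B.add.int_pow_1)
next
  case (Suc n)
  obtain a b ys where xs: "xs = a # b # ys" and ab: "a \<in> carrier A" "b \<in> carrier A" "ys \<in> tuples A n"
    using Suc.prems(2) by (auto elim!: tuples_SucE)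
  define zs where "zs = b # ys"
  have zs: "zs \<in> tuples A (Suc n)" "xs = a # zs" "zs \<noteq> []" using ab by (simp_all add: zs_def xs)
  let ?m = "\<lambda>xs k. take (k - 1) xs @ [xs ! (k - 1) \<otimes>\<^bsub>A\<^esub> xs ! k] @ drop (k + 1) xs"
  let ?t = "\<lambda>k. [((- 1 :: int) ^ k)] \<cdot>\<^bsub>B\<^esub> f (?m xs k)"
  let ?s = "\<lambda>k. [((- 1 :: int) ^ k)] \<cdot>\<^bsub>B\<^esub> f (a # ?m zs k)"
  have fa: "f (a # us) \<in> carrier B" if "us \<in> tuples A n" for us using Suc.prems(1) ab that by simp
  have m: "?m zs k \<in> tuples A n" if "k \<in> {1..n}" for k
    by (rule tuples_merge[OF A.M_cring zs(1) that])
  have s_closed: "?s k \<in> carrier B" if "k \<in> {1..n}" for k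
    by (rule B.int_pow_closed[OF fa[OF m[OF that]]])
  have shift: "?t (Suc k) = \<ominus>\<^bsub>B\<^esub> ?s k" if "k \<in> {1..n}" for k
  proof -
    have "?m xs (Suc k) = a # ?m zs k" using that by (cases k) (simp_all add: zs(2))
    then show ?thesis using B.neg_pow[OF fa[OF m[OF that]], of k] by simp
  qed
  have t_closed: "?t (Suc k) \<in> carrier B" if "k \<in> {1..n}" for k
    unfolding shift[OF that] by (rule B.a_inv_closed[OF s_closed[OF that]])
  have tPi: "?t \<in> Suc ` {1..n} \<rightarrow> carrier B"
    by (rule Pi_I) (elim imageE, simp only: t_closed)
  have t1: "?t 1 = \<ominus>\<^bsub>B\<^esub> f ((a \<otimes>\<^bsub>A\<^esub> b) # ys)"
    using B.neg_pow[of "f ((a \<otimes>\<^bsub>A\<^esub> b) # ys)" 0] Suc.prems(1) ab by (simp add: xs B.add.int_pow_1)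
  have fab: "f ((a \<otimes>\<^bsub>A\<^esub> b) # ys) \<in> carrier B" using Suc.prems(1) ab by simp
  have "{1..Suc n} = insert 1 (Suc ` {1..n})" by (auto simp: image_Suc_atLeastAtMost)
  then have "(\<Oplus>\<^bsub>B\<^esub>k\<in>{1..Suc n}. ?t k) = (\<Oplus>\<^bsub>B\<^esub>k\<in>insert 1 (Suc ` {1..n}). ?t k)" by simp
  also have "\<dots> = ?t 1 \<oplus>\<^bsub>B\<^esub> (\<Oplus>\<^bsub>B\<^esub>k\<in>Suc ` {1..n}. ?t k)"
  proof (rule B.finsum_insert)
    show "?t \<in> Suc ` {1..n} \<rightarrow> carrier B" by (rule tPi)
    show "?t 1 \<in> carrier B" unfolding t1 using fab by simp
  qed auto
  also have "(\<Oplus>\<^bsub>B\<^esub>k\<in>Suc ` {1..n}. ?t k) = (\<Oplus>\<^bsub>B\<^esub>k\<in>{1..n}. ?t (Suc k))"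
    by (rule B.finsum_reindex[OF tPi]) simp
  also have "\<dots> = (\<Oplus>\<^bsub>B\<^esub>k\<in>{1..n}. \<ominus>\<^bsub>B\<^esub> ?s k)"
    by (intro B.finsum_cong'[OF refl] Pi_I B.a_inv_closed s_closed shift)
  also have "\<dots> = \<ominus>\<^bsub>B\<^esub> (\<Oplus>\<^bsub>B\<^esub>k\<in>{1..n}. ?s k)"
    by (intro B.finsum_minus Pi_I s_closed finite_atLeastAtMost)
  finally have sum: "(\<Oplus>\<^bsub>B\<^esub>k\<in>{1..Suc n}. ?t k) =
      \<ominus>\<^bsub>B\<^esub> f ((a \<otimes>\<^bsub>A\<^esub> b) # ys) \<oplus>\<^bsub>B\<^esub> \<ominus>\<^bsub>B\<^esub> (\<Oplus>\<^bsub>B\<^esub>k\<in>{1..n}. ?s k)" unfolding t1 .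
  let ?l = "rsmult B (f (a # butlast zs)) (last zs)"
  have "butlast zs \<in> tuples A n" "last zs \<in> carrier A"
    using zs by (auto simp: tuples_def subset_iff dest: in_set_butlastD)
  then have l: "?l \<in> carrier B" by (simp add: B.rsmult_closed fa)
  have last: "[((- 1 :: int) ^ (Suc n + 1))] \<cdot>\<^bsub>B\<^esub> rsmult B (f (butlast xs)) (last xs) =
      \<ominus>\<^bsub>B\<^esub> ([((- 1 :: int) ^ (n + 1))] \<cdot>\<^bsub>B\<^esub> ?l)"
    using B.neg_pow[OF l, of "n + 1"] zs(2,3) by simp
  have IH: "(\<Oplus>\<^bsub>B\<^esub>k\<in>{1..n}. ?s k) \<oplus>\<^bsub>B\<^esub> [((- 1 :: int) ^ (n + 1))] \<cdot>\<^bsub>B\<^esub> ?l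
      = \<ominus>\<^bsub>B\<^esub> merge A B (\<lambda>ys. f (a # ys)) zs"
    by (rule Suc.IH[OF fa zs(1)])
  have mc: "merge A B (\<lambda>ys. f (a # ys)) zs \<in> carrier B" by (rule merge_closed[OF fa zs(1)])
  have sc: "(\<Oplus>\<^bsub>B\<^esub>k\<in>{1..n}. ?s k) \<in> carrier B" by (intro B.finsum_closed Pi_I s_closed)
  have pc: "[((- 1 :: int) ^ (n + 1))] \<cdot>\<^bsub>B\<^esub> ?l \<in> carrier B" by (rule B.int_pow_closed[OF l])
  have "(\<Oplus>\<^bsub>B\<^esub>k\<in>{1..Suc n}. ?t k) \<oplus>\<^bsub>B\<^esub> [((- 1 :: int) ^ (Suc n + 1))] \<cdot>\<^bsub>B\<^esub> rsmult B (f (butlast xs)) (last xs)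
     = \<ominus>\<^bsub>B\<^esub> f ((a \<otimes>\<^bsub>A\<^esub> b) # ys) \<oplus>\<^bsub>B\<^esub> \<ominus>\<^bsub>B\<^esub> ((\<Oplus>\<^bsub>B\<^esub>k\<in>{1..n}. ?s k) \<oplus>\<^bsub>B\<^esub> [((- 1 :: int) ^ (n + 1))] \<cdot>\<^bsub>B\<^esub> ?l)"
    unfolding sum last B.minus_add[OF sc pc] using fab sc pc by (simp only: B.a_assoc B.a_inv_closed)
  also have "\<dots> = \<ominus>\<^bsub>B\<^esub> merge A B f xs"
    unfolding IH using fab mc by (simp add: xs zs_def B.diff_diff_add)
  finally show ?case .
qed

lemma hochschild_d_eq:
  assumes "\<And>ys. ys \<in> tuples A n \<Longrightarrow> f ys \<in> carrier B" "xs \<in> tuples A (Suc n)"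
  shows "hochschild_d A B n f xs = bar_d A B f xs"
proof -
  let ?S = "\<Oplus>\<^bsub>B\<^esub>k\<in>{1..n}. [((- 1 :: int) ^ k)] \<cdot>\<^bsub>B\<^esub>
        f (take (k - 1) xs @ [xs ! (k - 1) \<otimes>\<^bsub>A\<^esub> xs ! k] @ drop (k + 1) xs)"
  let ?L = "[((- 1 :: int) ^ (n + 1))] \<cdot>\<^bsub>B\<^esub> rsmult B (f (butlast xs)) (last xs)"
  obtain a ys where xs: "xs = a # ys" "a \<in> carrier A" "ys \<in> tuples A n" using assms(2) by (rule tuples_SucE)
  have S: "?S \<in> carrier B" by (intro B.finsum_closed Pi_I B.int_pow_closed assms(1) tuples_merge[OF A.M_cring assms(2)])
  have "butlast xs \<in> tuples A n" "last xs \<in> carrier A"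
    using assms(2) xs(1) by (auto simp: tuples_def subset_iff dest: in_set_butlastD split: if_splits)
  then have L: "?L \<in> carrier B" by (intro B.int_pow_closed B.rsmult_closed assms(1))
  have hd: "hd xs \<odot>\<^bsub>B\<^esub> f (tl xs) \<in> carrier B" using xs assms(1) by simp
  have "hochschild_d A B n f xs = hd xs \<odot>\<^bsub>B\<^esub> f (tl xs) \<oplus>\<^bsub>B\<^esub> ?S \<oplus>\<^bsub>B\<^esub> ?L"
    using assms(2) by (simp add: hochschild_d_def)
  also have "\<dots> = hd xs \<odot>\<^bsub>B\<^esub> f (tl xs) \<oplus>\<^bsub>B\<^esub> (?S \<oplus>\<^bsub>B\<^esub> ?L)" by (rule B.a_assoc[OF hd S L])
  also have "\<dots> = bar_d A B f xs"
    using face_sum_eq_merge[of n f xs, OF assms] by (simp only: bar_d_def a_minus_def)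
  finally show ?thesis .
qed

end

section \<open>The differential squares to zero\<close>

text \<open>The cancellation in both \<open>merge_merge\<close> and \<open>bar_d_bar_d\<close>.\<close>

lemma (in abelian_group) diff_cancel:
  assumes "x \<in> carrier G" "y \<in> carrier G" "u \<in> carrier G" "v \<in> carrier G"
  shows "(x \<ominus> y) \<ominus> ((x \<ominus> u) \<ominus> (y \<ominus> v)) = u \<ominus> v"
proof -
  have "(x \<ominus> y) \<ominus> ((x \<ominus> u) \<ominus> (y \<ominus> v)) = (x \<oplus> \<ominus> x) \<oplus> ((y \<oplus> \<ominus> y) \<oplus> (u \<ominus> v))"
    using assms by (simp only: minus_eq minus_add minus_minus a_closed a_inv_closed a_ac)
  also have "\<dots> = u \<ominus> v" using assms by (simp add: r_neg)
  finally show ?thesis .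
qed

lemma (in abelian_group) diff_add_diff:
  assumes "x \<in> carrier G" "y \<in> carrier G" "u \<in> carrier G" "v \<in> carrier G"
  shows "(x \<oplus> y) \<ominus> (u \<oplus> v) = (x \<ominus> u) \<oplus> (y \<ominus> v)"
  using assms by (simp only: minus_eq minus_add a_closed a_inv_closed a_ac)

lemma (in abelian_group) diff_eq_zero: "x \<in> carrier G \<Longrightarrow> x \<ominus> x = \<zero>"
  by (simp add: minus_eq r_neg)

text \<open>On the left only the scalars from \<open>R\<close> have to be respected, since the map \<open>y \<mapsto> x \<otimes> y\<close> into \<open>X \<otimes>\<^sub>A Y\<close> is not left
  \<open>A\<close>-linear. Left multiplication by an element of \<open>A\<close> is another instance.\<close>

locale bimod_map = B: central_bimod R A B + C: central_bimod R A C
  for R and A :: "('r, 'a, 'q) module_scheme" and B :: "('a, 'b, 'e) bimodule_scheme" and C :: "('a, 'c, 'f) bimodule_scheme" +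
  fixes h
  assumes h_add: "add_map B C h"
    and h_rsmult: "x \<in> carrier B \<Longrightarrow> a \<in> carrier A \<Longrightarrow> h (rsmult B x a) = rsmult C (h x) a"
    and h_scalar: "x \<in> carrier B \<Longrightarrow> r \<in> carrier R \<Longrightarrow>
       h ((r \<odot>\<^bsub>A\<^esub> \<one>\<^bsub>A\<^esub>) \<odot>\<^bsub>B\<^esub> x) = (r \<odot>\<^bsub>A\<^esub> \<one>\<^bsub>A\<^esub>) \<odot>\<^bsub>C\<^esub> h x"
begin

lemma B_grp: "abelian_group B" and C_grp: "abelian_group C"
  by (rule B.B.abelian_group_axioms C.B.abelian_group_axioms)+

lemma h_closed: "x \<in> carrier B \<Longrightarrow> h x \<in> carrier C"
  by (rule add_map_closed[OF h_add])

lemma merge_hom: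
  "(\<And>ys. ys \<in> tuples A n \<Longrightarrow> f ys \<in> carrier B) \<Longrightarrow> xs \<in> tuples A (Suc n) \<Longrightarrow>
     merge A C (\<lambda>ys. h (f ys)) xs = h (merge A B f xs)"
proof (induction n arbitrary: f xs)
  case 0 then show ?case by (auto elim!: tuples_SucE simp: h_rsmult)
next
  case (Suc n)
  obtain a b ys where xs: "xs = a # b # ys" and ab: "a \<in> carrier A" "b \<in> carrier A" "ys \<in> tuples A n"
    using Suc.prems(2) by (auto elim!: tuples_SucE)
  have fa: "f (a # us) \<in> carrier B" if "us \<in> tuples A n" for us using Suc.prems(1) ab that by simp
  have "merge A C (\<lambda>ys. h (f (a # ys))) (b # ys) = h (merge A B (\<lambda>ys. f (a # ys)) (b # ys))"
    by (rule Suc.IH[OF fa]) (use ab in simp_all)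
  moreover have "merge A B (\<lambda>ys. f (a # ys)) (b # ys) \<in> carrier B"
    by (rule B.merge_closed[OF fa]) (use ab in simp_all)
  ultimately show ?case using Suc.prems(1) ab
    by (simp add: xs add_map_diff[OF h_add B_grp C_grp])
qed

lemma mlin_hom: "mlin R A B n f \<Longrightarrow> mlin R A C n (\<lambda>xs. h (f xs))"
proof (induction n arbitrary: f)
  case (Suc n)
  have cl: "f (a # ys) \<in> carrier B" if "a \<in> carrier A" "ys \<in> tuples A n" for a ys
    using mlin_closed[OF Suc.prems, of "a # ys"] that by simp
  show ?case using Suc.prems by (simp add: Suc.IH add_map_add[OF h_add] h_scalar cl)
qed (simp add: h_closed)

end

context central_bimod begin

lemma one_smult_closed: "r \<in> carrier R \<Longrightarrow> r \<odot>\<^bsub>A\<^esub> \<one>\<^bsub>A\<^esub> \<in> carrier A"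
  using A.smult_closed[OF _ A.one_closed] by simp

lemma smult_diff: "a \<in> carrier A \<Longrightarrow> x \<in> carrier B \<Longrightarrow> y \<in> carrier B \<Longrightarrow>
    a \<odot>\<^bsub>B\<^esub> (x \<ominus>\<^bsub>B\<^esub> y) = a \<odot>\<^bsub>B\<^esub> x \<ominus>\<^bsub>B\<^esub> a \<odot>\<^bsub>B\<^esub> y"
  by (rule add_map_diff[OF B.add_map_smult B.abelian_group_axioms B.abelian_group_axioms])

lemma bimod_map_smult: "a \<in> carrier A \<Longrightarrow> bimod_map R A B B (\<lambda>x. a \<odot>\<^bsub>B\<^esub> x)"
  by unfold_locales (simp_all add: B.add_map_smult B.rsmult_smult B.smult_comm one_smult_closed)

lemma bimod_map_minus: "bimod_map R A B B (\<lambda>x. \<ominus>\<^bsub>B\<^esub> x)"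
proof unfold_locales
  show "add_map B B (\<lambda>x. \<ominus>\<^bsub>B\<^esub> x)" by (rule add_mapI) (simp_all add: B.minus_add)
qed (simp_all add: add_map_minus[OF B.add_map_rsmult] B.abelian_group_axioms B.smult_r_minus one_smult_closed)

lemma merge_add:
  "(\<And>ys. ys \<in> tuples A n \<Longrightarrow> f ys \<in> carrier B) \<Longrightarrow> (\<And>ys. ys \<in> tuples A n \<Longrightarrow> g ys \<in> carrier B) \<Longrightarrow>
    xs \<in> tuples A (Suc n) \<Longrightarrow>
    merge A B (\<lambda>ys. f ys \<oplus>\<^bsub>B\<^esub> g ys) xs = merge A B f xs \<oplus>\<^bsub>B\<^esub> merge A B g xs"
proof (induction n arbitrary: f g xs)
  case 0 then show ?case by (auto elim!: tuples_SucE simp: B.rsmult_add_left)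
next
  case (Suc n)
  obtain a b ys where xs: "xs = a # b # ys" and ab: "a \<in> carrier A" "b \<in> carrier A" "ys \<in> tuples A n"
    using Suc.prems(3) by (auto elim!: tuples_SucE)
  have fa: "f (a # us) \<in> carrier B" "g (a # us) \<in> carrier B" if "us \<in> tuples A n" for us
    using Suc.prems(1,2) ab that by simp_all
  have "merge A B (\<lambda>ys. f (a # ys) \<oplus>\<^bsub>B\<^esub> g (a # ys)) (b # ys)
      = merge A B (\<lambda>ys. f (a # ys)) (b # ys) \<oplus>\<^bsub>B\<^esub> merge A B (\<lambda>ys. g (a # ys)) (b # ys)"
    by (rule Suc.IH[OF fa]) (use ab in simp_all)
  moreover have "merge A B (\<lambda>ys. f (a # ys)) (b # ys) \<in> carrier B" "merge A B (\<lambda>ys. g (a # ys)) (b # ys) \<in> carrier B"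
    by (rule merge_closed[OF fa(1)] merge_closed[OF fa(2)]; use ab in simp)+
  ultimately show ?case using Suc.prems(1,2) ab by (simp add: xs B.diff_add_diff)
qed

lemma merge_minus:
  "(\<And>ys. ys \<in> tuples A n \<Longrightarrow> f ys \<in> carrier B) \<Longrightarrow> xs \<in> tuples A (Suc n) \<Longrightarrow>
    merge A B (\<lambda>ys. \<ominus>\<^bsub>B\<^esub> f ys) xs = \<ominus>\<^bsub>B\<^esub> merge A B f xs"
  by (rule bimod_map.merge_hom[OF bimod_map_minus])

lemma merge_diff:
  assumes "\<And>ys. ys \<in> tuples A n \<Longrightarrow> f ys \<in> carrier B" "\<And>ys. ys \<in> tuples A n \<Longrightarrow> g ys \<in> carrier B"
    "xs \<in> tuples A (Suc n)"
  shows "merge A B (\<lambda>ys. f ys \<ominus>\<^bsub>B\<^esub> g ys) xs = merge A B f xs \<ominus>\<^bsub>B\<^esub> merge A B g xs"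
  unfolding a_minus_def using merge_add[of n f "\<lambda>ys. \<ominus>\<^bsub>B\<^esub> g ys" xs] merge_minus[of n g xs] assms by simp

lemma merge_smult:
  "a \<in> carrier A \<Longrightarrow> (\<And>ys. ys \<in> tuples A n \<Longrightarrow> f ys \<in> carrier B) \<Longrightarrow> xs \<in> tuples A (Suc n) \<Longrightarrow>
    merge A B (\<lambda>ys. a \<odot>\<^bsub>B\<^esub> f ys) xs = a \<odot>\<^bsub>B\<^esub> merge A B f xs"
  by (rule bimod_map.merge_hom[OF bimod_map_smult])

text \<open>Write \<open>f\<^sub>a = f(a, \<dots>)\<close>. After expansion at \<open>(a, b, c, \<dots>)\<close> the terms that contain \<open>f(a b c, \<dots>)\<close> or \<open>f\<^sub>a\<^sub>b\<close> cancel, and the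
  others form the same expression for \<open>f\<^sub>a\<close> at \<open>(b, c, \<dots>)\<close>.\<close>

lemma merge_merge:
  "(\<And>ys. ys \<in> tuples A n \<Longrightarrow> f ys \<in> carrier B) \<Longrightarrow> xs \<in> tuples A (Suc (Suc n)) \<Longrightarrow>
    merge A B (merge A B f) xs = \<zero>\<^bsub>B\<^esub>"
proof (induction n arbitrary: f xs)
  case 0
  obtain a b where xs: "xs = [a, b]" and ab: "a \<in> carrier A" "b \<in> carrier A"
    using 0(2) by (auto elim!: tuples_SucE)
  then show ?case using 0(1) by (simp add: B.rsmult_assoc B.rsmult_closed B.diff_eq_zero)
next
  case (Suc n)
  obtain a b c ys where xs: "xs = a # b # c # ys"
    and ab: "a \<in> carrier A" "b \<in> carrier A" "c \<in> carrier A" "ys \<in> tuples A n"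
    using Suc.prems(2) by (auto elim!: tuples_SucE)
  have fx: "f (x # us) \<in> carrier B" if "x \<in> carrier A" "us \<in> tuples A n" for x us
    using Suc.prems(1) that by simp
  have mx: "merge A B (\<lambda>ys. f (x # ys)) us \<in> carrier B" if "x \<in> carrier A" "us \<in> tuples A (Suc n)" for x us
    by (rule merge_closed[OF fx[OF that(1)] that(2)])
  let ?w = "merge A B (\<lambda>us. merge A B (\<lambda>ys. f (a # ys)) (b # us)) (c # ys)"
  have w: "?w \<in> carrier B" by (rule merge_closed[of n]) (use mx ab in simp_all)
  have "merge A B (\<lambda>us. merge A B f (a # b # us)) (c # ys)
      = merge A B (\<lambda>us. f ((a \<otimes>\<^bsub>A\<^esub> b) # us)) (c # ys) \<ominus>\<^bsub>B\<^esub> ?w"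
    unfolding merge.simps by (rule merge_diff[of n]) (use mx fx ab in simp_all)
  then have "merge A B (merge A B f) xs
      = merge A B (\<lambda>us. f (a # us)) ((b \<otimes>\<^bsub>A\<^esub> c) # ys) \<ominus>\<^bsub>B\<^esub> ?w"
    unfolding xs using mx fx ab w by (simp add: A.m_assoc B.diff_cancel)
  also have "\<dots> = merge A B (merge A B (\<lambda>us. f (a # us))) (b # c # ys)" by simp
  also have "\<dots> = \<zero>\<^bsub>B\<^esub>" by (rule Suc.IH) (use fx ab in simp_all)
  finally show ?case .
qed

lemma bar_d_closed:
  assumes "\<And>ys. ys \<in> tuples A n \<Longrightarrow> f ys \<in> carrier B" "xs \<in> tuples A (Suc n)"
  shows "bar_d A B f xs \<in> carrier B"
  using assms merge_closed[OF assms] by (auto simp: bar_d_def elim!: tuples_SucE)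

text \<open>The terms with the factor \<open>a\<close> in front cancel, and what is left is \<open>merge\<close> applied twice.\<close>

lemma bar_d_bar_d:
  assumes f: "\<And>ys. ys \<in> tuples A n \<Longrightarrow> f ys \<in> carrier B" and xs: "xs \<in> tuples A (Suc (Suc n))"
  shows "bar_d A B (bar_d A B f) xs = \<zero>\<^bsub>B\<^esub>"
proof -
  obtain a b ys where xs': "xs = a # b # ys" and ab: "a \<in> carrier A" "b \<in> carrier A" "ys \<in> tuples A n"
    using xs by (auto elim!: tuples_SucE)
  have m: "merge A B f us \<in> carrier B" if "us \<in> tuples A (Suc n)" for us
    by (rule merge_closed[OF f that])
  have mm: "merge A B (\<lambda>us. merge A B f (a # us)) (b # ys) \<in> carrier B"
    by (rule merge_closed[of n]) (use m ab in simp_all)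
  have "merge A B (\<lambda>us. bar_d A B f (a # us)) (b # ys)
      = merge A B (\<lambda>us. a \<odot>\<^bsub>B\<^esub> f us) (b # ys) \<ominus>\<^bsub>B\<^esub> merge A B (\<lambda>us. merge A B f (a # us)) (b # ys)"
    unfolding bar_d_def list.sel by (rule merge_diff[of n]) (use m f ab in simp_all)
  also have "merge A B (\<lambda>us. a \<odot>\<^bsub>B\<^esub> f us) (b # ys) = a \<odot>\<^bsub>B\<^esub> merge A B f (b # ys)"
    by (rule merge_smult[of _ n]) (use f ab in simp_all)
  finally have 1: "merge A B (\<lambda>us. bar_d A B f (a # us)) (b # ys) =
    a \<odot>\<^bsub>B\<^esub> merge A B f (b # ys) \<ominus>\<^bsub>B\<^esub> merge A B (\<lambda>us. merge A B f (a # us)) (b # ys)" .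
  have "bar_d A B (bar_d A B f) xs = a \<odot>\<^bsub>B\<^esub> bar_d A B f (b # ys)
     \<ominus>\<^bsub>B\<^esub> (bar_d A B f ((a \<otimes>\<^bsub>A\<^esub> b) # ys) \<ominus>\<^bsub>B\<^esub> merge A B (\<lambda>us. bar_d A B f (a # us)) (b # ys))"
    by (simp add: xs' bar_d_def[of A B "bar_d A B f"])
  also have "\<dots> = merge A B f ((a \<otimes>\<^bsub>A\<^esub> b) # ys) \<ominus>\<^bsub>B\<^esub> merge A B (\<lambda>us. merge A B f (a # us)) (b # ys)"
    unfolding 1 using m mm f ab
    by (simp only: bar_d_def list.sel smult_diff B.smult_closed A.m_closed tuples_Cons simp_thms B.smult_assoc1 B.diff_cancel)
  also have "\<dots> = merge A B (merge A B f) xs" by (simp add: xs')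
  also have "\<dots> = \<zero>\<^bsub>B\<^esub>" by (rule merge_merge[OF f xs])
  finally show ?thesis .
qed

lemma mlin_add: "mlin R A B n f \<Longrightarrow> mlin R A B n g \<Longrightarrow> mlin R A B n (\<lambda>xs. f xs \<oplus>\<^bsub>B\<^esub> g xs)"
proof (induction n arbitrary: f g)
  case (Suc n)
  have cl: "f (a # ys) \<in> carrier B" "g (a # ys) \<in> carrier B" if "a \<in> carrier A" "ys \<in> tuples A n" for a ys
    using mlin_closed[OF Suc.prems(1), of "a # ys"] mlin_closed[OF Suc.prems(2), of "a # ys"] that by simp_all
  show ?case using Suc.prems by (simp add: Suc.IH cl B.smult_r_distr one_smult_closed B.a_ac)
qed simp

lemma mlin_minus: "mlin R A B n f \<Longrightarrow> mlin R A B n (\<lambda>xs. \<ominus>\<^bsub>B\<^esub> f xs)"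
  by (rule bimod_map.mlin_hom[OF bimod_map_minus])

lemma mlin_diff: "mlin R A B n f \<Longrightarrow> mlin R A B n g \<Longrightarrow> mlin R A B n (\<lambda>xs. f xs \<ominus>\<^bsub>B\<^esub> g xs)"
  unfolding a_minus_def by (intro mlin_add mlin_minus)

lemma mlin_zero: "mlin R A B n (\<lambda>_. \<zero>\<^bsub>B\<^esub>)"
  by (induction n) (simp_all add: one_smult_closed)

lemma mlin_smult: "a \<in> carrier A \<Longrightarrow> mlin R A B n f \<Longrightarrow> mlin R A B n (\<lambda>xs. a \<odot>\<^bsub>B\<^esub> f xs)"
  by (rule bimod_map.mlin_hom[OF bimod_map_smult])

lemma scalar_smult: "r \<in> carrier R \<Longrightarrow> a \<in> carrier A \<Longrightarrow> r \<odot>\<^bsub>A\<^esub> a = (r \<odot>\<^bsub>A\<^esub> \<one>\<^bsub>A\<^esub>) \<otimes>\<^bsub>A\<^esub> a"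
  using A.smult_assoc2[of r "\<one>\<^bsub>A\<^esub>" a] by simp

lemma rsmult_scalar: "r \<in> carrier R \<Longrightarrow> a \<in> carrier A \<Longrightarrow> x \<in> carrier B \<Longrightarrow>
    rsmult B x (r \<odot>\<^bsub>A\<^esub> a) = (r \<odot>\<^bsub>A\<^esub> \<one>\<^bsub>A\<^esub>) \<odot>\<^bsub>B\<^esub> rsmult B x a"
  by (subst scalar_smult) (simp_all add: one_smult_closed B.rsmult_assoc central B.rsmult_smult)

lemma smult_scalar: "r \<in> carrier R \<Longrightarrow> a \<in> carrier A \<Longrightarrow> x \<in> carrier B \<Longrightarrow>
    (r \<odot>\<^bsub>A\<^esub> a) \<odot>\<^bsub>B\<^esub> x = (r \<odot>\<^bsub>A\<^esub> \<one>\<^bsub>A\<^esub>) \<odot>\<^bsub>B\<^esub> (a \<odot>\<^bsub>B\<^esub> x)"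
  by (subst scalar_smult) (simp_all add: one_smult_closed B.smult_assoc1)

lemma mlin_mult_left:
  assumes f: "mlin R A B (Suc n) f" and a: "a \<in> carrier A"
  shows "mlin R A B (Suc n) (\<lambda>xs. f ((a \<otimes>\<^bsub>A\<^esub> hd xs) # tl xs))"
proof -
  have "a \<otimes>\<^bsub>A\<^esub> (r \<odot>\<^bsub>A\<^esub> b) = r \<odot>\<^bsub>A\<^esub> (a \<otimes>\<^bsub>A\<^esub> b)" if "r \<in> carrier R" "b \<in> carrier A" for r b
    using A.smult_assoc2[of r b a] that a by (simp add: A.m_comm)
  then show ?thesis using f a by (simp add: A.r_distr)
qed

lemma mlin_merge: "mlin R A B n f \<Longrightarrow> mlin R A B (Suc n) (merge A B f)"
proof (induction n arbitrary: f)
  case 0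
  then show ?case
    by (simp add: B.rsmult_closed B.rsmult_add_right, intro ballI rsmult_scalar)
next
  case (Suc n)
  have fx: "f (x # us) \<in> carrier B" if "x \<in> carrier A" "us \<in> tuples A n" for x us
    using mlin_closed[OF Suc.prems, of "x # us"] that by simp
  have mx: "merge A B (\<lambda>ys. f (x # ys)) us \<in> carrier B" if "x \<in> carrier A" "us \<in> tuples A (Suc n)" for x us
    by (rule merge_closed[OF fx[OF that(1)] that(2)])
  have "mlin R A B (Suc n) (\<lambda>ys. merge A B f (a # ys))" if a: "a \<in> carrier A" for a
  proof (rule mlin_cong[OF _ _ A.algebra_axioms])
    show "mlin R A B (Suc n) (\<lambda>xs. f ((a \<otimes>\<^bsub>A\<^esub> hd xs) # tl xs) \<ominus>\<^bsub>B\<^esub> merge A B (\<lambda>ys. f (a # ys)) xs)"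
      by (intro mlin_diff mlin_mult_left Suc.prems a Suc.IH) (use Suc.prems a in simp)
    fix xs assume "xs \<in> tuples A (Suc n)"
    then show "f ((a \<otimes>\<^bsub>A\<^esub> hd xs) # tl xs) \<ominus>\<^bsub>B\<^esub> merge A B (\<lambda>ys. f (a # ys)) xs = merge A B f (a # xs)"
      by (auto elim!: tuples_SucE)
  qed
  moreover have "merge A B f ((a \<oplus>\<^bsub>A\<^esub> a') # xs) = merge A B f (a # xs) \<oplus>\<^bsub>B\<^esub> merge A B f (a' # xs)"
    if a: "a \<in> carrier A" "a' \<in> carrier A" and xs: "xs \<in> tuples A (Suc n)" for a a' xs
  proof -
    obtain b ys where b: "xs = b # ys" "b \<in> carrier A" "ys \<in> tuples A n" using xs by (rule tuples_SucE)
    have "merge A B (\<lambda>ys. f ((a \<oplus>\<^bsub>A\<^esub> a') # ys)) xs = merge A B (\<lambda>ys. f (a # ys) \<oplus>\<^bsub>B\<^esub> f (a' # ys)) xs"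
      by (rule merge_cong[OF _ xs A.M_cring]) (use Suc.prems a in simp)
    also have "\<dots> = merge A B (\<lambda>ys. f (a # ys)) xs \<oplus>\<^bsub>B\<^esub> merge A B (\<lambda>ys. f (a' # ys)) xs"
      by (rule merge_add[OF fx[OF a(1)] fx[OF a(2)] xs])
    finally show ?thesis
      using Suc.prems a b fx mx[OF a(1) xs] mx[OF a(2) xs] by (simp add: A.l_distr B.diff_add_diff)
  qed
  moreover have "merge A B f ((r \<odot>\<^bsub>A\<^esub> a) # xs) = (r \<odot>\<^bsub>A\<^esub> \<one>\<^bsub>A\<^esub>) \<odot>\<^bsub>B\<^esub> merge A B f (a # xs)"
    if r: "r \<in> carrier R" and a: "a \<in> carrier A" and xs: "xs \<in> tuples A (Suc n)" for r a xs
  proof -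
    obtain b ys where b: "xs = b # ys" "b \<in> carrier A" "ys \<in> tuples A n" using xs by (rule tuples_SucE)
    have "merge A B (\<lambda>ys. f ((r \<odot>\<^bsub>A\<^esub> a) # ys)) xs = merge A B (\<lambda>ys. (r \<odot>\<^bsub>A\<^esub> \<one>\<^bsub>A\<^esub>) \<odot>\<^bsub>B\<^esub> f (a # ys)) xs"
      by (rule merge_cong[OF _ xs A.M_cring]) (use Suc.prems a r in simp)
    also have "\<dots> = (r \<odot>\<^bsub>A\<^esub> \<one>\<^bsub>A\<^esub>) \<odot>\<^bsub>B\<^esub> merge A B (\<lambda>ys. f (a # ys)) xs"
      by (rule merge_smult[OF one_smult_closed[OF r] fx[OF a] xs])
    finally show ?thesis
      using Suc.prems a b r fx mx[OF a xs] by (simp add: A.smult_assoc2 smult_diff one_smult_closed)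
  qed
  ultimately show ?case unfolding mlin.simps(2)[of R A B "Suc n"] by (intro conjI ballI)
qed

lemma mlin_bar_d:
  assumes f: "mlin R A B n f" shows "mlin R A B (Suc n) (bar_d A B f)"
proof -
  have cl: "f us \<in> carrier B" if "us \<in> tuples A n" for us using mlin_closed[OF f that] .
  have "mlin R A B (Suc n) (\<lambda>xs. hd xs \<odot>\<^bsub>B\<^esub> f (tl xs))"
    using f by (simp add: mlin_smult cl B.smult_l_distr, intro ballI smult_scalar cl)
  from mlin_diff[OF this mlin_merge[OF f]] show ?thesis by (simp only: bar_d_def[abs_def])
qed

end

section \<open>The Leibniz rule\<close>

lemma (in abelian_group) diff_diff_right:
  assumes "x \<in> carrier G" "y \<in> carrier G"
  shows "x \<ominus> (x \<ominus> y) = y"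
proof -
  have "x \<ominus> (x \<ominus> y) = (x \<oplus> \<ominus> x) \<oplus> y"
    using assms by (simp only: minus_eq minus_add minus_minus a_closed a_inv_closed a_ac)
  then show ?thesis using assms by (simp add: r_neg)
qed

definition psign :: "('b, 'e) ring_scheme \<Rightarrow> nat \<Rightarrow> 'b \<Rightarrow> 'b" where
  "psign B i x = (if even i then x else \<ominus>\<^bsub>B\<^esub> x)"

lemma (in abelian_group) minus_psign_Suc:
  "x \<in> carrier G \<Longrightarrow> y \<ominus> psign G (Suc i) x = y \<oplus> psign G i x"
  by (simp add: psign_def minus_eq)

lemma (in abelian_group) diff_diff_assoc:
  assumes "x \<in> carrier G" "y \<in> carrier G" "z \<in> carrier G"
  shows "x \<ominus> (y \<ominus> z) = (x \<ominus> y) \<oplus> z"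
  using assms by (simp add: minus_eq minus_add a_assoc)

locale cup_pair = X: central_bimod R A X + Y: central_bimod R A Y
  for R and A :: "('r, 'a, 'q) module_scheme" and X :: "('a, 'x, 'e) bimodule_scheme" and Y :: "('a, 'y, 'f) bimodule_scheme"
begin

sublocale T: tensor_bimod A X Y
  by (rule tensor_bimod.intro[OF X.B.bimod_axioms Y.B.bimod_axioms])

abbreviation XY where "XY \<equiv> tensor A X Y"
abbreviation pure where "pure \<equiv> pure_tensor A X Y"

sublocale XY: central_bimod R A XY
  by (rule central_tensor) (unfold_locales)

lemma pure_closed: "x \<in> carrier X \<Longrightarrow> y \<in> carrier Y \<Longrightarrow> pure x y \<in> carrier XY"
  by (simp add: tensor_simps(1))

lemma pure_left: "y \<in> carrier Y \<Longrightarrow> add_map X XY (\<lambda>x. pure x y)"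
  and pure_right: "x \<in> carrier X \<Longrightarrow> add_map Y XY (\<lambda>y. pure x y)"
  using balancedD(1,2)[OF T.balanced_pure] by (simp_all add: add_map_def tensor_simps(1,2))

text \<open>For scalars from \<open>R\<close>: \<open>x \<otimes> r y = x r \<otimes> y = r x \<otimes> y\<close>.\<close>

lemma bimod_map_pure:
  assumes x: "x \<in> carrier X" shows "bimod_map R A Y XY (\<lambda>y. pure x y)"
proof unfold_locales
  show "add_map Y XY (\<lambda>y. pure x y)" by (rule pure_right[OF x])
next
  fix y a assume "y \<in> carrier Y" "a \<in> carrier A"
  then show "pure x (rsmult Y y a) = rsmult XY (pure x y) a" using x by simp
next
  fix y r assume y: "y \<in> carrier Y" and r: "r \<in> carrier R"
  let ?r = "r \<odot>\<^bsub>A\<^esub> \<one>\<^bsub>A\<^esub>"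
  have rA: "?r \<in> carrier A" by (rule X.one_smult_closed[OF r])
  have "pure x (?r \<odot>\<^bsub>Y\<^esub> y) = pure (rsmult X x ?r) y" using T.pure_balanced[OF x rA y] by simp
  also have "\<dots> = ?r \<odot>\<^bsub>XY\<^esub> pure x y" using X.central[OF r x] rA x y by simp
  finally show "pure x (?r \<odot>\<^bsub>Y\<^esub> y) = ?r \<odot>\<^bsub>XY\<^esub> pure x y" .
qed

definition cup where
  "cup i f g xs = pure (f (take i xs)) (g (drop i xs))"

lemma cup_Suc: "cup (Suc i) f g (a # xs) = cup i (\<lambda>ys. f (a # ys)) g xs"
  by (simp add: cup_def)

lemma cup_closed:
  assumes "\<And>ys. ys \<in> tuples A i \<Longrightarrow> f ys \<in> carrier X" "\<And>ys. ys \<in> tuples A j \<Longrightarrow> g ys \<in> carrier Y"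
    "xs \<in> tuples A (i + j)"
  shows "cup i f g xs \<in> carrier XY"
  unfolding cup_def by (rule pure_closed[OF assms(1)[OF tuples_take[OF assms(3)]] assms(2)[OF tuples_drop[OF assms(3)]]])

lemma mlin_cup: "mlin R A X i f \<Longrightarrow> mlin R A Y j g \<Longrightarrow> mlin R A XY (i + j) (cup i f g)"
proof (induction i arbitrary: f)
  case 0
  have "mlin R A XY j (\<lambda>xs. pure (f []) (g xs))"
    by (rule bimod_map.mlin_hom[OF bimod_map_pure]) (use 0 in simp_all)
  then show ?case by (simp add: cup_def[abs_def])
next
  case (Suc i)
  have fx: "f (a # take i xs) \<in> carrier X" and gx: "g (drop i xs) \<in> carrier Y"
    if "a \<in> carrier A" "xs \<in> tuples A (i + j)" for a xs
    using mlin_closed[OF Suc.prems(1), of "a # take i xs"] mlin_closed[OF Suc.prems(2), of "drop i xs"] that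
    by (simp_all add: tuples_take tuples_drop)
  have 1: "mlin R A XY (i + j) (\<lambda>ys. cup (Suc i) f g (a # ys))" if "a \<in> carrier A" for a
    unfolding cup_Suc by (rule Suc.IH) (use Suc.prems that in simp_all)
  have 2: "cup (Suc i) f g ((a \<oplus>\<^bsub>A\<^esub> b) # xs) = cup (Suc i) f g (a # xs) \<oplus>\<^bsub>XY\<^esub> cup (Suc i) f g (b # xs)"
    if "a \<in> carrier A" "b \<in> carrier A" "xs \<in> tuples A (i + j)" for a b xs
    using Suc.prems(1) that fx gx add_map_add[OF pure_left[OF gx]] by (simp add: cup_def tuples_take)
  have 3: "cup (Suc i) f g ((r \<odot>\<^bsub>A\<^esub> a) # xs) = (r \<odot>\<^bsub>A\<^esub> \<one>\<^bsub>A\<^esub>) \<odot>\<^bsub>XY\<^esub> cup (Suc i) f g (a # xs)"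
    if "r \<in> carrier R" "a \<in> carrier A" "xs \<in> tuples A (i + j)" for r a xs
    using Suc.prems(1) that fx gx by (simp add: cup_def tuples_take X.one_smult_closed)
  show ?case unfolding add_Suc mlin.simps(2) by (intro conjI ballI 1 2 3)
qed

text \<open>Induction on the degree of \<open>f\<close>. In degree 0, merging commutes with \<open>y \<mapsto> f() \<otimes> y\<close>, and the term \<open>f() \<otimes> b g\<close>, which \<open>\<delta>g\<close>
  has and \<open>merge\<close> lacks, equals \<open>f() b \<otimes> g\<close>, the value of \<open>merge\<close> at \<open>f\<close>.\<close>

lemma merge_cup:
  "(\<And>ys. ys \<in> tuples A i \<Longrightarrow> f ys \<in> carrier X) \<Longrightarrow> (\<And>ys. ys \<in> tuples A j \<Longrightarrow> g ys \<in> carrier Y) \<Longrightarrow>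
   xs \<in> tuples A (Suc (i + j)) \<Longrightarrow>
   merge A XY (cup i f g) xs = pure (merge A X f (take (Suc i) xs)) (g (drop (Suc i) xs))
     \<ominus>\<^bsub>XY\<^esub> psign XY i (pure (f (take i xs)) (bar_d A Y g (drop i xs)))"
proof (induction i arbitrary: f xs)
  case 0
  obtain b r where xs: "xs = b # r" "b \<in> carrier A" "r \<in> tuples A j" using 0(3) by (auto elim!: tuples_SucE)
  have f0: "f [] \<in> carrier X" and gr: "g r \<in> carrier Y" using 0(1,2) xs by simp_all
  have xs': "xs \<in> tuples A (Suc j)" using 0(3) by simp
  note add = pure_right[OF f0] and grp = Y.B.abelian_group_axioms XY.B.abelian_group_axioms
  have mg: "merge A Y g xs \<in> carrier Y" by (rule Y.merge_closed[OF 0(2) xs'])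
  have "merge A XY (cup 0 f g) xs = merge A XY (\<lambda>ys. pure (f []) (g ys)) xs" by (simp add: cup_def[abs_def])
  also have "\<dots> = pure (f []) (merge A Y g xs)"
    by (rule bimod_map.merge_hom[OF bimod_map_pure[OF f0] 0(2) xs'])
  also have "merge A Y g xs = b \<odot>\<^bsub>Y\<^esub> g r \<ominus>\<^bsub>Y\<^esub> bar_d A Y g xs"
    using mg gr xs(2) by (simp add: bar_d_def xs(1) Y.B.diff_diff_right)
  also have "pure (f []) \<dots> = pure (f []) (b \<odot>\<^bsub>Y\<^esub> g r) \<ominus>\<^bsub>XY\<^esub> pure (f []) (bar_d A Y g xs)"
    by (rule add_map_diff[OF add grp]) (use gr xs(2) Y.bar_d_closed[OF 0(2) xs'] in simp_all)
  also have "pure (f []) (b \<odot>\<^bsub>Y\<^esub> g r) = pure (rsmult X (f []) b) (g r)"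
    by (rule T.pure_balanced[symmetric, OF f0 xs(2) gr])
  finally show ?case by (simp add: psign_def xs(1))
next
  case (Suc i)
  obtain a b r where xs: "xs = a # b # r" and ab: "a \<in> carrier A" "b \<in> carrier A" "r \<in> tuples A (i + j)"
    using Suc.prems(3) by (auto elim!: tuples_SucE)
  have fx: "f (x # us) \<in> carrier X" if "x \<in> carrier A" "us \<in> tuples A i" for x us
    using Suc.prems(1) that by simp
  have br: "b # r \<in> tuples A (Suc (i + j))" "b # r \<in> tuples A (i + Suc j)" using ab by simp_all
  let ?P = "pure (f ((a \<otimes>\<^bsub>A\<^esub> b) # take i r)) (g (drop i r))"
  let ?Q = "pure (merge A X (\<lambda>us. f (a # us)) (b # take i r)) (g (drop i r))"
  let ?S = "pure (f (a # take i (b # r))) (bar_d A Y g (drop i (b # r)))"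
  have gr: "g (drop i r) \<in> carrier Y" by (rule Suc.prems(2)[OF tuples_drop[OF ab(3)]])
  have fab: "f ((a \<otimes>\<^bsub>A\<^esub> b) # take i r) \<in> carrier X" using ab by (intro fx tuples_take) simp_all
  have mf: "merge A X (\<lambda>us. f (a # us)) (b # take i r) \<in> carrier X"
    by (rule X.merge_closed[OF fx[OF ab(1)]]) (use ab tuples_take[OF ab(3)] in simp_all)
  have S: "?S \<in> carrier XY"
    by (intro pure_closed fx ab(1) tuples_take[OF br(2)] Y.bar_d_closed[of j g, OF Suc.prems(2)] tuples_drop[OF br(2)])
  have sS: "psign XY i ?S \<in> carrier XY" using S by (simp add: psign_def)
  have P: "?P \<in> carrier XY" and Q: "?Q \<in> carrier XY" by (intro pure_closed gr fab mf)+
  have IH: "merge A XY (cup i (\<lambda>us. f (a # us)) g) (b # r) = ?Q \<ominus>\<^bsub>XY\<^esub> psign XY i ?S"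
    using Suc.IH[of "\<lambda>us. f (a # us)" "b # r", OF fx[OF ab(1)] Suc.prems(2) br(1)]
    by (simp only: take_Suc_Cons drop_Suc_Cons)
  have "merge A XY (cup (Suc i) f g) xs = ?P \<ominus>\<^bsub>XY\<^esub> (?Q \<ominus>\<^bsub>XY\<^esub> psign XY i ?S)"
    unfolding xs merge.simps cup_Suc IH by (simp add: cup_def)
  also have "\<dots> = (?P \<ominus>\<^bsub>XY\<^esub> ?Q) \<ominus>\<^bsub>XY\<^esub> psign XY (Suc i) ?S"
    unfolding XY.B.diff_diff_assoc[OF P Q sS] XY.B.minus_psign_Suc[OF S] ..
  also have "?P \<ominus>\<^bsub>XY\<^esub> ?Q = pure (merge A X f (take (Suc (Suc i)) xs)) (g (drop (Suc (Suc i)) xs))"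
    using add_map_diff[OF pure_left[OF gr] X.B.abelian_group_axioms XY.B.abelian_group_axioms fab mf]
    by (simp add: xs)
  finally show ?case by (simp add: xs)
qed

text \<open>The first argument acts from the left on the values of \<open>f\<close> only, so the rule follows from the one for \<open>merge\<close>.\<close>

lemma bar_d_cup:
  assumes f: "\<And>ys. ys \<in> tuples A i \<Longrightarrow> f ys \<in> carrier X" and g: "\<And>ys. ys \<in> tuples A j \<Longrightarrow> g ys \<in> carrier Y"
    and xs: "xs \<in> tuples A (Suc (i + j))"
  shows "bar_d A XY (cup i f g) xs = cup (Suc i) (bar_d A X f) g xs \<oplus>\<^bsub>XY\<^esub> psign XY i (cup i f (bar_d A Y g) xs)"
proof -
  obtain a ys where xs': "xs = a # ys" "a \<in> carrier A" "ys \<in> tuples A (i + j)" using xs by (auto elim!: tuples_SucE)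
  let ?x = "a \<odot>\<^bsub>X\<^esub> f (take i ys)" and ?m = "merge A X f (take (Suc i) xs)"
  let ?S = "psign XY i (cup i f (bar_d A Y g) xs)"
  have gy: "g (drop i ys) \<in> carrier Y" and fy: "f (take i ys) \<in> carrier X"
    by (rule g[OF tuples_drop[OF xs'(3)]] f[OF tuples_take[OF xs'(3)]])+
  have xx: "?x \<in> carrier X" using fy xs'(2) by simp
  have m: "?m \<in> carrier X"
    by (rule X.merge_closed[OF f]) (use xs' tuples_take[OF xs'(3)] in simp_all)
  have "xs \<in> tuples A (i + Suc j)" using xs by simp
  then have S: "?S \<in> carrier XY"
    using cup_closed[OF f Y.bar_d_closed[OF g]] by (simp add: psign_def)
  have P: "pure ?x (g (drop i ys)) \<in> carrier XY" and Q: "pure ?m (g (drop i ys)) \<in> carrier XY"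
    by (intro pure_closed xx gy m)+
  have "bar_d A XY (cup i f g) xs = a \<odot>\<^bsub>XY\<^esub> cup i f g ys \<ominus>\<^bsub>XY\<^esub> merge A XY (cup i f g) xs"
    by (simp add: bar_d_def xs'(1))
  also have "a \<odot>\<^bsub>XY\<^esub> cup i f g ys = pure ?x (g (drop i ys))"
    using xs'(2) fy gy by (simp add: cup_def)
  also have "merge A XY (cup i f g) xs = pure ?m (g (drop i ys)) \<ominus>\<^bsub>XY\<^esub> ?S"
    using merge_cup[OF f g xs] by (simp add: cup_def xs'(1))
  also have "pure ?x (g (drop i ys)) \<ominus>\<^bsub>XY\<^esub> (pure ?m (g (drop i ys)) \<ominus>\<^bsub>XY\<^esub> ?S)
      = (pure ?x (g (drop i ys)) \<ominus>\<^bsub>XY\<^esub> pure ?m (g (drop i ys))) \<oplus>\<^bsub>XY\<^esub> ?S"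
    by (rule XY.B.diff_diff_assoc[OF P Q S])
  also have "pure ?x (g (drop i ys)) \<ominus>\<^bsub>XY\<^esub> pure ?m (g (drop i ys)) = pure (?x \<ominus>\<^bsub>X\<^esub> ?m) (g (drop i ys))"
    by (rule add_map_diff[OF pure_left[OF gy] X.B.abelian_group_axioms XY.B.abelian_group_axioms xx m, symmetric])
  also have "\<dots> = cup (Suc i) (bar_d A X f) g xs"
    by (simp add: cup_def bar_d_def xs'(1))
  finally show ?thesis .
qed

end

section \<open>Cohomology as a graded module\<close>

text \<open>The quotient \<open>Z / D\<close>, with operations on cosets in the form used for \<open>HHn\<close>.\<close>

definition subquot ::
  "('r, 'c, 'e) module_scheme \<Rightarrow> 'c set \<Rightarrow> 'c set \<Rightarrow> ('r, 'c set) module"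
where
  "subquot C Z D = \<lparr>carrier = (\<lambda>f. D +>\<^bsub>C\<^esub> f) ` Z, mult = undefined, one = undefined,
     ring.zero = D, add = (\<lambda>U V. U <+>\<^bsub>C\<^esub> V),
     smult = (\<lambda>r U. the_elem ((\<lambda>f. D +>\<^bsub>C\<^esub> (r \<odot>\<^bsub>C\<^esub> f)) ` U))\<rparr>"

locale subquotient = module R C for R and C :: "('r, 'c, 'e) module_scheme" +
  fixes Z D
  assumes Z: "submodule Z R C" and D: "submodule D R C" and DZ: "D \<subseteq> Z"
begin

abbreviation cls where "cls f \<equiv> D +>\<^bsub>C\<^esub> f"
abbreviation Q where "Q \<equiv> subquot C Z D"

lemma cycle_facts:
  "f \<in> Z \<Longrightarrow> f \<in> carrier C" "d \<in> D \<Longrightarrow> d \<in> carrier C" "d \<in> D \<Longrightarrow> d \<in> Z"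
  "f \<in> Z \<Longrightarrow> g \<in> Z \<Longrightarrow> f \<oplus>\<^bsub>C\<^esub> g \<in> Z" "f \<in> Z \<Longrightarrow> \<ominus>\<^bsub>C\<^esub> f \<in> Z" "r \<in> carrier R \<Longrightarrow> f \<in> Z \<Longrightarrow> r \<odot>\<^bsub>C\<^esub> f \<in> Z"
  "r \<in> carrier R \<Longrightarrow> d \<in> D \<Longrightarrow> r \<odot>\<^bsub>C\<^esub> d \<in> D"
  using submoduleE[OF Z] submoduleE[OF D] DZ by (simp_all add: subset_iff)

lemma zero_cycle: "\<zero>\<^bsub>C\<^esub> \<in> D" "\<zero>\<^bsub>C\<^esub> \<in> Z"
proof -
  show D0: "\<zero>\<^bsub>C\<^esub> \<in> D" using subgroup.one_closed[OF submodule.axioms(1)[OF D]] by simp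
  show "\<zero>\<^bsub>C\<^esub> \<in> Z" by (rule cycle_facts(3)[OF D0])
qed

sublocale S: abelian_subgroup D C
  by (rule abelian_subgroupI2[OF M.a_comm_group submodule.axioms(1)[OF D]])

lemma cls_add: "f \<in> carrier C \<Longrightarrow> g \<in> carrier C \<Longrightarrow> cls f <+>\<^bsub>C\<^esub> cls g = cls (f \<oplus>\<^bsub>C\<^esub> g)"
  by (rule S.a_rcos_sum)

lemma cls_mem: "d \<in> D \<Longrightarrow> cls d = D"
  by (rule S.a_rcos_const)

lemma cls_shift:
  assumes d: "d \<in> D" and f: "f \<in> carrier C" shows "cls (d \<oplus>\<^bsub>C\<^esub> f) = cls f"
proof -
  have "d \<oplus>\<^bsub>C\<^esub> f \<in> cls f" unfolding a_r_coset_def' using d by blast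
  from S.a_repr_independence'[OF this f] show ?thesis by simp
qed

lemma cls_memE:
  assumes "g \<in> cls f" obtains d where "d \<in> D" "g = d \<oplus>\<^bsub>C\<^esub> f"
  using assms unfolding a_r_coset_def' by blast

lemma the_elem_cls:
  assumes f: "f \<in> carrier C" and "\<And>d. d \<in> D \<Longrightarrow> \<phi> (d \<oplus>\<^bsub>C\<^esub> f) = \<phi> f"
  shows "the_elem (\<phi> ` cls f) = \<phi> f"
proof (rule the_elem_image_unique)
  show "cls f \<noteq> {}" using S.a_rcos_self[OF f] by (metis empty_iff)
  show "\<phi> g = \<phi> f" if "g \<in> cls f" for g using that by (rule cls_memE) (simp add: assms(2))
qed

lemma Q_simps:
  "carrier Q = cls ` Z" "\<zero>\<^bsub>Q\<^esub> = D" "U \<oplus>\<^bsub>Q\<^esub> V = U <+>\<^bsub>C\<^esub> V"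
  "r \<odot>\<^bsub>Q\<^esub> U = the_elem ((\<lambda>f. cls (r \<odot>\<^bsub>C\<^esub> f)) ` U)"
  by (simp_all add: subquot_def)

lemma Q_add: "f \<in> carrier C \<Longrightarrow> g \<in> carrier C \<Longrightarrow> cls f \<oplus>\<^bsub>Q\<^esub> cls g = cls (f \<oplus>\<^bsub>C\<^esub> g)"
  by (simp add: Q_simps cls_add)

lemma Q_smult:
  assumes r: "r \<in> carrier R" and f: "f \<in> carrier C"
  shows "r \<odot>\<^bsub>Q\<^esub> cls f = cls (r \<odot>\<^bsub>C\<^esub> f)"
  unfolding Q_simps
proof (rule the_elem_cls[OF f])
  fix d assume d: "d \<in> D"
  then have "r \<odot>\<^bsub>C\<^esub> (d \<oplus>\<^bsub>C\<^esub> f) = r \<odot>\<^bsub>C\<^esub> d \<oplus>\<^bsub>C\<^esub> r \<odot>\<^bsub>C\<^esub> f" using r f by (simp add: smult_r_distr cycle_facts)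
  then show "cls (r \<odot>\<^bsub>C\<^esub> (d \<oplus>\<^bsub>C\<^esub> f)) = cls (r \<odot>\<^bsub>C\<^esub> f)"
    using cls_shift[OF cycle_facts(7)[OF r d]] r f by simp
qed

lemma Q_carrierI: "f \<in> Z \<Longrightarrow> cls f \<in> carrier Q"
  by (simp add: Q_simps)

lemma Q_carrierE: assumes "U \<in> carrier Q" obtains f where "f \<in> Z" "U = cls f"
  using assms unfolding Q_simps by (rule imageE) 

lemma Q_module: "module R Q"
proof (rule moduleI[OF R.is_cring])
  show "abelian_group Q"
  proof (rule abelian_groupI)
    show "\<zero>\<^bsub>Q\<^esub> \<in> carrier Q" using Q_carrierI[OF zero_cycle(2)] cls_mem[OF zero_cycle(1)] by (simp add: Q_simps(2))
  next
    fix U V assume "U \<in> carrier Q" "V \<in> carrier Q"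
    then show "U \<oplus>\<^bsub>Q\<^esub> V \<in> carrier Q"
      by (elim Q_carrierE) (simp add: Q_add cycle_facts Q_carrierI)
  next
    fix U V W assume "U \<in> carrier Q" "V \<in> carrier Q" "W \<in> carrier Q"
    then show "U \<oplus>\<^bsub>Q\<^esub> V \<oplus>\<^bsub>Q\<^esub> W = U \<oplus>\<^bsub>Q\<^esub> (V \<oplus>\<^bsub>Q\<^esub> W)"
      by (elim Q_carrierE) (simp add: Q_add cycle_facts M.a_assoc)
  next
    fix U V assume "U \<in> carrier Q" "V \<in> carrier Q"
    then show "U \<oplus>\<^bsub>Q\<^esub> V = V \<oplus>\<^bsub>Q\<^esub> U"
      by (elim Q_carrierE) (simp add: Q_add cycle_facts M.a_comm)
  next
    fix U assume "U \<in> carrier Q"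
    then obtain f where f: "f \<in> Z" "U = cls f" by (rule Q_carrierE)
    have z: "\<zero>\<^bsub>Q\<^esub> = cls \<zero>\<^bsub>C\<^esub>" by (simp add: cls_mem[OF zero_cycle(1)] Q_simps(2))
    show "\<zero>\<^bsub>Q\<^esub> \<oplus>\<^bsub>Q\<^esub> U = U" unfolding z f(2) using f(1) by (simp add: Q_add cycle_facts)
    show "\<exists>V\<in>carrier Q. V \<oplus>\<^bsub>Q\<^esub> U = \<zero>\<^bsub>Q\<^esub>"
      unfolding z f(2) using f(1)
      by (intro bexI[OF _ Q_carrierI[OF cycle_facts(5)[OF f(1)]]]) (simp add: Q_add cycle_facts M.l_neg)
  qed
next
  fix r U assume "r \<in> carrier R" "U \<in> carrier Q"
  then show "r \<odot>\<^bsub>Q\<^esub> U \<in> carrier Q" by (elim Q_carrierE) (simp add: Q_smult cycle_facts Q_carrierI)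
next
  fix r s U assume "r \<in> carrier R" "s \<in> carrier R" "U \<in> carrier Q"
  then show "(r \<oplus>\<^bsub>R\<^esub> s) \<odot>\<^bsub>Q\<^esub> U = r \<odot>\<^bsub>Q\<^esub> U \<oplus>\<^bsub>Q\<^esub> s \<odot>\<^bsub>Q\<^esub> U"
    by (elim Q_carrierE) (simp add: Q_smult Q_add cycle_facts smult_l_distr)
next
  fix r U V assume "r \<in> carrier R" "U \<in> carrier Q" "V \<in> carrier Q"
  then show "r \<odot>\<^bsub>Q\<^esub> (U \<oplus>\<^bsub>Q\<^esub> V) = r \<odot>\<^bsub>Q\<^esub> U \<oplus>\<^bsub>Q\<^esub> r \<odot>\<^bsub>Q\<^esub> V"
    by (elim Q_carrierE) (simp add: Q_smult Q_add cycle_facts smult_r_distr)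
next
  fix r s U assume "r \<in> carrier R" "s \<in> carrier R" "U \<in> carrier Q"
  then show "(r \<otimes>\<^bsub>R\<^esub> s) \<odot>\<^bsub>Q\<^esub> U = r \<odot>\<^bsub>Q\<^esub> (s \<odot>\<^bsub>Q\<^esub> U)"
    by (elim Q_carrierE) (simp add: Q_smult cycle_facts smult_assoc1)
next
  fix U assume "U \<in> carrier Q"
  then show "\<one>\<^bsub>R\<^esub> \<odot>\<^bsub>Q\<^esub> U = U" by (elim Q_carrierE) (simp add: Q_smult cycle_facts)
qed

end

definition graded_sum :: "(nat \<Rightarrow> ('r, 'c, 'e) module_scheme) \<Rightarrow> ('r, nat \<Rightarrow> 'c) module" where
  "graded_sum Q = \<lparr>carrier = {u. (\<forall>i. u i \<in> carrier (Q i)) \<and> finite {i. u i \<noteq> \<zero>\<^bsub>Q i\<^esub>}},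
     mult = undefined, one = undefined,
     ring.zero = (\<lambda>i. \<zero>\<^bsub>Q i\<^esub>),
     add = (\<lambda>u v i. u i \<oplus>\<^bsub>Q i\<^esub> v i),
     smult = (\<lambda>r u i. r \<odot>\<^bsub>Q i\<^esub> u i)\<rparr>"

lemma graded_sum_simps:
  "\<zero>\<^bsub>graded_sum Q\<^esub> = (\<lambda>i. \<zero>\<^bsub>Q i\<^esub>)" "u \<oplus>\<^bsub>graded_sum Q\<^esub> v = (\<lambda>i. u i \<oplus>\<^bsub>Q i\<^esub> v i)"
  "r \<odot>\<^bsub>graded_sum Q\<^esub> u = (\<lambda>i. r \<odot>\<^bsub>Q i\<^esub> u i)"
  by (simp_all add: graded_sum_def)

lemma graded_sum_carrier: "u \<in> carrier (graded_sum Q) \<longleftrightarrow> (\<forall>i. u i \<in> carrier (Q i)) \<and> (\<exists>n. \<forall>i>n. u i = \<zero>\<^bsub>Q i\<^esub>)"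
  by (simp add: graded_sum_def finite_nat_set_iff_bounded_le) (meson not_le)

lemma graded_sumI: "(\<And>i. u i \<in> carrier (Q i)) \<Longrightarrow> (\<And>i. i > n \<Longrightarrow> u i = \<zero>\<^bsub>Q i\<^esub>) \<Longrightarrow> u \<in> carrier (graded_sum Q)"
  unfolding graded_sum_carrier by blast

lemma graded_sum_closed: "u \<in> carrier (graded_sum Q) \<Longrightarrow> u i \<in> carrier (Q i)"
  by (simp add: graded_sum_carrier)

lemma graded_sumE:
  assumes "u \<in> carrier (graded_sum Q)" obtains n where "\<And>i. i > n \<Longrightarrow> u i = \<zero>\<^bsub>Q i\<^esub>"
  using assms unfolding graded_sum_carrier by blast

lemma graded_sum_module:
  assumes R: "cring R" and Q: "\<And>i. module R (Q i)"
  shows "module R (graded_sum Q)"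
proof (rule moduleI[OF R])
  have grp: "abelian_group (Q i)" for i by (rule module.axioms(2)[OF Q])
  have mon: "abelian_monoid (Q i)" for i by (rule abelian_group.axioms(1)[OF grp])
  note f = abelian_monoid.a_closed[OF mon] abelian_monoid.a_assoc[OF mon]
    abelian_monoid.l_zero[OF mon] abelian_monoid.zero_closed[OF mon] abelian_group.a_inv_closed[OF grp]
    abelian_group.l_neg[OF grp]
    module.smult_closed[OF Q] module.smult_l_distr[OF Q] module.smult_r_distr[OF Q]
    module.smult_assoc1[OF Q] module.smult_one[OF Q] module.smult_r_null[OF Q] graded_sum_closed
  show "abelian_group (graded_sum Q)"
  proof (rule abelian_groupI)
    fix u v assume u: "u \<in> carrier (graded_sum Q)" and v: "v \<in> carrier (graded_sum Q)"
    obtain m where m: "\<And>i. i > m \<Longrightarrow> u i = \<zero>\<^bsub>Q i\<^esub>" using u by (rule graded_sumE) blast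
    obtain n where n: "\<And>i. i > n \<Longrightarrow> v i = \<zero>\<^bsub>Q i\<^esub>" using v by (rule graded_sumE) blast
    from m n show "u \<oplus>\<^bsub>graded_sum Q\<^esub> v \<in> carrier (graded_sum Q)"
      by (intro graded_sumI[of _ _ "max m n"]) (simp_all add: graded_sum_simps f u v)
  next
    show "\<zero>\<^bsub>graded_sum Q\<^esub> \<in> carrier (graded_sum Q)" by (rule graded_sumI) (simp_all add: graded_sum_simps f)
  next
    fix u assume u: "u \<in> carrier (graded_sum Q)"
    obtain n where n: "\<And>i. i > n \<Longrightarrow> u i = \<zero>\<^bsub>Q i\<^esub>" using u by (rule graded_sumE) blast
    have z: "\<ominus>\<^bsub>Q i\<^esub> \<zero>\<^bsub>Q i\<^esub> = \<zero>\<^bsub>Q i\<^esub>" for i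
      using abelian_group.minus_equality[OF grp[of i], of "\<zero>\<^bsub>Q i\<^esub>" "\<zero>\<^bsub>Q i\<^esub>"] by (simp add: f)
    have "(\<lambda>i. \<ominus>\<^bsub>Q i\<^esub> u i) \<in> carrier (graded_sum Q)"
      by (rule graded_sumI[of _ _ n]) (simp_all add: f u n z)
    then show "\<exists>v\<in>carrier (graded_sum Q). v \<oplus>\<^bsub>graded_sum Q\<^esub> u = \<zero>\<^bsub>graded_sum Q\<^esub>"
      by (rule bexI[rotated]) (simp add: graded_sum_simps abelian_group.l_neg[OF grp] graded_sum_closed[OF u])
  qed (simp_all add: graded_sum_simps f, simp add: abelian_monoid.a_comm[OF mon] graded_sum_closed)
  show "r \<odot>\<^bsub>graded_sum Q\<^esub> u \<in> carrier (graded_sum Q)" if r: "r \<in> carrier R" and u: "u \<in> carrier (graded_sum Q)" for r u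
  proof -
    obtain n where "\<And>i. i > n \<Longrightarrow> u i = \<zero>\<^bsub>Q i\<^esub>" using u by (rule graded_sumE) blast
    then show ?thesis by (intro graded_sumI[of _ _ n]) (simp_all add: graded_sum_simps f r u)
  qed
qed (simp_all add: graded_sum_simps module.smult_l_distr[OF Q] module.smult_r_distr[OF Q]
    module.smult_assoc1[OF Q] module.smult_one[OF Q] graded_sum_closed)

lemma graded_sum_linear:
  assumes R: "cring R" and P: "\<And>n. module R (P n)" and Q: "\<And>n. module R (Q n)"
    and add: "\<And>n. add_map (P n) (Q n) (m n)"
    and smult: "\<And>n r U. r \<in> carrier R \<Longrightarrow> U \<in> carrier (P n) \<Longrightarrow> m n (r \<odot>\<^bsub>P n\<^esub> U) = r \<odot>\<^bsub>Q n\<^esub> m n U"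
  shows "linear_map R (graded_sum P) (graded_sum Q) (\<lambda>u\<in>carrier (graded_sum P). \<lambda>n. m n (u n))"
proof -
  interpret GP: module R "graded_sum P" by (rule graded_sum_module[OF R P])
  have cl: "(\<lambda>n. m n (u n)) \<in> carrier (graded_sum Q)" if u: "u \<in> carrier (graded_sum P)" for u
  proof -
    obtain k where "\<And>n. n > k \<Longrightarrow> u n = \<zero>\<^bsub>P n\<^esub>" using u by (rule graded_sumE) blast
    then show ?thesis
      using add_map_zero[OF add module.axioms(2)[OF P] module.axioms(2)[OF Q]]
      by (intro graded_sumI[of _ _ k]) (simp_all add: add_map_closed[OF add] graded_sum_closed[OF u])
  qed
  show ?thesis
    unfolding linear_map_def
    by (intro conjI ballI PiE_I graded_sum_module R P Q)
      (simp_all add: cl, simp_all add: graded_sum_simps add_map_add[OF add] smult graded_sum_closed)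
qed

lemma linear_image_submodule:
  assumes X: "module R X" and Y: "module R Y" and h: "add_map X Y h"
    and sm: "\<And>r x. r \<in> carrier R \<Longrightarrow> x \<in> carrier X \<Longrightarrow> h (r \<odot>\<^bsub>X\<^esub> x) = r \<odot>\<^bsub>Y\<^esub> h x"
  shows "submodule (h ` carrier X) R Y"
proof -
  interpret X: module R X by fact
  interpret Y: module R Y by fact
  note g = X.M.abelian_group_axioms Y.M.abelian_group_axioms
  show ?thesis
  proof (rule Y.submoduleI)
    show "h ` carrier X \<subseteq> carrier Y" using add_map_closed[OF h] by (simp add: image_subset_iff)
    show "\<zero>\<^bsub>Y\<^esub> \<in> h ` carrier X"
      using add_map_zero[OF h g] by (intro image_eqI[of _ _ "\<zero>\<^bsub>X\<^esub>"]) simp_all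
  next
    fix y assume "y \<in> h ` carrier X"
    then obtain x where x: "x \<in> carrier X" "y = h x" by (elim imageE)
    then show "\<ominus>\<^bsub>Y\<^esub> y \<in> h ` carrier X"
      using add_map_minus[OF h g x(1)] by (intro image_eqI[of _ _ "\<ominus>\<^bsub>X\<^esub> x"]) simp_all
    show "r \<odot>\<^bsub>Y\<^esub> y \<in> h ` carrier X" if "r \<in> carrier R" for r
      using sm[OF that x(1)] x that by (intro image_eqI[of _ _ "r \<odot>\<^bsub>X\<^esub> x"]) simp_all
    fix z assume "z \<in> h ` carrier X"
    then obtain w where w: "w \<in> carrier X" "z = h w" by (elim imageE)
    then show "y \<oplus>\<^bsub>Y\<^esub> z \<in> h ` carrier X"
      using add_map_add[OF h x(1) w(1)] x by (intro image_eqI[of _ _ "x \<oplus>\<^bsub>X\<^esub> w"]) simp_all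
  qed
qed

lemma linear_kernel_submodule:
  assumes X: "module R X" and Y: "module R Y" and h: "add_map X Y h"
    and sm: "\<And>r x. r \<in> carrier R \<Longrightarrow> x \<in> carrier X \<Longrightarrow> h (r \<odot>\<^bsub>X\<^esub> x) = r \<odot>\<^bsub>Y\<^esub> h x"
  shows "submodule {x \<in> carrier X. h x = \<zero>\<^bsub>Y\<^esub>} R X"
proof -
  interpret X: module R X by fact
  interpret Y: module R Y by fact
  note g = X.M.abelian_group_axioms Y.M.abelian_group_axioms
  have z: "\<ominus>\<^bsub>Y\<^esub> \<zero>\<^bsub>Y\<^esub> = \<zero>\<^bsub>Y\<^esub>" using Y.M.minus_equality[of "\<zero>\<^bsub>Y\<^esub>" "\<zero>\<^bsub>Y\<^esub>"] by simp
  show ?thesis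
    by (rule X.submoduleI)
      (simp_all add: subset_iff add_map_zero[OF h g] add_map_minus[OF h g] add_map_add[OF h] sm z)
qed

context central_bimod begin

abbreviation Cn where "Cn \<equiv> cochain_module R A B"

lemma Cn_carrier: "f \<in> carrier (Cn n) \<longleftrightarrow> f \<in> extensional (tuples A n) \<and> mlin R A B n f"
proof -
  have "carrier A \<noteq> {}" using A.one_closed by blast
  from mlin_iff[OF this, of R B n f] show ?thesis
    unfolding cochain_module_def cochains_def by (simp add: PiE_def Pi_iff) (simp only: conj_ac)
qed

lemma Cn_simps:
  "\<zero>\<^bsub>Cn n\<^esub> = (\<lambda>xs\<in>tuples A n. \<zero>\<^bsub>B\<^esub>)" "f \<oplus>\<^bsub>Cn n\<^esub> g = (\<lambda>xs\<in>tuples A n. f xs \<oplus>\<^bsub>B\<^esub> g xs)"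
  "r \<odot>\<^bsub>Cn n\<^esub> f = (\<lambda>xs\<in>tuples A n. (r \<odot>\<^bsub>A\<^esub> \<one>\<^bsub>A\<^esub>) \<odot>\<^bsub>B\<^esub> f xs)"
  by (simp_all add: cochain_module_def)

lemma Cn_carrier_cochains: "carrier (Cn n) = cochains R A B n"
  by (simp add: cochain_module_def)

lemma Cn_closed: "f \<in> carrier (Cn n) \<Longrightarrow> xs \<in> tuples A n \<Longrightarrow> f xs \<in> carrier B"
  unfolding Cn_carrier by (elim conjE) (rule mlin_closed)

lemma Cn_ext: "f \<in> carrier (Cn n) \<Longrightarrow> g \<in> carrier (Cn n) \<Longrightarrow> (\<And>xs. xs \<in> tuples A n \<Longrightarrow> f xs = g xs) \<Longrightarrow> f = g"
  unfolding Cn_carrier by (elim conjE) (rule extensionalityI)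

lemma restrict_CnI: "mlin R A B n f \<Longrightarrow> (\<lambda>xs\<in>tuples A n. f xs) \<in> carrier (Cn n)"
  unfolding Cn_carrier by (intro conjI restrict_extensional, erule mlin_cong[OF _ _ A.algebra_axioms, rotated]) simp

lemma Cn_mlin: "f \<in> carrier (Cn n) \<Longrightarrow> mlin R A B n f"
  by (simp add: Cn_carrier)

lemma one_smult_laws:
  "r \<in> carrier R \<Longrightarrow> s \<in> carrier R \<Longrightarrow> (r \<oplus>\<^bsub>R\<^esub> s) \<odot>\<^bsub>A\<^esub> \<one>\<^bsub>A\<^esub> = (r \<odot>\<^bsub>A\<^esub> \<one>\<^bsub>A\<^esub>) \<oplus>\<^bsub>A\<^esub> (s \<odot>\<^bsub>A\<^esub> \<one>\<^bsub>A\<^esub>)"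
  "r \<in> carrier R \<Longrightarrow> s \<in> carrier R \<Longrightarrow> (r \<otimes>\<^bsub>R\<^esub> s) \<odot>\<^bsub>A\<^esub> \<one>\<^bsub>A\<^esub> = (r \<odot>\<^bsub>A\<^esub> \<one>\<^bsub>A\<^esub>) \<otimes>\<^bsub>A\<^esub> (s \<odot>\<^bsub>A\<^esub> \<one>\<^bsub>A\<^esub>)"
  "\<one>\<^bsub>R\<^esub> \<odot>\<^bsub>A\<^esub> \<one>\<^bsub>A\<^esub> = \<one>\<^bsub>A\<^esub>"
  by (simp_all add: A.smult_l_distr A.smult_assoc1 A.smult_assoc2)

lemma restrict_scalars_module: "module R (restrict_scalars A B)"
proof (rule moduleI[OF A.R_cring])
  show "abelian_group (restrict_scalars A B)"
    by (rule abelian_group_transfer[OF B.abelian_group_axioms]) (simp_all add: restrict_scalars_simps)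
qed (simp_all add: restrict_scalars_simps one_smult_closed one_smult_laws B.smult_l_distr B.smult_r_distr
    B.smult_assoc1)

lemma Cn_module: "module R (Cn n)"
proof (rule module_of_functions[OF restrict_scalars_module, of _ "tuples A n"])
  show "carrier (Cn n) \<subseteq> tuples A n \<rightarrow>\<^sub>E carrier (restrict_scalars A B)"
  proof
    fix f assume f: "f \<in> carrier (Cn n)"
    then have "f \<in> extensional (tuples A n)" unfolding Cn_carrier by (rule conjunct1)
    then show "f \<in> tuples A n \<rightarrow>\<^sub>E carrier (restrict_scalars A B)"
      by (simp add: PiE_def Pi_iff restrict_scalars_simps Cn_closed[OF f])
  qed
  show "f \<oplus>\<^bsub>Cn n\<^esub> g \<in> carrier (Cn n)" if "f \<in> carrier (Cn n)" "g \<in> carrier (Cn n)" for f g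
    unfolding Cn_simps by (intro restrict_CnI mlin_add Cn_mlin that)
  show "\<zero>\<^bsub>Cn n\<^esub> \<in> carrier (Cn n)" unfolding Cn_simps by (intro restrict_CnI mlin_zero)
  show "r \<odot>\<^bsub>Cn n\<^esub> f \<in> carrier (Cn n)" if "r \<in> carrier R" "f \<in> carrier (Cn n)" for r f
    unfolding Cn_simps by (intro restrict_CnI mlin_smult Cn_mlin that one_smult_closed)
qed (simp_all only: Cn_simps restrict_scalars_simps)

abbreviation \<delta> where "\<delta> \<equiv> hochschild_d A B"

lemma d_eq:
  assumes f: "f \<in> carrier (Cn n)" shows "\<delta> n f = (\<lambda>xs\<in>tuples A (Suc n). bar_d A B f xs)"
proof (rule extensionalityI[of _ "tuples A (Suc n)"])
  show "\<delta> n f \<in> extensional (tuples A (Suc n))" by (simp add: hochschild_d_def)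
  fix xs assume xs: "xs \<in> tuples A (Suc n)"
  then show "\<delta> n f xs = (\<lambda>xs\<in>tuples A (Suc n). bar_d A B f xs) xs"
    using hochschild_d_eq[OF Cn_closed[OF f] xs] by simp
qed simp

lemma d_closed: "f \<in> carrier (Cn n) \<Longrightarrow> \<delta> n f \<in> carrier (Cn (Suc n))"
  unfolding d_eq by (intro restrict_CnI mlin_bar_d Cn_mlin)

lemma bar_d_cong:
  assumes "\<And>ys. ys \<in> tuples A n \<Longrightarrow> f ys = g ys" "xs \<in> tuples A (Suc n)"
  shows "bar_d A B f xs = bar_d A B g xs"
  using merge_cong[of A n f g xs B, OF assms A.M_cring] assms by (auto simp: bar_d_def elim!: tuples_SucE)

lemma bar_d_add:
  assumes f: "\<And>ys. ys \<in> tuples A n \<Longrightarrow> f ys \<in> carrier B" and g: "\<And>ys. ys \<in> tuples A n \<Longrightarrow> g ys \<in> carrier B"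
    and xs: "xs \<in> tuples A (Suc n)"
  shows "bar_d A B (\<lambda>ys. f ys \<oplus>\<^bsub>B\<^esub> g ys) xs = bar_d A B f xs \<oplus>\<^bsub>B\<^esub> bar_d A B g xs"
proof -
  obtain a ys where xs': "xs = a # ys" "a \<in> carrier A" "ys \<in> tuples A n" using xs by (rule tuples_SucE)
  have m: "merge A B f xs \<in> carrier B" "merge A B g xs \<in> carrier B"
    using merge_closed[of n f, OF f xs] merge_closed[of n g, OF g xs] by simp_all
  have ma: "merge A B (\<lambda>ys. f ys \<oplus>\<^bsub>B\<^esub> g ys) xs = merge A B f xs \<oplus>\<^bsub>B\<^esub> merge A B g xs"
    by (rule merge_add[OF f g xs])
  show ?thesis
    using m f[OF xs'(3)] g[OF xs'(3)] xs'(2) ma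
    by (simp add: bar_d_def xs'(1) B.smult_r_distr B.diff_add_diff)
qed

end

context bimod_map begin

lemma bar_d_hom:
  assumes f: "\<And>ys. ys \<in> tuples A n \<Longrightarrow> f ys \<in> carrier B" and xs: "xs \<in> tuples A (Suc n)"
    and sm: "\<And>a x. a \<in> carrier A \<Longrightarrow> x \<in> carrier B \<Longrightarrow> h (a \<odot>\<^bsub>B\<^esub> x) = a \<odot>\<^bsub>C\<^esub> h x"
  shows "bar_d A C (\<lambda>ys. h (f ys)) xs = h (bar_d A B f xs)"
proof -
  obtain a ys where xs': "xs = a # ys" "a \<in> carrier A" "ys \<in> tuples A n" using xs by (rule tuples_SucE)
  have m: "merge A B f xs \<in> carrier B" by (rule B.merge_closed[OF f xs])
  have mh: "merge A C (\<lambda>ys. h (f ys)) xs = h (merge A B f xs)" by (rule merge_hom[OF f xs])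
  have "h (bar_d A B f xs) = h (a \<odot>\<^bsub>B\<^esub> f ys) \<ominus>\<^bsub>C\<^esub> h (merge A B f xs)"
    unfolding bar_d_def using m f[OF xs'(3)] xs'(2) by (simp add: xs'(1) add_map_diff[OF h_add B_grp C_grp])
  also have "\<dots> = bar_d A C (\<lambda>ys. h (f ys)) xs"
    using f[OF xs'(3)] xs'(2) mh by (simp add: bar_d_def xs'(1) sm)
  finally show ?thesis ..
qed

end

context central_bimod begin

lemma d_add:
  assumes f: "f \<in> carrier (Cn n)" and g: "g \<in> carrier (Cn n)"
  shows "\<delta> n (f \<oplus>\<^bsub>Cn n\<^esub> g) = \<delta> n f \<oplus>\<^bsub>Cn (Suc n)\<^esub> \<delta> n g"
proof -
  interpret C: module R "Cn n" by (rule Cn_module)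
  interpret C': module R "Cn (Suc n)" by (rule Cn_module)
  show ?thesis
  proof (rule Cn_ext[OF d_closed[OF C.a_closed[OF f g]] C'.a_closed[OF d_closed[OF f] d_closed[OF g]]])
    fix xs assume xs: "xs \<in> tuples A (Suc n)"
    have "bar_d A B (f \<oplus>\<^bsub>Cn n\<^esub> g) xs = bar_d A B (\<lambda>ys. f ys \<oplus>\<^bsub>B\<^esub> g ys) xs"
      by (rule bar_d_cong[OF _ xs]) (simp add: Cn_simps)
    then show "\<delta> n (f \<oplus>\<^bsub>Cn n\<^esub> g) xs = (\<delta> n f \<oplus>\<^bsub>Cn (Suc n)\<^esub> \<delta> n g) xs"
      using bar_d_add[OF Cn_closed[OF f] Cn_closed[OF g] xs] xs
      by (simp add: d_eq[OF C.a_closed[OF f g]] d_eq[OF f] d_eq[OF g] Cn_simps(2)[of "Suc n"])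
  qed
qed

lemma d_smult:
  assumes r: "r \<in> carrier R" and f: "f \<in> carrier (Cn n)"
  shows "\<delta> n (r \<odot>\<^bsub>Cn n\<^esub> f) = r \<odot>\<^bsub>Cn (Suc n)\<^esub> \<delta> n f"
proof -
  interpret C: module R "Cn n" by (rule Cn_module)
  interpret C': module R "Cn (Suc n)" by (rule Cn_module)
  note r1 = one_smult_closed[OF r]
  show ?thesis
  proof (rule Cn_ext[OF d_closed[OF C.smult_closed[OF r f]] C'.smult_closed[OF r d_closed[OF f]]])
    fix xs assume xs: "xs \<in> tuples A (Suc n)"
    have "bar_d A B (r \<odot>\<^bsub>Cn n\<^esub> f) xs = bar_d A B (\<lambda>ys. (r \<odot>\<^bsub>A\<^esub> \<one>\<^bsub>A\<^esub>) \<odot>\<^bsub>B\<^esub> f ys) xs"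
      by (rule bar_d_cong[OF _ xs]) (simp add: Cn_simps)
    also have "\<dots> = (r \<odot>\<^bsub>A\<^esub> \<one>\<^bsub>A\<^esub>) \<odot>\<^bsub>B\<^esub> bar_d A B f xs"
      by (rule bimod_map.bar_d_hom[OF bimod_map_smult[OF r1] Cn_closed[OF f] xs])
        (simp_all add: B.smult_comm r1)
    finally show "\<delta> n (r \<odot>\<^bsub>Cn n\<^esub> f) xs = (r \<odot>\<^bsub>Cn (Suc n)\<^esub> \<delta> n f) xs"
      using xs by (simp add: d_eq[OF C.smult_closed[OF r f]] d_eq[OF f] Cn_simps(3)[of "Suc n"])
  qed
qed

lemma d_d:
  assumes f: "f \<in> carrier (Cn n)" shows "\<delta> (Suc n) (\<delta> n f) = \<zero>\<^bsub>Cn (Suc (Suc n))\<^esub>"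
proof -
  have "bar_d A B (\<delta> n f) xs = \<zero>\<^bsub>B\<^esub>" if xs: "xs \<in> tuples A (Suc (Suc n))" for xs
    using bar_d_cong[OF _ xs, of "\<delta> n f" "bar_d A B f"] bar_d_bar_d[OF Cn_closed[OF f] xs]
    by (simp add: d_eq[OF f])
  then show ?thesis unfolding d_eq[OF d_closed[OF f]] Cn_simps by (intro restrict_ext)
qed

lemma d_add_map: "add_map (Cn n) (Cn (Suc n)) (\<delta> n)"
  by (rule add_mapI) (simp_all add: d_closed d_add)

lemma cocycles_iff: "f \<in> cocycles R A B n \<longleftrightarrow> f \<in> carrier (Cn n) \<and> \<delta> n f = \<zero>\<^bsub>Cn (Suc n)\<^esub>"
  by (simp add: cocycles_def Cn_carrier_cochains)

lemma cocycles_submodule: "submodule (cocycles R A B n) R (Cn n)"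
proof -
  have "cocycles R A B n = {f \<in> carrier (Cn n). \<delta> n f = \<zero>\<^bsub>Cn (Suc n)\<^esub>}"
    by (simp add: cocycles_def Cn_carrier_cochains)
  then show ?thesis
    by (simp only:) (rule linear_kernel_submodule[OF Cn_module Cn_module d_add_map], rule d_smult)
qed

lemma coboundaries_Suc: "coboundaries R A B (Suc n) = \<delta> n ` carrier (Cn n)"
  by (simp add: coboundaries_def Cn_carrier_cochains)

lemma coboundaries_0: "coboundaries R A B 0 = {\<zero>\<^bsub>Cn 0\<^esub>}"
  by (simp add: coboundaries_def)

lemma coboundaries_submodule: "submodule (coboundaries R A B n) R (Cn n)"
proof (cases n)
  case 0
  interpret C: module R "Cn 0" by (rule Cn_module)
  have "\<ominus>\<^bsub>Cn 0\<^esub> \<zero>\<^bsub>Cn 0\<^esub> = \<zero>\<^bsub>Cn 0\<^esub>" using C.M.minus_equality[of "\<zero>\<^bsub>Cn 0\<^esub>" "\<zero>\<^bsub>Cn 0\<^esub>"] by simp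
  then show ?thesis unfolding 0 coboundaries_0 by (intro C.submoduleI) simp_all
next
  case (Suc m)
  show ?thesis unfolding Suc coboundaries_Suc
    by (rule linear_image_submodule[OF Cn_module Cn_module d_add_map], rule d_smult)
qed

lemma coboundaries_subset: "coboundaries R A B n \<subseteq> cocycles R A B n"
proof (cases n)
  case 0
  have "\<zero>\<^bsub>Cn 0\<^esub> \<in> cocycles R A B 0"
    using subgroup.one_closed[OF submodule.axioms(1)[OF cocycles_submodule]] by simp
  then show ?thesis by (simp add: 0 coboundaries_0)
next
  case (Suc m)
  show ?thesis unfolding Suc coboundaries_Suc
    by (rule image_subsetI) (simp add: cocycles_iff d_closed d_d)
qed

lemma subquotient: "subquotient R (Cn n) (cocycles R A B n) (coboundaries R A B n)"
  by (intro subquotient.intro subquotient_axioms.intro Cn_module cocycles_submodule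
      coboundaries_submodule coboundaries_subset)

lemma HHn_eq: "HHn R A B n = subquot (Cn n) (cocycles R A B n) (coboundaries R A B n)"
  by (simp add: HHn_def subquot_def hochschild_class_def[abs_def])

lemma HHn_module: "module R (HHn R A B n)"
  unfolding HHn_eq by (rule subquotient.Q_module[OF subquotient])

lemma HH_eq: "HH R A B = graded_sum (HHn R A B)"
  by (simp add: HH_def graded_sum_def)

lemma HH_module: "module R (HH R A B)"
  unfolding HH_eq by (rule graded_sum_module[OF A.R_cring HHn_module])

end

context central_bimod begin

abbreviation hclass where "hclass n \<equiv> hochschild_class R A B n"
abbreviation H where "H \<equiv> HHn R A B"

lemma cocycle_Cn: "f \<in> cocycles R A B n \<Longrightarrow> f \<in> carrier (Cn n)"
  by (simp add: cocycles_iff)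

lemma class_closed: "f \<in> cocycles R A B n \<Longrightarrow> hclass n f \<in> carrier (H n)"
  unfolding HHn_eq hochschild_class_def by (rule subquotient.Q_carrierI[OF subquotient])

lemma classE:
  assumes "U \<in> carrier (H n)" obtains f where "f \<in> cocycles R A B n" "U = hclass n f"
  using assms unfolding HHn_eq hochschild_class_def by (rule subquotient.Q_carrierE[OF subquotient])

lemma class_add: "f \<in> cocycles R A B n \<Longrightarrow> g \<in> cocycles R A B n \<Longrightarrow>
    hclass n f \<oplus>\<^bsub>H n\<^esub> hclass n g = hclass n (f \<oplus>\<^bsub>Cn n\<^esub> g)"
  unfolding HHn_eq hochschild_class_def by (intro subquotient.Q_add[OF subquotient] cocycle_Cn)

lemma class_smult: "r \<in> carrier R \<Longrightarrow> f \<in> cocycles R A B n \<Longrightarrow>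
    r \<odot>\<^bsub>H n\<^esub> hclass n f = hclass n (r \<odot>\<^bsub>Cn n\<^esub> f)"
  unfolding HHn_eq hochschild_class_def by (intro subquotient.Q_smult[OF subquotient] cocycle_Cn)

lemma class_shift: "d \<in> coboundaries R A B n \<Longrightarrow> f \<in> carrier (Cn n) \<Longrightarrow>
    hclass n (d \<oplus>\<^bsub>Cn n\<^esub> f) = hclass n f"
  unfolding hochschild_class_def by (rule subquotient.cls_shift[OF subquotient])

lemma class_memE:
  assumes "g \<in> hclass n f" obtains d where "d \<in> coboundaries R A B n" "g = d \<oplus>\<^bsub>Cn n\<^esub> f"
  using assms unfolding hochschild_class_def by (rule subquotient.cls_memE[OF subquotient])

lemma class_self: "f \<in> carrier (Cn n) \<Longrightarrow> f \<in> hclass n f"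
  unfolding hochschild_class_def
  by (rule abelian_subgroup.a_rcos_self) (intro abelian_subgroupI2 abelian_group.a_comm_group
      module.axioms(2)[OF Cn_module] submodule.axioms(1)[OF coboundaries_submodule])

lemmas cocycle_add = subquotient.cycle_facts(4)[OF subquotient]
lemmas cocycle_smult = subquotient.cycle_facts(6)[OF subquotient]
lemmas coboundary_Cn = subquotient.cycle_facts(2)[OF subquotient]
lemmas coboundary_cocycle = subquotient.cycle_facts(3)[OF subquotient]

lemma coboundary_zero: "\<zero>\<^bsub>Cn n\<^esub> \<in> coboundaries R A B n"
  by (rule subquotient.zero_cycle(1)[OF subquotient])

lemma H_grp: "abelian_group (H n)"
  by (rule module.axioms(2)[OF HHn_module])

end

section \<open>Functoriality in the coefficients\<close>

locale bimod_hom = bimod_map R A B C h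
  for R and A :: "('r, 'a, 'q) module_scheme" and B :: "('a, 'b, 'e) bimodule_scheme" and C :: "('a, 'c, 'f) bimodule_scheme"
    and h +
  assumes h_smult: "a \<in> carrier A \<Longrightarrow> x \<in> carrier B \<Longrightarrow> h (a \<odot>\<^bsub>B\<^esub> x) = a \<odot>\<^bsub>C\<^esub> h x"
begin

abbreviation push where "push n f \<equiv> compose (tuples A n) h f"

lemma push_eq: "push n f = (\<lambda>xs\<in>tuples A n. h (f xs))"
  by (simp add: compose_def)

lemma push_closed: "f \<in> carrier (B.Cn n) \<Longrightarrow> push n f \<in> carrier (C.Cn n)"
  unfolding push_eq by (intro C.restrict_CnI mlin_hom B.Cn_mlin)

lemma push_add:
  assumes f: "f \<in> carrier (B.Cn n)" and g: "g \<in> carrier (B.Cn n)"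
  shows "push n (f \<oplus>\<^bsub>B.Cn n\<^esub> g) = push n f \<oplus>\<^bsub>C.Cn n\<^esub> push n g"
  unfolding push_eq B.Cn_simps C.Cn_simps
  by (rule restrict_ext) (simp add: add_map_add[OF h_add] B.Cn_closed[OF f] B.Cn_closed[OF g])

lemma push_smult:
  assumes r: "r \<in> carrier R" and f: "f \<in> carrier (B.Cn n)"
  shows "push n (r \<odot>\<^bsub>B.Cn n\<^esub> f) = r \<odot>\<^bsub>C.Cn n\<^esub> push n f"
  unfolding push_eq B.Cn_simps C.Cn_simps
  by (rule restrict_ext) (simp add: h_smult B.one_smult_closed r B.Cn_closed[OF f])

lemma push_zero: "push n \<zero>\<^bsub>B.Cn n\<^esub> = \<zero>\<^bsub>C.Cn n\<^esub>"
  unfolding push_eq B.Cn_simps C.Cn_simps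
  by (rule restrict_ext) (simp add: add_map_zero[OF h_add B_grp C_grp])

lemma push_d:
  assumes f: "f \<in> carrier (B.Cn n)"
  shows "C.\<delta> n (push n f) = push (Suc n) (B.\<delta> n f)"
  unfolding C.d_eq[OF push_closed[OF f]] push_eq[of "Suc n"]
proof (rule restrict_ext)
  fix xs assume xs: "xs \<in> tuples A (Suc n)"
  have "bar_d A C (push n f) xs = bar_d A C (\<lambda>ys. h (f ys)) xs"
    by (rule C.bar_d_cong[OF _ xs]) (simp add: push_eq)
  also have "\<dots> = h (bar_d A B f xs)"
    by (rule bar_d_hom[OF B.Cn_closed[OF f] xs h_smult])
  finally show "bar_d A C (push n f) xs = h (B.\<delta> n f xs)" using xs by (simp add: B.d_eq[OF f])
qed

lemma push_cocycle: "f \<in> cocycles R A B n \<Longrightarrow> push n f \<in> cocycles R A C n"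
  unfolding B.cocycles_iff C.cocycles_iff by (elim conjE, intro conjI push_closed) (simp_all add: push_d push_zero)

lemma push_coboundary: "d \<in> coboundaries R A B n \<Longrightarrow> push n d \<in> coboundaries R A C n"
proof (cases n)
  case 0
  assume "d \<in> coboundaries R A B n"
  then show ?thesis unfolding 0 B.coboundaries_0 C.coboundaries_0 singleton_iff by (simp only: push_zero)
next
  case (Suc m)
  assume "d \<in> coboundaries R A B n"
  then obtain p where p: "p \<in> carrier (B.Cn m)" "d = B.\<delta> m p"
    unfolding Suc B.coboundaries_Suc by (elim imageE)
  have "push n d = C.\<delta> m (push m p)" unfolding p(2) Suc by (rule push_d[OF p(1), symmetric])
  then show ?thesis unfolding Suc C.coboundaries_Suc using push_closed[OF p(1)] by simp
qed

definition class_map where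
  "class_map n U = the_elem ((\<lambda>f. C.hclass n (push n f)) ` U)"

lemma class_map_class:
  assumes f: "f \<in> cocycles R A B n"
  shows "class_map n (B.hclass n f) = C.hclass n (push n f)"
  unfolding class_map_def
proof (rule the_elem_image_unique)
  note fC = B.cocycle_Cn[OF f]
  show "B.hclass n f \<noteq> {}" using B.class_self[OF fC] by (metis empty_iff)
  fix g assume "g \<in> B.hclass n f"
  then obtain d where d: "d \<in> coboundaries R A B n" "g = d \<oplus>\<^bsub>B.Cn n\<^esub> f" by (rule B.class_memE)
  show "C.hclass n (push n g) = C.hclass n (push n f)"
    unfolding d(2) push_add[OF B.coboundary_Cn[OF d(1)] fC]
    by (rule C.class_shift[OF push_coboundary[OF d(1)] push_closed[OF fC]])
qed

lemma class_map_add_map: "add_map (B.H n) (C.H n) (class_map n)"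
proof (rule add_mapI)
  fix U assume U: "U \<in> carrier (B.H n)"
  obtain f where f: "f \<in> cocycles R A B n" "U = B.hclass n f" using U by (rule B.classE)
  show "class_map n U \<in> carrier (C.H n)"
    unfolding f(2) class_map_class[OF f(1)] by (rule C.class_closed[OF push_cocycle[OF f(1)]])
  fix V assume V: "V \<in> carrier (B.H n)"
  obtain g where g: "g \<in> cocycles R A B n" "V = B.hclass n g" using V by (rule B.classE)
  show "class_map n (U \<oplus>\<^bsub>B.H n\<^esub> V) = class_map n U \<oplus>\<^bsub>C.H n\<^esub> class_map n V"
    unfolding f(2) g(2) B.class_add[OF f(1) g(1)] class_map_class[OF f(1)] class_map_class[OF g(1)]
      class_map_class[OF B.cocycle_add[OF f(1) g(1)]] C.class_add[OF push_cocycle[OF f(1)] push_cocycle[OF g(1)]]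
      push_add[OF B.cocycle_Cn[OF f(1)] B.cocycle_Cn[OF g(1)]] ..
qed

lemma class_map_smult:
  assumes r: "r \<in> carrier R" and U: "U \<in> carrier (B.H n)"
  shows "class_map n (r \<odot>\<^bsub>B.H n\<^esub> U) = r \<odot>\<^bsub>C.H n\<^esub> class_map n U"
proof -
  obtain f where f: "f \<in> cocycles R A B n" "U = B.hclass n f" using U by (rule B.classE)
  show ?thesis
    unfolding f(2) B.class_smult[OF r f(1)] class_map_class[OF f(1)] class_map_class[OF B.cocycle_smult[OF r f(1)]]
      C.class_smult[OF r push_cocycle[OF f(1)]] push_smult[OF r B.cocycle_Cn[OF f(1)]] ..
qed

lemma HH_map_linear: "linear_map R (HH R A B) (HH R A C) (HH_map R A B C h)"
proof -
  have "HH_map R A B C h = (\<lambda>u\<in>carrier (graded_sum B.H). \<lambda>n. class_map n (u n))"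
    by (simp add: HH_map_def class_map_def B.HH_eq)
  then show ?thesis
    using graded_sum_linear[OF B.A.R_cring B.HHn_module C.HHn_module class_map_add_map class_map_smult]
    by (simp add: B.HH_eq C.HH_eq)
qed

end

section \<open>The cup product on cohomology\<close>

context cup_pair begin

abbreviation cc where "cc \<equiv> cochain_cup A X Y"

lemma cc_eq: "cc i j f g = (\<lambda>xs\<in>tuples A (i + j). cup i f g xs)"
  by (simp add: cochain_cup_def cup_def)

lemma cc_closed: "f \<in> carrier (X.Cn i) \<Longrightarrow> g \<in> carrier (Y.Cn j) \<Longrightarrow> cc i j f g \<in> carrier (XY.Cn (i + j))"
  unfolding cc_eq by (intro XY.restrict_CnI mlin_cup X.Cn_mlin Y.Cn_mlin)

lemma cc_add_left:
  assumes "f \<in> carrier (X.Cn i)" "f' \<in> carrier (X.Cn i)" "g \<in> carrier (Y.Cn j)"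
  shows "cc i j (f \<oplus>\<^bsub>X.Cn i\<^esub> f') g = cc i j f g \<oplus>\<^bsub>XY.Cn (i + j)\<^esub> cc i j f' g"
  unfolding cc_eq XY.Cn_simps
  by (rule restrict_ext)
    (simp add: cup_def X.Cn_simps tuples_take tuples_drop add_map_add[OF pure_left] X.Cn_closed[OF assms(1)] X.Cn_closed[OF assms(2)] Y.Cn_closed[OF assms(3)])

lemma cc_add_right:
  assumes "f \<in> carrier (X.Cn i)" "g \<in> carrier (Y.Cn j)" "g' \<in> carrier (Y.Cn j)"
  shows "cc i j f (g \<oplus>\<^bsub>Y.Cn j\<^esub> g') = cc i j f g \<oplus>\<^bsub>XY.Cn (i + j)\<^esub> cc i j f g'"
  unfolding cc_eq XY.Cn_simps
  by (rule restrict_ext)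
    (simp add: cup_def Y.Cn_simps tuples_take tuples_drop add_map_add[OF pure_right] X.Cn_closed[OF assms(1)] Y.Cn_closed[OF assms(2)] Y.Cn_closed[OF assms(3)])

lemma cc_smult_left:
  assumes "r \<in> carrier R" "f \<in> carrier (X.Cn i)" "g \<in> carrier (Y.Cn j)"
  shows "cc i j (r \<odot>\<^bsub>X.Cn i\<^esub> f) g = r \<odot>\<^bsub>XY.Cn (i + j)\<^esub> cc i j f g"
  unfolding cc_eq XY.Cn_simps
  by (rule restrict_ext)
    (simp add: cup_def X.Cn_simps tuples_take tuples_drop X.one_smult_closed assms(1) X.Cn_closed[OF assms(2)] Y.Cn_closed[OF assms(3)])

lemma cc_smult_right:
  assumes "r \<in> carrier R" "f \<in> carrier (X.Cn i)" "g \<in> carrier (Y.Cn j)"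
  shows "cc i j f (r \<odot>\<^bsub>Y.Cn j\<^esub> g) = r \<odot>\<^bsub>XY.Cn (i + j)\<^esub> cc i j f g"
  unfolding cc_eq XY.Cn_simps
  by (rule restrict_ext)
    (simp add: cup_def Y.Cn_simps tuples_take tuples_drop bimod_map.h_scalar[OF bimod_map_pure] assms(1) X.Cn_closed[OF assms(2)] Y.Cn_closed[OF assms(3)] del: T.smult_pure)

lemma cc_zero_left: "g \<in> carrier (Y.Cn j) \<Longrightarrow> cc i j \<zero>\<^bsub>X.Cn i\<^esub> g = \<zero>\<^bsub>XY.Cn (i + j)\<^esub>"
  by (rule add_map_zero[of "X.Cn i" "XY.Cn (i + j)" "\<lambda>f. cc i j f g"])
    (simp_all add: add_map_def cc_closed cc_add_left module.axioms(2)[OF X.Cn_module] module.axioms(2)[OF XY.Cn_module])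

lemma cc_zero_right: "f \<in> carrier (X.Cn i) \<Longrightarrow> cc i j f \<zero>\<^bsub>Y.Cn j\<^esub> = \<zero>\<^bsub>XY.Cn (i + j)\<^esub>"
  by (rule add_map_zero[of "Y.Cn j" "XY.Cn (i + j)" "\<lambda>g. cc i j f g"])
    (simp_all add: add_map_def cc_closed cc_add_right module.axioms(2)[OF Y.Cn_module] module.axioms(2)[OF XY.Cn_module])

lemma d_cc:
  assumes f: "f \<in> carrier (X.Cn i)" and g: "g \<in> carrier (Y.Cn j)"
  shows "XY.\<delta> (i + j) (cc i j f g) = cc (Suc i) j (X.\<delta> i f) g
     \<oplus>\<^bsub>XY.Cn (Suc (i + j))\<^esub> psign (XY.Cn (Suc (i + j))) i (cc i (Suc j) f (Y.\<delta> j g))"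
proof -
  interpret C: module R "XY.Cn (Suc (i + j))" by (rule XY.Cn_module)
  let ?c = "cc i (Suc j) f (Y.\<delta> j g)"
  have c1: "cc (Suc i) j (X.\<delta> i f) g \<in> carrier (XY.Cn (Suc (i + j)))"
    using cc_closed[OF X.d_closed[OF f] g] by simp
  have c2: "?c \<in> carrier (XY.Cn (Suc (i + j)))"
    using cc_closed[OF f Y.d_closed[OF g]] by simp
  have c3: "psign (XY.Cn (Suc (i + j))) i ?c \<in> carrier (XY.Cn (Suc (i + j)))" using c2 by (simp add: psign_def)
  have sign: "psign (XY.Cn (Suc (i + j))) i ?c xs = psign XY i (?c xs)" if xs: "xs \<in> tuples A (Suc (i + j))" for xs
  proof -
    have "(\<lambda>xs\<in>tuples A (Suc (i + j)). \<ominus>\<^bsub>XY\<^esub> ?c xs) \<in> carrier (XY.Cn (Suc (i + j)))"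
      by (intro XY.restrict_CnI XY.mlin_minus XY.Cn_mlin c2)
    moreover have "(\<lambda>xs\<in>tuples A (Suc (i + j)). \<ominus>\<^bsub>XY\<^esub> ?c xs) \<oplus>\<^bsub>XY.Cn (Suc (i + j))\<^esub> ?c = \<zero>\<^bsub>XY.Cn (Suc (i + j))\<^esub>"
      unfolding XY.Cn_simps by (rule restrict_ext) (simp add: XY.Cn_closed[OF c2] XY.B.l_neg)
    ultimately have "\<ominus>\<^bsub>XY.Cn (Suc (i + j))\<^esub> ?c = (\<lambda>xs\<in>tuples A (Suc (i + j)). \<ominus>\<^bsub>XY\<^esub> ?c xs)"
      using C.M.minus_equality[OF _ c2] by simp
    then show ?thesis using xs by (simp add: psign_def)
  qed
  show ?thesis
  proof (rule XY.Cn_ext[OF XY.d_closed[OF cc_closed[OF f g]] C.M.a_closed[OF c1 c3]])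
    fix xs assume xs: "xs \<in> tuples A (Suc (i + j))"
    have ti: "take (Suc i) xs \<in> tuples A (Suc i)" and di: "drop i xs \<in> tuples A (Suc j)"
      using tuples_take[of xs A "Suc i" j] tuples_drop[of xs A i "Suc j"] xs by simp_all
    have "XY.\<delta> (i + j) (cc i j f g) xs = bar_d A XY (cc i j f g) xs"
      using xs by (simp add: XY.d_eq[OF cc_closed[OF f g]])
    also have "\<dots> = bar_d A XY (cup i f g) xs"
      by (rule XY.bar_d_cong[OF _ xs]) (simp add: cc_eq)
    also have "\<dots> = cup (Suc i) (bar_d A X f) g xs \<oplus>\<^bsub>XY\<^esub> psign XY i (cup i f (bar_d A Y g) xs)"
      by (rule bar_d_cup[OF X.Cn_closed[OF f] Y.Cn_closed[OF g] xs])
    also have "cup (Suc i) (bar_d A X f) g xs = cc (Suc i) j (X.\<delta> i f) g xs"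
      using xs ti by (simp add: cc_eq cup_def X.d_eq[OF f])
    also have "cup i f (bar_d A Y g) xs = ?c xs"
      using xs di by (simp add: cc_eq cup_def Y.d_eq[OF g])
    also have "psign XY i (?c xs) = psign (XY.Cn (Suc (i + j))) i ?c xs" by (rule sign[OF xs, symmetric])
    finally show "XY.\<delta> (i + j) (cc i j f g) xs = (cc (Suc i) j (X.\<delta> i f) g
       \<oplus>\<^bsub>XY.Cn (Suc (i + j))\<^esub> psign (XY.Cn (Suc (i + j))) i ?c) xs"
      using xs by (simp add: XY.Cn_simps(2)[of "Suc (i + j)"])
  qed
qed

end

context cup_pair begin

lemma Cn_grp: "abelian_group (XY.Cn n)"
  by (rule module.axioms(2)[OF XY.Cn_module])

lemma psign_zero: "psign (XY.Cn n) i \<zero>\<^bsub>XY.Cn n\<^esub> = \<zero>\<^bsub>XY.Cn n\<^esub>"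
proof -
  interpret C: abelian_group "XY.Cn n" by (rule Cn_grp)
  show ?thesis using C.minus_equality[of "\<zero>\<^bsub>XY.Cn n\<^esub>" "\<zero>\<^bsub>XY.Cn n\<^esub>"] by (simp add: psign_def)
qed

lemma d_cc_cocycle_right:
  assumes f: "f \<in> carrier (X.Cn i)" and g: "g \<in> cocycles R A Y j"
  shows "XY.\<delta> (i + j) (cc i j f g) = cc (Suc i) j (X.\<delta> i f) g"
proof -
  interpret C: abelian_group "XY.Cn (Suc (i + j))" by (rule Cn_grp)
  have g': "g \<in> carrier (Y.Cn j)" "Y.\<delta> j g = \<zero>\<^bsub>Y.Cn (Suc j)\<^esub>" using g by (simp_all add: Y.cocycles_iff)
  have "cc (Suc i) j (X.\<delta> i f) g \<in> carrier (XY.Cn (Suc (i + j)))"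
    using cc_closed[OF X.d_closed[OF f] g'(1)] by simp
  then show ?thesis
    unfolding d_cc[OF f g'(1)] g'(2) cc_zero_right[OF f] add_Suc_right psign_zero by (rule C.r_zero)
qed

lemma d_cc_cocycle_left:
  assumes f: "f \<in> cocycles R A X i" and g: "g \<in> carrier (Y.Cn j)"
  shows "XY.\<delta> (i + j) (cc i j f g) = psign (XY.Cn (Suc (i + j))) i (cc i (Suc j) f (Y.\<delta> j g))"
proof -
  interpret C: abelian_group "XY.Cn (Suc (i + j))" by (rule Cn_grp)
  have f': "f \<in> carrier (X.Cn i)" "X.\<delta> i f = \<zero>\<^bsub>X.Cn (Suc i)\<^esub>" using f by (simp_all add: X.cocycles_iff)
  have "cc i (Suc j) f (Y.\<delta> j g) \<in> carrier (XY.Cn (Suc (i + j)))"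
    using cc_closed[OF f'(1) Y.d_closed[OF g]] by simp
  then have "psign (XY.Cn (Suc (i + j))) i (cc i (Suc j) f (Y.\<delta> j g)) \<in> carrier (XY.Cn (Suc (i + j)))"
    by (simp add: psign_def)
  then show ?thesis
    unfolding d_cc[OF f'(1) g] f'(2) cc_zero_left[OF g] add_Suc by (rule C.l_zero)
qed

lemma cc_cocycle:
  assumes f: "f \<in> cocycles R A X i" and g: "g \<in> cocycles R A Y j"
  shows "cc i j f g \<in> cocycles R A XY (i + j)"
proof -
  have f': "f \<in> carrier (X.Cn i)" "X.\<delta> i f = \<zero>\<^bsub>X.Cn (Suc i)\<^esub>" using f by (simp_all add: X.cocycles_iff)
  have g': "g \<in> carrier (Y.Cn j)" by (rule Y.cocycle_Cn[OF g])
  show ?thesis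
    unfolding XY.cocycles_iff d_cc_cocycle_right[OF f'(1) g] f'(2) cc_zero_left[OF g']
    by (intro conjI cc_closed f'(1) g') simp
qed

text \<open>If \<open>g\<close> is a cocycle, \<open>\<delta>p \<union> g = \<delta>(p \<union> g)\<close>.\<close>

lemma cc_coboundary_left:
  assumes d: "d \<in> coboundaries R A X i" and g: "g \<in> cocycles R A Y j"
  shows "cc i j d g \<in> coboundaries R A XY (i + j)"
proof (cases i)
  case 0
  have "d = \<zero>\<^bsub>X.Cn 0\<^esub>" using d unfolding 0 X.coboundaries_0 by (rule singletonD)
  then show ?thesis
    unfolding 0 using cc_zero_left[OF Y.cocycle_Cn[OF g], of 0] XY.coboundary_zero by simp
next
  case (Suc i')
  obtain p where p: "p \<in> carrier (X.Cn i')" "d = X.\<delta> i' p"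
    using d unfolding Suc X.coboundaries_Suc by (elim imageE)
  have "cc i j d g = XY.\<delta> (i' + j) (cc i' j p g)"
    unfolding Suc p(2) by (rule d_cc_cocycle_right[OF p(1) g, symmetric])
  then show ?thesis
    unfolding Suc add_Suc XY.coboundaries_Suc using cc_closed[OF p(1) Y.cocycle_Cn[OF g]] by simp
qed

text \<open>If \<open>f\<close> is a cocycle of degree \<open>i\<close>, \<open>f \<union> \<delta>p\<close> is \<open>\<delta>(f \<union> p)\<close> up to the sign \<open>(-1)\<^sup>i\<close>.\<close>

lemma cc_coboundary_right:
  assumes f: "f \<in> cocycles R A X i" and d: "d \<in> coboundaries R A Y j"
  shows "cc i j f d \<in> coboundaries R A XY (i + j)"
proof (cases j)
  case 0
  have "d = \<zero>\<^bsub>Y.Cn 0\<^esub>" using d unfolding 0 Y.coboundaries_0 by (rule singletonD)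
  then show ?thesis
    unfolding 0 using cc_zero_right[OF X.cocycle_Cn[OF f], of 0] XY.coboundary_zero by simp
next
  case (Suc j')
  interpret C: module R "XY.Cn (Suc (i + j'))" by (rule XY.Cn_module)
  obtain p where p: "p \<in> carrier (Y.Cn j')" "d = Y.\<delta> j' p"
    using d unfolding Suc Y.coboundaries_Suc by (elim imageE)
  have c: "cc i (Suc j') f (Y.\<delta> j' p) \<in> carrier (XY.Cn (Suc (i + j')))"
    using cc_closed[OF X.cocycle_Cn[OF f] Y.d_closed[OF p(1)]] by simp
  have mem: "psign (XY.Cn (Suc (i + j'))) i (cc i (Suc j') f (Y.\<delta> j' p)) \<in> coboundaries R A XY (Suc (i + j'))"
    unfolding d_cc_cocycle_left[OF f p(1), symmetric] XY.coboundaries_Suc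
    by (rule imageI[OF cc_closed[OF X.cocycle_Cn[OF f] p(1)]])
  have "cc i (Suc j') f (Y.\<delta> j' p) \<in> coboundaries R A XY (Suc (i + j'))"
  proof (cases "even i")
    case True then show ?thesis using mem by (simp add: psign_def)
  next
    case False
    then have "\<ominus>\<^bsub>XY.Cn (Suc (i + j'))\<^esub> cc i (Suc j') f (Y.\<delta> j' p) \<in> coboundaries R A XY (Suc (i + j'))"
      using mem by (simp add: psign_def)
    from C.submoduleE(3)[OF XY.coboundaries_submodule this]
    show ?thesis using c by simp
  qed
  then show ?thesis unfolding Suc p(2) by simp
qed

abbreviation CC where "CC \<equiv> class_cup R A X Y"

text \<open>Other representatives are \<open>d + f\<close> and \<open>e + g\<close> with coboundaries \<open>d\<close> and \<open>e\<close>. That \<open>d \<union> (e + g)\<close> is a coboundary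
  requires \<open>e\<close> to be a cocycle, so \<open>\<delta>\<delta> = 0\<close> enters here.\<close>

lemma CC_class:
  assumes f: "f \<in> cocycles R A X i" and g: "g \<in> cocycles R A Y j"
  shows "CC i j (X.hclass i f) (Y.hclass j g) = XY.hclass (i + j) (cc i j f g)"
proof -
  interpret C: module R "XY.Cn (i + j)" by (rule XY.Cn_module)
  let ?\<phi> = "\<lambda>(f, g). hochschild_class R A XY (i + j) (cc i j f g)"
  note fC = X.cocycle_Cn[OF f] and gC = Y.cocycle_Cn[OF g]
  have "the_elem (?\<phi> ` (X.hclass i f \<times> Y.hclass j g)) = ?\<phi> (f, g)"
  proof (rule the_elem_image_unique)
    have "(f, g) \<in> X.hclass i f \<times> Y.hclass j g" by (rule SigmaI[OF X.class_self[OF fC] Y.class_self[OF gC]])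
    then show "X.hclass i f \<times> Y.hclass j g \<noteq> {}" by (metis empty_iff)
    fix q assume "q \<in> X.hclass i f \<times> Y.hclass j g"
    then obtain f' g' where q: "q = (f', g')" "f' \<in> X.hclass i f" "g' \<in> Y.hclass j g" by (rule SigmaE)
    obtain d where d: "d \<in> coboundaries R A X i" "f' = d \<oplus>\<^bsub>X.Cn i\<^esub> f" using q(2) by (rule X.class_memE)
    obtain e where e: "e \<in> coboundaries R A Y j" "g' = e \<oplus>\<^bsub>Y.Cn j\<^esub> g" using q(3) by (rule Y.class_memE)
    have g'Z: "g' \<in> cocycles R A Y j" unfolding e(2) by (rule Y.cocycle_add[OF Y.coboundary_cocycle[OF e(1)] g])
    note g'C = Y.cocycle_Cn[OF g'Z] and eC = Y.coboundary_Cn[OF e(1)] and dC = X.coboundary_Cn[OF d(1)]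
    have "cc i j f' g' = cc i j d g' \<oplus>\<^bsub>XY.Cn (i + j)\<^esub> cc i j f g'"
      unfolding d(2) by (rule cc_add_left[OF dC fC g'C])
    then have "XY.hclass (i + j) (cc i j f' g') = XY.hclass (i + j) (cc i j f g')"
      by (simp only: XY.class_shift[OF cc_coboundary_left[OF d(1) g'Z] cc_closed[OF fC g'C]])
    also have "cc i j f g' = cc i j f e \<oplus>\<^bsub>XY.Cn (i + j)\<^esub> cc i j f g"
      unfolding e(2) by (rule cc_add_right[OF fC eC gC])
    also have "XY.hclass (i + j) \<dots> = XY.hclass (i + j) (cc i j f g)"
      by (rule XY.class_shift[OF cc_coboundary_right[OF f e(1)] cc_closed[OF fC gC]])
    finally show "?\<phi> q = ?\<phi> (f, g)" unfolding q(1) by simp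
  qed
  then show ?thesis unfolding class_cup_def by simp
qed

lemma CC_closed:
  assumes U: "U \<in> carrier (X.H i)" and V: "V \<in> carrier (Y.H j)" shows "CC i j U V \<in> carrier (XY.H (i + j))"
proof -
  obtain f where f: "f \<in> cocycles R A X i" "U = X.hclass i f" using U by (rule X.classE)
  obtain g where g: "g \<in> cocycles R A Y j" "V = Y.hclass j g" using V by (rule Y.classE)
  show ?thesis unfolding f(2) g(2) CC_class[OF f(1) g(1)] by (rule XY.class_closed[OF cc_cocycle[OF f(1) g(1)]])
qed

lemma CC_add_left:
  assumes U: "U \<in> carrier (X.H i)" and U': "U' \<in> carrier (X.H i)" and V: "V \<in> carrier (Y.H j)"
  shows "CC i j (U \<oplus>\<^bsub>X.H i\<^esub> U') V = CC i j U V \<oplus>\<^bsub>XY.H (i + j)\<^esub> CC i j U' V"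
proof -
  obtain f where f: "f \<in> cocycles R A X i" "U = X.hclass i f" using U by (rule X.classE)
  obtain f' where f': "f' \<in> cocycles R A X i" "U' = X.hclass i f'" using U' by (rule X.classE)
  obtain g where g: "g \<in> cocycles R A Y j" "V = Y.hclass j g" using V by (rule Y.classE)
  show ?thesis
    unfolding f(2) f'(2) g(2) X.class_add[OF f(1) f'(1)] CC_class[OF f(1) g(1)] CC_class[OF f'(1) g(1)]
      CC_class[OF X.cocycle_add[OF f(1) f'(1)] g(1)] XY.class_add[OF cc_cocycle[OF f(1) g(1)] cc_cocycle[OF f'(1) g(1)]]
      cc_add_left[OF X.cocycle_Cn[OF f(1)] X.cocycle_Cn[OF f'(1)] Y.cocycle_Cn[OF g(1)]] ..
qed

lemma CC_add_right:
  assumes U: "U \<in> carrier (X.H i)" and V: "V \<in> carrier (Y.H j)" and V': "V' \<in> carrier (Y.H j)"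
  shows "CC i j U (V \<oplus>\<^bsub>Y.H j\<^esub> V') = CC i j U V \<oplus>\<^bsub>XY.H (i + j)\<^esub> CC i j U V'"
proof -
  obtain f where f: "f \<in> cocycles R A X i" "U = X.hclass i f" using U by (rule X.classE)
  obtain g where g: "g \<in> cocycles R A Y j" "V = Y.hclass j g" using V by (rule Y.classE)
  obtain g' where g': "g' \<in> cocycles R A Y j" "V' = Y.hclass j g'" using V' by (rule Y.classE)
  show ?thesis
    unfolding f(2) g(2) g'(2) Y.class_add[OF g(1) g'(1)] CC_class[OF f(1) g(1)] CC_class[OF f(1) g'(1)]
      CC_class[OF f(1) Y.cocycle_add[OF g(1) g'(1)]] XY.class_add[OF cc_cocycle[OF f(1) g(1)] cc_cocycle[OF f(1) g'(1)]]
      cc_add_right[OF X.cocycle_Cn[OF f(1)] Y.cocycle_Cn[OF g(1)] Y.cocycle_Cn[OF g'(1)]] ..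
qed

lemma
  assumes r: "r \<in> carrier R" and U: "U \<in> carrier (X.H i)" and V: "V \<in> carrier (Y.H j)"
  shows CC_smult_left: "CC i j (r \<odot>\<^bsub>X.H i\<^esub> U) V = r \<odot>\<^bsub>XY.H (i + j)\<^esub> CC i j U V"
    and CC_smult_right: "CC i j U (r \<odot>\<^bsub>Y.H j\<^esub> V) = r \<odot>\<^bsub>XY.H (i + j)\<^esub> CC i j U V"
proof -
  obtain f where f: "f \<in> cocycles R A X i" "U = X.hclass i f" using U by (rule X.classE)
  obtain g where g: "g \<in> cocycles R A Y j" "V = Y.hclass j g" using V by (rule Y.classE)
  show "CC i j (r \<odot>\<^bsub>X.H i\<^esub> U) V = r \<odot>\<^bsub>XY.H (i + j)\<^esub> CC i j U V"
    unfolding f(2) g(2) X.class_smult[OF r f(1)] CC_class[OF f(1) g(1)] CC_class[OF X.cocycle_smult[OF r f(1)] g(1)]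
      XY.class_smult[OF r cc_cocycle[OF f(1) g(1)]] cc_smult_left[OF r X.cocycle_Cn[OF f(1)] Y.cocycle_Cn[OF g(1)]] ..
  show "CC i j U (r \<odot>\<^bsub>Y.H j\<^esub> V) = r \<odot>\<^bsub>XY.H (i + j)\<^esub> CC i j U V"
    unfolding f(2) g(2) Y.class_smult[OF r g(1)] CC_class[OF f(1) g(1)] CC_class[OF f(1) Y.cocycle_smult[OF r g(1)]]
      XY.class_smult[OF r cc_cocycle[OF f(1) g(1)]] cc_smult_right[OF r X.cocycle_Cn[OF f(1)] Y.cocycle_Cn[OF g(1)]] ..
qed

lemma CC_zero_left: "V \<in> carrier (Y.H j) \<Longrightarrow> CC i j \<zero>\<^bsub>X.H i\<^esub> V = \<zero>\<^bsub>XY.H (i + j)\<^esub>"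
  by (rule add_map_zero[of "X.H i" "XY.H (i + j)" "\<lambda>U. CC i j U V"])
    (simp_all add: add_map_def CC_closed CC_add_left X.H_grp XY.H_grp)

lemma CC_zero_right: "U \<in> carrier (X.H i) \<Longrightarrow> CC i j U \<zero>\<^bsub>Y.H j\<^esub> = \<zero>\<^bsub>XY.H (i + j)\<^esub>"
  by (rule add_map_zero[of "Y.H j" "XY.H (i + j)" "\<lambda>V. CC i j U V"])
    (simp_all add: add_map_def CC_closed CC_add_right Y.H_grp XY.H_grp)

definition total_cup where
  "total_cup u v n = (\<Oplus>\<^bsub>XY.H n\<^esub>i\<in>{..n}. CC i (n - i) (u i) (v (n - i)))"

abbreviation HX where "HX \<equiv> HH R A X"
abbreviation HY where "HY \<equiv> HH R A Y"
abbreviation HXY where "HXY \<equiv> HH R A XY"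

lemma HX_closed: "u \<in> carrier HX \<Longrightarrow> u i \<in> carrier (X.H i)"
  unfolding X.HH_eq by (rule graded_sum_closed)

lemma HY_closed: "u \<in> carrier HY \<Longrightarrow> u i \<in> carrier (Y.H i)"
  unfolding Y.HH_eq by (rule graded_sum_closed)

lemma term_closed:
  assumes "u \<in> carrier HX" "v \<in> carrier HY" "i \<in> {..n}"
  shows "CC i (n - i) (u i) (v (n - i)) \<in> carrier (XY.H n)"
  using CC_closed[OF HX_closed[OF assms(1), of i] HY_closed[OF assms(2), of "n - i"]] assms(3) by simp

text \<open>If \<open>u\<close> vanishes above degree \<open>k\<close> and \<open>v\<close> above degree \<open>l\<close>, then each summand in a degree above \<open>k + l\<close> has a
  factor that vanishes.\<close>

lemma total_cup_closed:
  assumes u: "u \<in> carrier HX" and v: "v \<in> carrier HY"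
  shows "total_cup u v \<in> carrier HXY"
proof -
  obtain k where k: "\<And>i. i > k \<Longrightarrow> u i = \<zero>\<^bsub>X.H i\<^esub>" using u unfolding X.HH_eq by (rule graded_sumE) blast
  obtain l where l: "\<And>i. i > l \<Longrightarrow> v i = \<zero>\<^bsub>Y.H i\<^esub>" using v unfolding Y.HH_eq by (rule graded_sumE) blast
  show ?thesis
    unfolding XY.HH_eq
  proof (rule graded_sumI[of _ _ "k + l"])
    fix n
    interpret N: abelian_group "XY.H n" by (rule XY.H_grp)
    show "total_cup u v n \<in> carrier (XY.H n)"
      unfolding total_cup_def by (intro N.finsum_closed Pi_I term_closed u v)
    assume n: "k + l < n"
    have "CC i (n - i) (u i) (v (n - i)) = \<zero>\<^bsub>XY.H n\<^esub>" if i: "i \<in> {..n}" for i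
    proof (cases "i > k")
      case True
      then show ?thesis using CC_zero_left[OF HY_closed[OF v], of i "n - i"] k i by simp
    next
      case False
      then have "n - i > l" using n by simp
      then show ?thesis using CC_zero_right[OF HX_closed[OF u], of i "n - i"] l i by simp
    qed
    then have "total_cup u v n = (\<Oplus>\<^bsub>XY.H n\<^esub>i\<in>{..n}. \<zero>\<^bsub>XY.H n\<^esub>)"
      unfolding total_cup_def by (intro N.finsum_cong' refl Pi_I N.zero_closed)
    then show "total_cup u v n = \<zero>\<^bsub>XY.H n\<^esub>" by (simp add: N.finsum_zero)
  qed
qed

lemma total_cup_sumI:
  assumes "u \<in> carrier HX" "v \<in> carrier HY" "u' \<in> carrier HX" "v' \<in> carrier HY"
    and "\<And>i. i \<le> n \<Longrightarrow> t i = CC i (n - i) (u i) (v (n - i)) \<oplus>\<^bsub>XY.H n\<^esub> CC i (n - i) (u' i) (v' (n - i))"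
  shows "(\<Oplus>\<^bsub>XY.H n\<^esub>i\<in>{..n}. t i) = (total_cup u v \<oplus>\<^bsub>HXY\<^esub> total_cup u' v') n"
proof -
  interpret N: abelian_group "XY.H n" by (rule XY.H_grp)
  have "(\<Oplus>\<^bsub>XY.H n\<^esub>i\<in>{..n}. t i) =
      (\<Oplus>\<^bsub>XY.H n\<^esub>i\<in>{..n}. CC i (n - i) (u i) (v (n - i)) \<oplus>\<^bsub>XY.H n\<^esub> CC i (n - i) (u' i) (v' (n - i)))"
    by (intro N.finsum_cong' refl Pi_I N.a_closed term_closed assms) simp_all
  also have "\<dots> = total_cup u v n \<oplus>\<^bsub>XY.H n\<^esub> total_cup u' v' n"
    unfolding total_cup_def by (intro N.finsum_addf Pi_I term_closed assms)
  finally show ?thesis by (simp add: XY.HH_eq graded_sum_simps)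
qed

lemma total_cup_scaleI:
  assumes "r \<in> carrier R" "u \<in> carrier HX" "v \<in> carrier HY"
    and "\<And>i. i \<le> n \<Longrightarrow> t i = r \<odot>\<^bsub>XY.H n\<^esub> CC i (n - i) (u i) (v (n - i))"
  shows "(\<Oplus>\<^bsub>XY.H n\<^esub>i\<in>{..n}. t i) = (r \<odot>\<^bsub>HXY\<^esub> total_cup u v) n"
proof -
  interpret N: module R "XY.H n" by (rule XY.HHn_module)
  have "(\<Oplus>\<^bsub>XY.H n\<^esub>i\<in>{..n}. t i) = (\<Oplus>\<^bsub>XY.H n\<^esub>i\<in>{..n}. r \<odot>\<^bsub>XY.H n\<^esub> CC i (n - i) (u i) (v (n - i)))"
    by (intro N.finsum_cong' refl Pi_I N.smult_closed term_closed assms) simp_all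
  also have "\<dots> = r \<odot>\<^bsub>XY.H n\<^esub> total_cup u v n"
    unfolding total_cup_def by (intro N.finsum_smult_ldistr[symmetric] finite_atMost Pi_I term_closed assms)
  finally show ?thesis by (simp add: XY.HH_eq graded_sum_simps)
qed

lemma HX_apply: "(u \<oplus>\<^bsub>HX\<^esub> u') i = u i \<oplus>\<^bsub>X.H i\<^esub> u' i" "(r \<odot>\<^bsub>HX\<^esub> u) i = r \<odot>\<^bsub>X.H i\<^esub> u i"
  and HY_apply: "(v \<oplus>\<^bsub>HY\<^esub> v') i = v i \<oplus>\<^bsub>Y.H i\<^esub> v' i" "(r \<odot>\<^bsub>HY\<^esub> v) i = r \<odot>\<^bsub>Y.H i\<^esub> v i"
  by (simp_all add: X.HH_eq Y.HH_eq graded_sum_simps)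

lemma CC_add_left_le: "i \<le> n \<Longrightarrow> U \<in> carrier (X.H i) \<Longrightarrow> U' \<in> carrier (X.H i) \<Longrightarrow> V \<in> carrier (Y.H (n - i)) \<Longrightarrow>
    CC i (n - i) (U \<oplus>\<^bsub>X.H i\<^esub> U') V = CC i (n - i) U V \<oplus>\<^bsub>XY.H n\<^esub> CC i (n - i) U' V"
  and CC_add_right_le: "i \<le> n \<Longrightarrow> U \<in> carrier (X.H i) \<Longrightarrow> V \<in> carrier (Y.H (n - i)) \<Longrightarrow> V' \<in> carrier (Y.H (n - i)) \<Longrightarrow>
    CC i (n - i) U (V \<oplus>\<^bsub>Y.H (n - i)\<^esub> V') = CC i (n - i) U V \<oplus>\<^bsub>XY.H n\<^esub> CC i (n - i) U V'"
  using CC_add_left[of U i U' V "n - i"] CC_add_right[of U i V "n - i" V'] by simp_all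

lemma CC_smult_le: "i \<le> n \<Longrightarrow> r \<in> carrier R \<Longrightarrow> U \<in> carrier (X.H i) \<Longrightarrow> V \<in> carrier (Y.H (n - i)) \<Longrightarrow>
    CC i (n - i) (r \<odot>\<^bsub>X.H i\<^esub> U) V = r \<odot>\<^bsub>XY.H n\<^esub> CC i (n - i) U V"
  "i \<le> n \<Longrightarrow> r \<in> carrier R \<Longrightarrow> U \<in> carrier (X.H i) \<Longrightarrow> V \<in> carrier (Y.H (n - i)) \<Longrightarrow>
    CC i (n - i) U (r \<odot>\<^bsub>Y.H (n - i)\<^esub> V) = r \<odot>\<^bsub>XY.H n\<^esub> CC i (n - i) U V"
  using CC_smult_left[of r U i V "n - i"] CC_smult_right[of r U i V "n - i"] by simp_all

lemma total_cup_add_left: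
  assumes "u \<in> carrier HX" "u' \<in> carrier HX" "v \<in> carrier HY"
  shows "total_cup (u \<oplus>\<^bsub>HX\<^esub> u') v = total_cup u v \<oplus>\<^bsub>HXY\<^esub> total_cup u' v"
  by (rule ext, subst total_cup_def, rule total_cup_sumI)
    (simp_all only: assms HX_apply CC_add_left_le HX_closed HY_closed)

lemma total_cup_add_right:
  assumes "u \<in> carrier HX" "v \<in> carrier HY" "v' \<in> carrier HY"
  shows "total_cup u (v \<oplus>\<^bsub>HY\<^esub> v') = total_cup u v \<oplus>\<^bsub>HXY\<^esub> total_cup u v'"
  by (rule ext, subst total_cup_def, rule total_cup_sumI)
    (simp_all only: assms HY_apply CC_add_right_le HX_closed HY_closed)

lemma total_cup_smult_left:
  assumes "r \<in> carrier R" "u \<in> carrier HX" "v \<in> carrier HY"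
  shows "total_cup (r \<odot>\<^bsub>HX\<^esub> u) v = r \<odot>\<^bsub>HXY\<^esub> total_cup u v"
  by (rule ext, subst total_cup_def, rule total_cup_scaleI)
    (simp_all only: assms HX_apply CC_smult_le HX_closed HY_closed)

lemma total_cup_smult_right:
  assumes "r \<in> carrier R" "u \<in> carrier HX" "v \<in> carrier HY"
  shows "total_cup u (r \<odot>\<^bsub>HY\<^esub> v) = r \<odot>\<^bsub>HXY\<^esub> total_cup u v"
  by (rule ext, subst total_cup_def, rule total_cup_scaleI)
    (simp_all only: assms HY_apply CC_smult_le HX_closed HY_closed)

sublocale HT: tensor_bimod R "symm_bimodule HX" "symm_bimodule HY"
  by (intro tensor_bimod.intro bimod_symm X.HH_module Y.HH_module)

lemma balanced_total_cup: "balanced R (symm_bimodule HX) (symm_bimodule HY) HXY total_cup"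
  by (rule balancedI)
    (simp_all add: symm_bimodule_simps total_cup_closed total_cup_add_left total_cup_add_right
      total_cup_smult_left total_cup_smult_right)

lemma HXY_grp: "abelian_group HXY"
  by (rule module.axioms(2)[OF XY.HH_module])

lemma cup_product_eq: "cup_product R A X Y = (\<lambda>t\<in>carrier HT.T. tensor_lift HXY total_cup t)"
  by (simp add: cup_product_def tensor_simps(1) total_cup_def[abs_def])

lemma cup_product_linear:
  "linear_map R (tensor R (symm_bimodule HX) (symm_bimodule HY)) HXY (cup_product R A X Y)"
proof -
  interpret HTb: bimod R "tensor R (symm_bimodule HX) (symm_bimodule HY)" by (rule HT.bimod_XY)
  interpret Z: module R HXY by (rule XY.HH_module)
  let ?l = "tensor_lift HXY total_cup"
  have la: "add_map HT.T HXY ?l" by (rule HT.lift_add_map[OF HXY_grp balanced_total_cup])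
  have zs: "add_map HXY HXY (\<lambda>x. r \<odot>\<^bsub>HXY\<^esub> x)" if "r \<in> carrier R" for r
    by (rule add_mapI) (simp_all add: Z.smult_r_distr that)
  have ls: "?l (r \<odot>\<^bsub>HT.XY\<^esub> t) = r \<odot>\<^bsub>HXY\<^esub> ?l t" if r: "r \<in> carrier R" and t: "t \<in> carrier HT.T" for r t
  proof (rule HT.add_map_eqI[OF add_map_comp[OF HT.smult_add_map[OF r] la] add_map_comp[OF la zs[OF r]] t])
    fix u v assume u: "u \<in> carrier (symm_bimodule HX)" and v: "v \<in> carrier (symm_bimodule HY)"
    have ru: "r \<odot>\<^bsub>symm_bimodule HX\<^esub> u \<in> carrier (symm_bimodule HX)" by (rule HT.X.smult_closed[OF r u])
    show "?l (r \<odot>\<^bsub>HT.XY\<^esub> HT.pure u v) = r \<odot>\<^bsub>HXY\<^esub> ?l (HT.pure u v)"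
      unfolding HT.smult_pure[OF r u v] HT.lift_pure[OF HXY_grp balanced_total_cup ru v]
        HT.lift_pure[OF HXY_grp balanced_total_cup u v]
      using total_cup_smult_left[OF r] u v by (simp add: symm_bimodule_simps)
  qed
  have T: "carrier HT.XY = carrier HT.T" "add HT.XY = add HT.T" by (simp_all add: tensor_simps)
  show ?thesis
    unfolding linear_map_def cup_product_eq
  proof (intro conjI ballI HTb.module_axioms XY.HH_module)
    show "(\<lambda>t\<in>carrier HT.T. ?l t) \<in> carrier HT.XY \<rightarrow>\<^sub>E carrier HXY"
      unfolding T by (rule PiE_I) (simp_all add: add_map_closed[OF la])
    fix x assume x: "x \<in> carrier HT.XY"
    show "(\<lambda>t\<in>carrier HT.T. ?l t) (x \<oplus>\<^bsub>HT.XY\<^esub> y) = (\<lambda>t\<in>carrier HT.T. ?l t) x \<oplus>\<^bsub>HXY\<^esub> (\<lambda>t\<in>carrier HT.T. ?l t) y"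
      if y: "y \<in> carrier HT.XY" for y
      using x y HTb.M.a_closed[OF x y] unfolding T by (simp add: add_map_add[OF la])
    show "(\<lambda>t\<in>carrier HT.T. ?l t) (r \<odot>\<^bsub>HT.XY\<^esub> x) = r \<odot>\<^bsub>HXY\<^esub> (\<lambda>t\<in>carrier HT.T. ?l t) x"
      if r: "r \<in> carrier R" for r
      using x HTb.smult_closed[OF r x] unfolding T by (simp add: ls[OF r])
  qed
qed

end

section \<open>The dot-cup product\<close>

lemma linear_map_compose:
  assumes f: "linear_map R X Y f" and g: "linear_map R Y Z g"
  shows "linear_map R X Z (compose (carrier X) g f)"
proof -
  have X: "module R X" and Y: "module R Y" and Z: "module R Z"
    using f g by (simp_all add: linear_map_def)
  have fc: "f x \<in> carrier Y" if "x \<in> carrier X" for x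
    using f that by (auto simp: linear_map_def)
  have gc: "g y \<in> carrier Z" if "y \<in> carrier Y" for y
    using g that by (auto simp: linear_map_def)
  have fa: "f (x \<oplus>\<^bsub>X\<^esub> y) = f x \<oplus>\<^bsub>Y\<^esub> f y" if "x \<in> carrier X" "y \<in> carrier X" for x y
    using f that by (simp add: linear_map_def)
  have ga: "g (x \<oplus>\<^bsub>Y\<^esub> y) = g x \<oplus>\<^bsub>Z\<^esub> g y" if "x \<in> carrier Y" "y \<in> carrier Y" for x y
    using g that by (simp add: linear_map_def)
  have fs: "f (r \<odot>\<^bsub>X\<^esub> x) = r \<odot>\<^bsub>Y\<^esub> f x" if "r \<in> carrier R" "x \<in> carrier X" for r x
    using f that by (simp add: linear_map_def)
  have gs: "g (r \<odot>\<^bsub>Y\<^esub> x) = r \<odot>\<^bsub>Z\<^esub> g x" if "r \<in> carrier R" "x \<in> carrier Y" for r x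
    using g that by (simp add: linear_map_def)
  interpret X: module R X by (rule X)
  show ?thesis
    unfolding linear_map_def
    by (intro conjI X Z ballI PiE_I) (simp_all add: compose_def fc gc fa ga fs gs)
qed

lemma bilinear_of_linear:
  assumes X: "module R X" and Y: "module R Y"
    and h: "linear_map R (tensor R (symm_bimodule X) (symm_bimodule Y)) Z h"
  shows "bilinear_map R (symm_bimodule X) (symm_bimodule Y) Z
    (\<lambda>u v. h (pure_tensor R (symm_bimodule X) (symm_bimodule Y) u v))"
proof -
  interpret X': bimod R "symm_bimodule X" by (rule bimod_symm[OF X])
  interpret Y': bimod R "symm_bimodule Y" by (rule bimod_symm[OF Y])
  interpret T: tensor_bimod R "symm_bimodule X" "symm_bimodule Y" ..
  have hc: "h t \<in> carrier Z" if "t \<in> carrier T.T" for t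
    using h that by (auto simp: linear_map_def tensor_simps(1))
  have ha: "h (t \<oplus>\<^bsub>T.T\<^esub> u) = h t \<oplus>\<^bsub>Z\<^esub> h u" if "t \<in> carrier T.T" "u \<in> carrier T.T" for t u
    using h that by (simp add: linear_map_def tensor_simps(1,2))
  have hs: "h (T.pure (r \<odot>\<^bsub>symm_bimodule X\<^esub> u) v) = r \<odot>\<^bsub>Z\<^esub> h (T.pure u v)"
    if "r \<in> carrier R" "u \<in> carrier (symm_bimodule X)" "v \<in> carrier (symm_bimodule Y)" for r u v
  proof -
    have "h (r \<odot>\<^bsub>T.XY\<^esub> T.pure u v) = r \<odot>\<^bsub>Z\<^esub> h (T.pure u v)"
      using h that unfolding linear_map_def by (simp only: tensor_simps(1) T.pure_closed)
    then show ?thesis using that by simp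
  qed
  have swap: "T.pure u (r \<odot>\<^bsub>symm_bimodule Y\<^esub> v) = T.pure (r \<odot>\<^bsub>symm_bimodule X\<^esub> u) v"
    if "r \<in> carrier R" "u \<in> carrier (symm_bimodule X)" "v \<in> carrier (symm_bimodule Y)" for r u v
    using T.pure_balanced[OF that(2,1,3)] by (simp add: symm_bimodule_simps)
  have Z: "module R Z" using h by (simp add: linear_map_def)
  show ?thesis
    unfolding bilinear_map_def linear_map_def
    by (intro conjI ballI PiE_I Z X'.module_axioms Y'.module_axioms)
      (simp_all add: hc T.pure_add_left T.pure_add_right ha hs swap)
qed

context eval_data begin

sublocale P: cup_pair R A H MD.TM
  by (rule cup_pair.intro[OF central_H MD.central_twist])

lemma bimod_hom_chi:
  assumes \<chi>: "is_chi \<chi>" shows "bimod_hom R A HML.XY ND.TM \<chi>"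
proof -
  have "add_map HML.XY ND.TM \<chi>"
    using chi_add_map[OF \<chi>] by (simp add: add_map_def tensor_simps(1,2))
  moreover have sm: "\<chi> (a \<odot>\<^bsub>HML.XY\<^esub> x) = a \<odot>\<^bsub>ND.TM\<^esub> \<chi> x" and rs: "\<chi> (rsmult HML.XY x a) = rsmult ND.TM (\<chi> x) a"
    if "x \<in> carrier HML.XY" "a \<in> carrier A" for a x
    using \<chi> that by (simp_all add: is_chi_def bimodule_hom_def)
  ultimately show ?thesis
    by (intro bimod_hom.intro bimod_map.intro bimod_map_axioms.intro bimod_hom_axioms.intro
        P.XY.central_bimod_axioms ND.central_twist) (simp_all only: P.XY.one_smult_closed)
qed

lemma dot_cup_linear:
  assumes \<chi>: "is_chi \<chi>"
  shows "linear_map R (tensor R (symm_bimodule P.HX) (symm_bimodule P.HY)) (HH R A ND.TM)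
    (compose (carrier (tensor R (symm_bimodule P.HX) (symm_bimodule P.HY)))
      (HH_map R A HML.XY ND.TM \<chi>) (cup_product R A H MD.TM))"
  by (rule linear_map_compose[OF P.cup_product_linear bimod_hom.HH_map_linear[OF bimod_hom_chi[OF \<chi>]]])

end

theorem mainTheorem7:
  fixes R :: "('r, 'p) ring_scheme"
    and A :: "('r, 'a, 'q) module_scheme"
    and M :: "('a, 'm, 'e) module_scheme"
    and N :: "('a, 'n, 'f) module_scheme"
    and lam :: "'a \<Rightarrow> (('k::field_char_0 \<times> 'r) \<Rightarrow>\<^sub>0 int) set"
  assumes "cring R"
    and "algebra R A"
    and "module A M"
    and "module A N"
    and "\<forall>x::'k. algebraic x"
    and "lam \<in> alg_hom R A (integers_algebra R)"
  shows "let H = Hom_bimodule R A M N;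
             ML = twist A M lam;
             NL = twist A N lam;
             HR = restrict_scalars A H;
             MR = restrict_scalars A ML;
             is_chi = (\<lambda>\<chi>. bimodule_hom R A (tensor A H ML) NL \<chi>
               \<and> compose (carrier (tensor R HR MR)) \<chi> (tensor_quotient R A H ML)
                   = evaluation_map R A M N lam);
             X = symm_bimodule (HH R A H);
             Y = symm_bimodule (HH R A ML)
         in (\<exists>!\<chi>. is_chi \<chi>) \<and>
            (\<forall>\<chi>. is_chi \<chi> \<longrightarrow>
               (let dot_cup = compose (carrier (tensor R X Y))
                      (HH_map R A (tensor A H ML) NL \<chi>) (cup_product R A H ML)
                in linear_map R (tensor R X Y) (HH R A NL) dot_cup
                   \<and> bilinear_map R X Y (HH R A NL)
                       (\<lambda>u v. dot_cup (pure_tensor R X Y u v))))"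
proof -
  have "twist_data R A M lam" "twist_data R A N lam"
    using assms by (simp_all add: twist_data_def twist_data_axioms_def)
  then interpret eval_data R A M N lam by (rule eval_data.intro)
  show ?thesis
    unfolding Let_def is_chi_def[symmetric]
  proof (intro conjI allI impI)
    show "\<exists>!\<chi>. is_chi \<chi>" by (rule ex1I[where P = is_chi, OF chi_exists]) (rule chi_unique[OF _ chi_exists])
    fix \<chi> assume \<chi>: "is_chi \<chi>"
    note lin = dot_cup_linear[OF \<chi>]
    show "linear_map R (tensor R (symm_bimodule P.HX) (symm_bimodule P.HY)) (HH R A ND.TM)
      (compose (carrier (tensor R (symm_bimodule P.HX) (symm_bimodule P.HY)))
        (HH_map R A HML.XY ND.TM \<chi>) (cup_product R A H MD.TM))" by (rule lin)
    show "bilinear_map R (symm_bimodule P.HX) (symm_bimodule P.HY) (HH R A ND.TM)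
      (\<lambda>u v. compose (carrier (tensor R (symm_bimodule P.HX) (symm_bimodule P.HY)))
        (HH_map R A HML.XY ND.TM \<chi>) (cup_product R A H MD.TM)
        (pure_tensor R (symm_bimodule P.HX) (symm_bimodule P.HY) u v))"
      by (rule bilinear_of_linear[OF H.HH_module TM.HH_module lin])
  qed
qed

end
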